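(* Let $\mathbb G$ be a connected reductive algebraic group defined over $F$, let $(J,\lambda)$ be a type in $G=\mathbb G(F)$, with $\lambda$ acting on $W$, and let $(\pi,\mathcal V)$ be an irreducible representation in $\mathcal S_\lambda(G)$. Assume that $\mathrm{Hom}_J(\lambda,\pi)$ is $1$-dimensional, and let $\chi$ be the character of $\mathcal H_\lambda$ afforded by this module. Let ${}_\chi\bar{\mathcal H}_\lambda=\{\Psi\in\bar{\mathcal H}_\lambda\ ;\ \varphi\star\Psi=\chi(\varphi)\Psi\ \ \forall\varphi\in\mathcal H_\lambda\}$. (i) The space ${}_\chi\bar{\mathcal H}_\lambda$ is of dimension $\leqslant1$. (ii) For any $\Psi\in{}_\chi\bar{\mathcal H}_\lambda$, $w\in W$ and $\tilde w\in\tilde W$, the formula $$c_{\Psi,w,\tilde w}(g)=\langle w,\Psi(g^{-1})\tilde w\rangle_\lambda,\qquad g\in G,$$ defines a matrix coefficient of $\pi$.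
   Context: $F$ is a non-archimedean, non-discrete, locally compact field of any characteristic. All representations are on complex vector spaces. $\mathcal S(G)$ is the category of smooth representations of $G$. Let $J$ be a compact open subgroup of $G$ and $(\lambda,W)$ an irreducible smooth representation of $J$; $\mathcal S_\lambda(G)$ is the full subcategory of $\mathcal S(G)$ of representations generated as $G$-modules by their $\lambda$-isotypic component. $(J,\lambda)$ is a type if $\mathcal S_\lambda(G)$ is stable under taking subquotients. $(\tilde\lambda,\tilde W)$ is the contragredient of $\lambda$, $\langle\ ,\ \rangle_\lambda$ the natural pairing between $W$ and $\tilde W$. $\bar{\mathcal H}_\lambda$ is the space of all functions $\Psi:G\to\mathrm{End}_{\mathbb C}(\tilde W)$ (no support condition) with $\Psi(j_1gj_2)=\tilde\lambda(j_1)\circ\Psi(g)\circ\tilde\lambda(j_2)$ for $j_1,j_2\in J$, $g\in G$; $\mathcal H_\lambda=\mathcal H(G,\lambda)$ is the subspace of compactly supported ones. For $\varphi\in\mathcal H_\lambda,\Psi\in\bar{\mathcal H}_\lambda$, $(\varphi\star\Psi)(g)=\sum_{x\in J\backslash G}\varphi(gx^{-1})\Psi(x)$ (a finite sum); this makes $\mathcal H_\lambda$ an algebra (convolution for the Haar measure on $G$ giving $J$ volume $1$). $\mathrm{ind}_J^G\lambda$ is the space of compactly supported $f:G\to W$ with $f(jg)=\lambda(j)f(g)$, $G$ acting by right translation. For $\varphi\in\mathcal H_\lambda$ put $\tilde\varphi(g)={}^t\varphi(g^{-1})\in\mathrm{End}_{\mathbb C}(W)$ and $(\tilde\varphi\star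 f)(g)=\sum_{x\in G/J}\tilde\varphi(x)f(x^{-1}g)$. $\mathrm{Hom}_J(\lambda,\pi)=\mathrm{Hom}_J(W,\mathcal V)\simeq\mathrm{Hom}_G(\mathrm{ind}_J^G\lambda,\mathcal V)$ is a left $\mathcal H_\lambda$-module by $(\varphi\cdot\alpha)(f)=\alpha(\tilde\varphi\star f)$. A matrix coefficient of $\pi$ is a function $g\mapsto\langle\pi(g)v,\tilde v\rangle$ with $v\in\mathcal V$ and $\tilde v$ in the contragredient $\tilde{\mathcal V}$. *)

theory Defs
  imports
    "HOL-Analysis.Analysis"
    "HOL-Algebra.Left_Coset"
    "HOL-Algebra.Ideal"
    "HOL-Algebra.Algebraic_Closure_Type"
    "HOL-Library.Poly_Mapping"
    "Jordan_Normal_Form.Missing_VectorSpace"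
begin

section \<open>Non-archimedean local fields\<close>

text \<open>The topology of the field is the one given by an absolute value \<open>v\<close>; non-discreteness is
  the non-triviality of \<open>v\<close>.  The characteristic is arbitrary.\<close>

definition field_topology :: "('f::field \<Rightarrow> real) \<Rightarrow> 'f topology" where
  "field_topology v = Metric_space.mtopology UNIV (\<lambda>x y. v (x - y))"

locale nonarch_local_field =
  fixes v :: "'f::field \<Rightarrow> real"
  assumes nonneg: "v x \<ge> 0"
    and eq_0_iff: "v x = 0 \<longleftrightarrow> x = 0"
    and mult: "v (x * y) = v x * v y"
    and ultrametric: "v (x + y) \<le> max (v x) (v y)"
    and nontrivial: "\<exists>x. x \<noteq> 0 \<and> v x \<noteq> 1"
    and locally_compact: "locally_compact_space (field_topology v)"

section \<open>Linear algebraic groups over a field\<close>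

text \<open>As in Borel's book, a linear algebraic group is a Zariski closed subgroup of
  \<open>GL\<^sub>n\<close> over the algebraic closure.  The regular functions on \<open>GL\<^sub>n\<close> are
  the polynomials in the matrix entries (variables \<open>Some (i, j)\<close>) and in the inverse of the
  determinant (variable \<open>None\<close>).\<close>

type_synonym ('n, 'a) gl_poly = "(('n \<times> 'n) option \<Rightarrow>\<^sub>0 nat) \<Rightarrow>\<^sub>0 'a"

definition poly_eval :: "(('i \<Rightarrow>\<^sub>0 nat) \<Rightarrow>\<^sub>0 'a) \<Rightarrow> ('i \<Rightarrow> 'a) \<Rightarrow> 'a::comm_semiring_1" where
  "poly_eval p x =
     (\<Sum>m\<in>Poly_Mapping.keys p. Poly_Mapping.lookup p m *
        (\<Prod>i\<in>Poly_Mapping.keys m. x i ^ Poly_Mapping.lookup m i))"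

definition gl_coords :: "'a::field ^ 'n ^ 'n \<Rightarrow> ('n \<times> 'n) option \<Rightarrow> 'a" where
  "gl_coords A k = (case k of None \<Rightarrow> inverse (det A) | Some (i, j) \<Rightarrow> A $ i $ j)"

definition gl_group :: "('a::field ^ 'n ^ 'n) monoid" where
  "gl_group = \<lparr>carrier = {A. invertible A}, mult = (**), one = mat 1\<rparr>"

definition zariski_topology :: "('a::field ^ 'n ^ 'n) topology" where
  "zariski_topology = topology_generated_by
     (range (\<lambda>p :: ('n, 'a) gl_poly. {A \<in> carrier gl_group. poly_eval p (gl_coords A) \<noteq> 0}))"

definition vanishing_ideal :: "('a::field ^ 'n ^ 'n) set \<Rightarrow> ('n, 'a) gl_poly set" where
  "vanishing_ideal S = {p. \<forall>A\<in>S. poly_eval p (gl_coords A) = 0}"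

definition rational_polys :: "('n, 'f::field alg_closure) gl_poly set" where
  "rational_polys = {p. \<forall>m. Poly_Mapping.lookup p m \<in> range to_ac}"

definition algebraic_group_over :: "('f::field alg_closure ^ 'n ^ 'n) set \<Rightarrow> bool" where
  "algebraic_group_over GG \<longleftrightarrow>
     subgroup GG gl_group \<and> closedin zariski_topology GG \<and>
     vanishing_ideal GG =
       Idl\<^bsub>ring_of_type_algebra\<^esub> (vanishing_ideal GG \<inter> rational_polys)"

definition unipotent :: "'a::field ^ 'n ^ 'n \<Rightarrow> bool" where
  "unipotent A \<longleftrightarrow> (\<exists>k. (((**) (A - mat 1)) ^^ k) (mat 1) = 0)"

text \<open>Triviality of the unipotent radical (over the algebraic closure).\<close>

definition reductive :: "('a::field ^ 'n ^ 'n) set \<Rightarrow> bool" where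
  "reductive GG \<longleftrightarrow>
     (\<forall>U. U \<lhd> gl_group\<lparr>carrier := GG\<rparr> \<and> closedin zariski_topology U \<and>
          connectedin zariski_topology U \<and> (\<forall>A\<in>U. unipotent A) \<longrightarrow> U = {mat 1})"

definition connected_reductive_group_over :: "('f::field alg_closure ^ 'n ^ 'n) set \<Rightarrow> bool" where
  "connected_reductive_group_over GG \<longleftrightarrow>
     algebraic_group_over GG \<and> connectedin zariski_topology GG \<and> reductive GG"

definition rational_points ::
    "('f::field alg_closure ^ 'n ^ 'n) set \<Rightarrow> ('f ^ 'n ^ 'n) monoid" where
  "rational_points GG = gl_group\<lparr>carrier := {A. (\<chi> i j. to_ac (A $ i $ j)) \<in> GG}\<rparr>"

definition rational_points_topology ::
    "('f::field \<Rightarrow> real) \<Rightarrow> ('f alg_closure ^ 'n ^ 'n) set \<Rightarrow> ('f ^ 'n ^ 'n) topology" where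
  "rational_points_topology v GG =
     subtopology
       (pullback_topology UNIV (\<lambda>A (i, j). A $ i $ j)
          (product_topology (\<lambda>_. field_topology v) UNIV))
       (carrier (rational_points GG))"

section \<open>Complex vector spaces\<close>

abbreviation CC :: "complex ring" where
  "CC \<equiv> ring_of_type_algebra"

definition complex_line :: "(complex, complex) module" where
  "complex_line =
     \<lparr>carrier = UNIV, mult = (*), one = 1, zero = 0, add = (+), smult = (*)\<rparr>"

text \<open>A set \<open>S\<close> of functions from \<open>D\<close> to \<open>M\<close> (extensional on \<open>D\<close>) with the pointwise operations.
  The multiplicative fields of the record play no role for modules.\<close>

definition pointwise_module ::
    "'x set \<Rightarrow> (complex, 'm) module \<Rightarrow> ('x \<Rightarrow> 'm) set \<Rightarrow> (complex, 'x \<Rightarrow> 'm) module" where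
  "pointwise_module D M S =
     \<lparr>carrier = S, mult = undefined, one = undefined,
      zero = (\<lambda>x\<in>D. \<zero>\<^bsub>M\<^esub>), add = (\<lambda>f g. \<lambda>x\<in>D. f x \<oplus>\<^bsub>M\<^esub> g x),
      smult = (\<lambda>c f. \<lambda>x\<in>D. c \<odot>\<^bsub>M\<^esub> f x)\<rparr>"

definition linear_maps ::
    "(complex, 'v) module \<Rightarrow> (complex, 'w) module \<Rightarrow> ('v \<Rightarrow> 'w) set" where
  "linear_maps V W = module_hom CC V W \<inter> extensional (carrier V)"

definition End_space :: "(complex, 'v) module \<Rightarrow> (complex, 'v \<Rightarrow> 'v) module" where
  "End_space V = pointwise_module (carrier V) V (linear_maps V V)"

text \<open>The sum of a family all but finitely many of whose members vanish (\<^const>\<open>finsum\<close> itself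
  returns zero over an infinite index set).\<close>

definition finsum_supp :: "(complex, 'v) module \<Rightarrow> ('i \<Rightarrow> 'v) \<Rightarrow> 'i set \<Rightarrow> 'v" where
  "finsum_supp V t I = finsum V t {i \<in> I. t i \<noteq> \<zero>\<^bsub>V\<^esub>}"

section \<open>Smooth representations of a topological group\<close>

text \<open>A group is a pair of a monoid record \<open>G\<close> and a topology \<open>T\<close> on its carrier, a representation
  a pair of a complex vector space and an action.  A subgroup \<open>J\<close> is considered
  as the group \<open>G\<lparr>carrier := J\<rparr>\<close> with topology \<open>subtopology T J\<close>.\<close>

type_synonym ('g, 'v) rep = "(complex, 'v) module \<times> ('g \<Rightarrow> 'v \<Rightarrow> 'v)"

definition is_rep :: "'g monoid \<Rightarrow> ('g, 'v) rep \<Rightarrow> bool" where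
  "is_rep G = (\<lambda>(V, \<rho>).
     vectorspace CC V \<and>
     (\<forall>g\<in>carrier G. \<rho> g \<in> module_hom CC V V) \<and>
     (\<forall>v\<in>carrier V. \<rho> \<one>\<^bsub>G\<^esub> v = v) \<and>
     (\<forall>g\<in>carrier G. \<forall>h\<in>carrier G. \<forall>v\<in>carrier V. \<rho> (g \<otimes>\<^bsub>G\<^esub> h) v = \<rho> g (\<rho> h v)))"

definition smooth_rep :: "'g monoid \<Rightarrow> 'g topology \<Rightarrow> ('g, 'v) rep \<Rightarrow> bool" where
  "smooth_rep G T = (\<lambda>(V, \<rho>).
     is_rep G (V, \<rho>) \<and> (\<forall>v\<in>carrier V. openin T {g \<in> carrier G. \<rho> g v = v}))"

definition subrep :: "'g monoid \<Rightarrow> ('g, 'v) rep \<Rightarrow> 'v set \<Rightarrow> bool" where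
  "subrep G = (\<lambda>(V, \<rho>) U. subspace CC U V \<and> (\<forall>g\<in>carrier G. \<forall>u\<in>U. \<rho> g u \<in> U))"

definition irreducible_rep :: "'g monoid \<Rightarrow> ('g, 'v) rep \<Rightarrow> bool" where
  "irreducible_rep G = (\<lambda>(V, \<rho>).
     is_rep G (V, \<rho>) \<and> carrier V \<noteq> {\<zero>\<^bsub>V\<^esub>} \<and>
     (\<forall>U. subrep G (V, \<rho>) U \<longrightarrow> U = {\<zero>\<^bsub>V\<^esub>} \<or> U = carrier V))"

definition intertwiners :: "'g monoid \<Rightarrow> ('g, 'v) rep \<Rightarrow> ('g, 'w) rep \<Rightarrow> ('v \<Rightarrow> 'w) set" where
  "intertwiners G = (\<lambda>(V, \<rho>) (W, \<sigma>).
     {\<alpha> \<in> linear_maps V W. \<forall>g\<in>carrier G. \<forall>v\<in>carrier V. \<alpha> (\<rho> g v) = \<sigma> g (\<alpha> v)})"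

definition hom_space ::
    "'g monoid \<Rightarrow> ('g, 'v) rep \<Rightarrow> ('g, 'w) rep \<Rightarrow> (complex, 'v \<Rightarrow> 'w) module" where
  "hom_space G R S = pointwise_module (carrier (fst R)) (fst S) (intertwiners G R S)"

text \<open>Subrepresentations are literal subspaces, quotients are given by surjective intertwiners.\<close>

definition subquotient :: "'g monoid \<Rightarrow> ('g, 'w) rep \<Rightarrow> ('g, 'v) rep \<Rightarrow> bool" where
  "subquotient G = (\<lambda>S (V, \<rho>).
     is_rep G S \<and>
     (\<exists>U q. subrep G (V, \<rho>) U \<and> q \<in> intertwiners G (V\<lparr>carrier := U\<rparr>, \<rho>) S \<and>
            q ` U = carrier (fst S)))"

definition contragredient_action ::
    "'g monoid \<Rightarrow> ('g, 'v) rep \<Rightarrow> 'g \<Rightarrow> ('v \<Rightarrow> complex) \<Rightarrow> 'v \<Rightarrow> complex" where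
  "contragredient_action G = (\<lambda>(V, \<rho>) g \<xi>. \<lambda>v\<in>carrier V. \<xi> (\<rho> (inv\<^bsub>G\<^esub> g) v))"

text \<open>The elements of the contragredient are functionals, so that the natural pairing of \<open>v\<close> and
  \<open>\<xi>\<close> is simply \<open>\<xi> v\<close>.\<close>

definition contragredient ::
    "'g monoid \<Rightarrow> 'g topology \<Rightarrow> ('g, 'v) rep \<Rightarrow> ('g, 'v \<Rightarrow> complex) rep" where
  "contragredient G T R =
     (pointwise_module (carrier (fst R)) complex_line
        {\<xi> \<in> linear_maps (fst R) complex_line.
           openin T {g \<in> carrier G. contragredient_action G R g \<xi> = \<xi>}},
      contragredient_action G R)"

definition matrix_coefficient ::
    "'g monoid \<Rightarrow> 'g topology \<Rightarrow> ('g, 'v) rep \<Rightarrow> ('g \<Rightarrow> complex) \<Rightarrow> bool" where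
  "matrix_coefficient G T = (\<lambda>(V, \<rho>) c.
     \<exists>v\<in>carrier V. \<exists>\<xi>\<in>carrier (fst (contragredient G T (V, \<rho>))).
       \<forall>g\<in>carrier G. c g = \<xi> (\<rho> g v))"

section \<open>Types\<close>

text \<open>The span of all \<open>J\<close>-subspaces isomorphic to \<open>\<lambda>\<close>.\<close>

definition isotypic_component ::
    "'g monoid \<Rightarrow> 'g set \<Rightarrow> ('g, 'w) rep \<Rightarrow> ('g, 'v) rep \<Rightarrow> 'v set" where
  "isotypic_component G J lam R =
     LinearCombinations.module.span CC (fst R)
       (\<Union>{\<alpha> ` carrier (fst lam) | \<alpha>.
            \<alpha> \<in> intertwiners (G\<lparr>carrier := J\<rparr>) lam R \<and> inj_on \<alpha> (carrier (fst lam))})"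

definition S_cat ::
    "'g monoid \<Rightarrow> 'g topology \<Rightarrow> 'g set \<Rightarrow> ('g, 'w) rep \<Rightarrow> ('g, 'v) rep set" where
  "S_cat G T J lam =
     {R. smooth_rep G T R \<and>
         (\<forall>U. subrep G R U \<and> isotypic_component G J lam R \<subseteq> U \<longrightarrow> U = carrier (fst R))}"

text \<open>As HOL has no quantification over types, the category of all representations is rendered by
  the category of representations whose underlying set is contained in a type \<open>'u\<close>.  This is no restriction as
  soon as \<open>'u\<close> has at least the cardinality of the continuum, in particular as soon as some nonzero
  complex vector space lives in it: for the groups considered here, \<open>G/J\<close> is countable and an
  instance of instability can be found inside a finitely generated smooth representation, which
  has countable dimension.\<close>

definition is_type ::
    "'u itself \<Rightarrow> 'g monoid \<Rightarrow> 'g topology \<Rightarrow> 'g set \<Rightarrow> ('g, 'w) rep \<Rightarrow> bool" where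
  "is_type (U :: 'u itself) G T J lam \<longleftrightarrow>
     subgroup J G \<and> compactin T J \<and> openin T J \<and>
     smooth_rep (G\<lparr>carrier := J\<rparr>) (subtopology T J) lam \<and>
     irreducible_rep (G\<lparr>carrier := J\<rparr>) lam \<and>
     (\<forall>(R :: ('g, 'u) rep) (S :: ('g, 'u) rep).
        R \<in> S_cat G T J lam \<and> subquotient G S R \<longrightarrow> S \<in> S_cat G T J lam)"

section \<open>The Hecke algebra\<close>

definition contra_J ::
    "'g monoid \<Rightarrow> 'g topology \<Rightarrow> 'g set \<Rightarrow> ('g, 'w) rep \<Rightarrow> ('g, 'w \<Rightarrow> complex) rep" where
  "contra_J G T J lam = contragredient (G\<lparr>carrier := J\<rparr>) (subtopology T J) lam"

abbreviation W_dual ::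
    "'g monoid \<Rightarrow> 'g topology \<Rightarrow> 'g set \<Rightarrow> ('g, 'w) rep \<Rightarrow> (complex, 'w \<Rightarrow> complex) module" where
  "W_dual G T J lam \<equiv> fst (contra_J G T J lam)"

definition compactly_supported ::
    "'g monoid \<Rightarrow> 'g topology \<Rightarrow> (complex, 'm) module \<Rightarrow> ('g \<Rightarrow> 'm) \<Rightarrow> bool" where
  "compactly_supported G T M f \<longleftrightarrow> compactin T (T closure_of {g \<in> carrier G. f g \<noteq> \<zero>\<^bsub>M\<^esub>})"

definition Hecke_bar ::
    "'g monoid \<Rightarrow> 'g topology \<Rightarrow> 'g set \<Rightarrow> ('g, 'w) rep \<Rightarrow>
      (complex, 'g \<Rightarrow> ('w \<Rightarrow> complex) \<Rightarrow> 'w \<Rightarrow> complex) module" where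
  "Hecke_bar G T J lam =
     (let W' = W_dual G T J lam; lam' = snd (contra_J G T J lam) in
      pointwise_module (carrier G) (End_space W')
        {\<Psi> \<in> carrier G \<rightarrow>\<^sub>E carrier (End_space W').
           \<forall>j\<^sub>1\<in>J. \<forall>j\<^sub>2\<in>J. \<forall>g\<in>carrier G.
             \<Psi> (j\<^sub>1 \<otimes>\<^bsub>G\<^esub> g \<otimes>\<^bsub>G\<^esub> j\<^sub>2) =
               compose (carrier W') (lam' j\<^sub>1) (compose (carrier W') (\<Psi> g) (lam' j\<^sub>2))})"

definition Hecke ::
    "'g monoid \<Rightarrow> 'g topology \<Rightarrow> 'g set \<Rightarrow> ('g, 'w) rep \<Rightarrow>
      ('g \<Rightarrow> ('w \<Rightarrow> complex) \<Rightarrow> 'w \<Rightarrow> complex) set" where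
  "Hecke G T J lam =
     {\<phi> \<in> carrier (Hecke_bar G T J lam).
        compactly_supported G T (End_space (W_dual G T J lam)) \<phi>}"

text \<open>In the following sums over \<open>J\G\<close> and \<open>G/J\<close> the summand does not depend on the choice of the
  representative of the coset.\<close>

definition coset_rep :: "'g set \<Rightarrow> 'g" where
  "coset_rep C = (SOME x. x \<in> C)"

definition Hecke_conv ::
    "'g monoid \<Rightarrow> 'g topology \<Rightarrow> 'g set \<Rightarrow> ('g, 'w) rep \<Rightarrow>
      ('g \<Rightarrow> ('w \<Rightarrow> complex) \<Rightarrow> 'w \<Rightarrow> complex) \<Rightarrow>
      ('g \<Rightarrow> ('w \<Rightarrow> complex) \<Rightarrow> 'w \<Rightarrow> complex) \<Rightarrow>
      'g \<Rightarrow> ('w \<Rightarrow> complex) \<Rightarrow> 'w \<Rightarrow> complex" where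
  "Hecke_conv G T J lam \<phi> \<Psi> =
     (let W' = W_dual G T J lam in
      (\<lambda>g\<in>carrier G.
        finsum_supp (End_space W')
          (\<lambda>C. compose (carrier W') (\<phi> (g \<otimes>\<^bsub>G\<^esub> inv\<^bsub>G\<^esub> (coset_rep C))) (\<Psi> (coset_rep C)))
          (rcosets\<^bsub>G\<^esub> J)))"

definition compact_ind ::
    "'g monoid \<Rightarrow> 'g topology \<Rightarrow> 'g set \<Rightarrow> ('g, 'w) rep \<Rightarrow> ('g, 'g \<Rightarrow> 'w) rep" where
  "compact_ind G T J lam =
     (pointwise_module (carrier G) (fst lam)
        {f \<in> carrier G \<rightarrow>\<^sub>E carrier (fst lam).
           (\<forall>j\<in>J. \<forall>g\<in>carrier G. f (j \<otimes>\<^bsub>G\<^esub> g) = snd lam j (f g)) \<and>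
           compactly_supported G T (fst lam) f},
      \<lambda>g f. \<lambda>x\<in>carrier G. f (x \<otimes>\<^bsub>G\<^esub> g))"

text \<open>The transpose of an endomorphism \<open>B\<close> of the dual of \<open>W\<close>, as an endomorphism of \<open>W\<close>
  (\<open>W\<close> is finite-dimensional, being irreducible and smooth under a compact group).\<close>

definition transpose_End ::
    "(complex, 'w) module \<Rightarrow> (complex, 'w \<Rightarrow> complex) module \<Rightarrow>
      (('w \<Rightarrow> complex) \<Rightarrow> 'w \<Rightarrow> complex) \<Rightarrow> 'w \<Rightarrow> 'w" where
  "transpose_End W W' B =
     (\<lambda>w\<in>carrier W. THE u. u \<in> carrier W \<and> (\<forall>\<xi>\<in>carrier W'. \<xi> u = B \<xi> w))"

definition Hecke_tilde ::
    "'g monoid \<Rightarrow> 'g topology \<Rightarrow> 'g set \<Rightarrow> ('g, 'w) rep \<Rightarrow>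
      ('g \<Rightarrow> ('w \<Rightarrow> complex) \<Rightarrow> 'w \<Rightarrow> complex) \<Rightarrow> 'g \<Rightarrow> 'w \<Rightarrow> 'w" where
  "Hecke_tilde G T J lam \<phi> g =
     transpose_End (fst lam) (W_dual G T J lam) (\<phi> (inv\<^bsub>G\<^esub> g))"

definition Hecke_ind_conv ::
    "'g monoid \<Rightarrow> 'g topology \<Rightarrow> 'g set \<Rightarrow> ('g, 'w) rep \<Rightarrow>
      ('g \<Rightarrow> ('w \<Rightarrow> complex) \<Rightarrow> 'w \<Rightarrow> complex) \<Rightarrow> ('g \<Rightarrow> 'w) \<Rightarrow> 'g \<Rightarrow> 'w" where
  "Hecke_ind_conv G T J lam \<phi> f =
     (\<lambda>g\<in>carrier G.
        finsum_supp (fst lam)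
          (\<lambda>C. Hecke_tilde G T J lam \<phi> (coset_rep C) (f (inv\<^bsub>G\<^esub> (coset_rep C) \<otimes>\<^bsub>G\<^esub> g)))
          (lcosets\<^bsub>G\<^esub> J))"

text \<open>Frobenius reciprocity: \<open>A\<close> corresponds to \<open>w \<mapsto> A f\<^sub>w\<close>, where \<open>f\<^sub>w\<close> is the function in the
  compactly induced representation supported on \<open>J\<close> with value \<open>w\<close> at the identity.\<close>

definition frobenius ::
    "'g monoid \<Rightarrow> 'g set \<Rightarrow> ('g, 'w) rep \<Rightarrow> (('g \<Rightarrow> 'w) \<Rightarrow> 'v) \<Rightarrow> 'w \<Rightarrow> 'v" where
  "frobenius G J lam A =
     (\<lambda>w\<in>carrier (fst lam).
        A (\<lambda>g\<in>carrier G. if g \<in> J then snd lam g w else \<zero>\<^bsub>fst lam\<^esub>))"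

definition Hecke_act_ind ::
    "'g monoid \<Rightarrow> 'g topology \<Rightarrow> 'g set \<Rightarrow> ('g, 'w) rep \<Rightarrow>
      ('g \<Rightarrow> ('w \<Rightarrow> complex) \<Rightarrow> 'w \<Rightarrow> complex) \<Rightarrow> (('g \<Rightarrow> 'w) \<Rightarrow> 'v) \<Rightarrow> ('g \<Rightarrow> 'w) \<Rightarrow> 'v" where
  "Hecke_act_ind G T J lam \<phi> A =
     (\<lambda>f\<in>carrier (fst (compact_ind G T J lam)). A (Hecke_ind_conv G T J lam \<phi> f))"

definition Hecke_act ::
    "'g monoid \<Rightarrow> 'g topology \<Rightarrow> 'g set \<Rightarrow> ('g, 'w) rep \<Rightarrow> ('g, 'v) rep \<Rightarrow>
      ('g \<Rightarrow> ('w \<Rightarrow> complex) \<Rightarrow> 'w \<Rightarrow> complex) \<Rightarrow> ('w \<Rightarrow> 'v) \<Rightarrow> 'w \<Rightarrow> 'v" where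
  "Hecke_act G T J lam R \<phi> \<alpha> =
     frobenius G J lam (Hecke_act_ind G T J lam \<phi>
       (the_inv_into (intertwiners G (compact_ind G T J lam) R) (frobenius G J lam) \<alpha>))"

definition Hom_J ::
    "'g monoid \<Rightarrow> 'g set \<Rightarrow> ('g, 'w) rep \<Rightarrow> ('g, 'v) rep \<Rightarrow> (complex, 'w \<Rightarrow> 'v) module" where
  "Hom_J G J lam R = hom_space (G\<lparr>carrier := J\<rparr>) lam R"

definition affords_character ::
    "'g monoid \<Rightarrow> 'g topology \<Rightarrow> 'g set \<Rightarrow> ('g, 'w) rep \<Rightarrow> ('g, 'v) rep \<Rightarrow>
      (('g \<Rightarrow> ('w \<Rightarrow> complex) \<Rightarrow> 'w \<Rightarrow> complex) \<Rightarrow> complex) \<Rightarrow> bool" where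
  "affords_character G T J lam R chi \<longleftrightarrow>
     (\<forall>\<phi>\<in>Hecke G T J lam. \<forall>\<alpha>\<in>carrier (Hom_J G J lam R).
        Hecke_act G T J lam R \<phi> \<alpha> = chi \<phi> \<odot>\<^bsub>Hom_J G J lam R\<^esub> \<alpha>)"

definition Hecke_bar_eigen ::
    "'g monoid \<Rightarrow> 'g topology \<Rightarrow> 'g set \<Rightarrow> ('g, 'w) rep \<Rightarrow>
      (('g \<Rightarrow> ('w \<Rightarrow> complex) \<Rightarrow> 'w \<Rightarrow> complex) \<Rightarrow> complex) \<Rightarrow>
      (complex, 'g \<Rightarrow> ('w \<Rightarrow> complex) \<Rightarrow> 'w \<Rightarrow> complex) module" where
  "Hecke_bar_eigen G T J lam chi =
     (Hecke_bar G T J lam)\<lparr>carrier :=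
        {\<Psi> \<in> carrier (Hecke_bar G T J lam).
           \<forall>\<phi>\<in>Hecke G T J lam.
             Hecke_conv G T J lam \<phi> \<Psi> = chi \<phi> \<odot>\<^bsub>Hecke_bar G T J lam\<^esub> \<Psi>}\<rparr>"

end

theory Submission imports Defs "HOL-Algebra.Free_Abelian_Groups" begin

text \<open>
  Write \<open>X\<close> for the representation compactly induced from \<open>\<lambda>\<close> and \<open>f\<^sub>w\<close> for the function in \<open>X\<close> supported
  on \<open>J\<close> with value \<open>w\<close> at the identity.  The \<open>f\<^sub>w\<close> generate \<open>X\<close>, and by Frobenius reciprocity a generator
  \<open>\<alpha>\<close> of the line \<open>Hom\<^sub>J(\<lambda>, \<pi>)\<close> extends to a \<open>G\<close>-map \<open>A : X \<rightarrow> V\<close> with \<open>A f\<^sub>w = \<alpha> w\<close>.  That the line affords \<open>\<chi>\<close>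
  means \<open>A (\<phi>~ * f\<^sub>w) = \<chi>(\<phi>) \<alpha> w\<close>, and every \<open>J\<close>-map from \<open>W\<close> to \<open>X\<close> has the form \<open>w \<mapsto> \<phi>~ * f\<^sub>w\<close> for an element
  \<open>\<phi>\<close> of the Hecke algebra (\<open>Hom_ind_eq_Hecke\<close>).

  A function \<open>\<Psi>\<close> in the big Hecke space amounts to a family of linear functionals \<open>l\<^sub>\<xi>\<close> on \<open>X\<close>, with
  \<open>l\<^sub>\<xi> (g f\<^sub>w) = \<langle>w, \<Psi>(g\<^sup>-\<^sup>1) \<xi>\<rangle>\<close>, and \<open>\<Psi>\<close> is an eigenfunction if and only if
  \<open>l\<^sub>\<xi> (g (\<phi>~ * f\<^sub>w)) = \<chi>(\<phi>) l\<^sub>\<xi> (g f\<^sub>w)\<close> for all \<open>\<phi>\<close> and \<open>g\<close> (\<open>Hecke_eigen_iff\<close>).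

  For the second assertion it suffices that \<open>l\<^sub>\<xi>\<close> vanishes on the kernel \<open>N\<close> of \<open>A\<close>: then \<open>l\<^sub>\<xi> = \<zeta> \<circ> A\<close> for a
  functional \<open>\<zeta>\<close> on \<open>V\<close>, which is smooth because the open kernel of \<open>\<lambda>\<close> fixes it, and
  \<open>\<langle>w, \<Psi>(g\<^sup>-\<^sup>1) \<xi>\<rangle> = \<zeta> (\<pi>(g) \<alpha> w)\<close>.  Let \<open>K\<close> be the largest subrepresentation of \<open>N\<close> on which all \<open>l\<^sub>\<xi>\<close> vanish.
  As \<open>X/K\<close> is generated by its \<open>\<lambda>\<close>-isotypic component and \<open>\<lambda>\<close> is a type, \<open>N/K\<close> is also generated by its
  \<open>\<lambda>\<close>-isotypic component.  But a \<open>J\<close>-map from \<open>W\<close> to \<open>N/K\<close> lifts to \<open>N\<close>, because \<open>J\<close> is compact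
  (\<open>equivariant_lift\<close>), so it comes from some \<open>\<phi>\<close>; now \<open>\<chi>(\<phi>) \<alpha> w = A (\<phi>~ * f\<^sub>w) = 0\<close>, so \<open>\<chi>(\<phi>) = 0\<close>, and the
  eigenvalue equation puts the \<open>\<phi>~ * f\<^sub>w\<close> into \<open>K\<close>.  Hence \<open>N = K\<close> (\<open>kernel_eig_functional\<close>).

  For the first assertion, \<open>\<Psi>(1)\<close> commutes with \<open>J\<close>, so that composing \<open>\<alpha>\<close> with its transpose gives an element of
  the line \<open>Hom\<^sub>J(\<lambda>, \<pi>)\<close>; hence \<open>\<Psi>(1)\<close> is a scalar.  This scalar determines \<open>\<Psi>\<close>: the \<open>l\<^sub>\<xi>\<close> are the components of
  a \<open>J\<close>-map \<open>X \<rightarrow> W\<close>, which is onto if it is not zero, and then has a \<open>J\<close>-equivariant section \<open>w \<mapsto> \<phi>~ * f\<^sub>w\<close>; this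
  gives \<open>\<xi> w = l\<^sub>\<xi> (\<phi>~ * f\<^sub>w) = \<chi>(\<phi>) \<langle>w, \<Psi>(1) \<xi>\<rangle>\<close>, so that \<open>\<Psi>(1)\<close> cannot vanish (\<open>eigenfunction_zero\<close>).

  There is one set-theoretic point.  The type condition speaks of representations carried by the type
  that carries \<open>V\<close>, and \<open>X/K\<close> has to be transported there.  This is possible because \<open>G/J\<close> is countable,
  the field being separable, so that \<open>X\<close> has no more elements than \<open>V\<close> (\<open>IND_embeds\<close>).
\<close>

section \<open>Complex vector spaces\<close>

lemma CC_simps [simp]:
  "carrier CC = UNIV" "x \<oplus>\<^bsub>CC\<^esub> y = x + y" "x \<otimes>\<^bsub>CC\<^esub> y = x * y" "\<one>\<^bsub>CC\<^esub> = 1" "\<zero>\<^bsub>CC\<^esub> = 0"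
  for x y :: complex
  by (simp_all add: ring_of_type_algebra_def)

lemma field_CC: "field CC"
  by (rule field_from_type_algebra)

lemma complex_vectorspaceI:
  fixes V (structure)
  assumes "\<And>x y. \<lbrakk>x \<in> carrier V; y \<in> carrier V\<rbrakk> \<Longrightarrow> x \<oplus> y \<in> carrier V"
    and "\<zero> \<in> carrier V"
    and sm: "\<And>c x. x \<in> carrier V \<Longrightarrow> c \<odot>\<^bsub>V\<^esub> x \<in> carrier V"
    and "\<And>x y z. \<lbrakk>x \<in> carrier V; y \<in> carrier V; z \<in> carrier V\<rbrakk> \<Longrightarrow> x \<oplus> y \<oplus> z = x \<oplus> (y \<oplus> z)"
    and "\<And>x y. \<lbrakk>x \<in> carrier V; y \<in> carrier V\<rbrakk> \<Longrightarrow> x \<oplus> y = y \<oplus> x"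
    and "\<And>x. x \<in> carrier V \<Longrightarrow> \<zero> \<oplus> x = x"
    and z: "\<And>x. x \<in> carrier V \<Longrightarrow> 0 \<odot>\<^bsub>V\<^esub> x = \<zero>"
    and d: "\<And>a b x. x \<in> carrier V \<Longrightarrow> (a + b) \<odot>\<^bsub>V\<^esub> x = a \<odot>\<^bsub>V\<^esub> x \<oplus> b \<odot>\<^bsub>V\<^esub> x"
    and "\<And>a x y. \<lbrakk>x \<in> carrier V; y \<in> carrier V\<rbrakk> \<Longrightarrow> a \<odot>\<^bsub>V\<^esub> (x \<oplus> y) = a \<odot>\<^bsub>V\<^esub> x \<oplus> a \<odot>\<^bsub>V\<^esub> y"
    and "\<And>a b x. x \<in> carrier V \<Longrightarrow> (a * b) \<odot>\<^bsub>V\<^esub> x = a \<odot>\<^bsub>V\<^esub> (b \<odot>\<^bsub>V\<^esub> x)"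
    and o: "\<And>x. x \<in> carrier V \<Longrightarrow> 1 \<odot>\<^bsub>V\<^esub> x = x"
  shows "vectorspace CC V"
proof -
  have inv: "\<exists>y\<in>carrier V. y \<oplus> x = \<zero>" if x: "x \<in> carrier V" for x
    using d[OF x, of "-1" 1] z[OF x] o[OF x] sm[OF x, of "-1"] by auto
  have "abelian_group V"
    by (rule abelian_groupI) (use assms inv in auto)
  then have "module CC V"
    by (intro moduleI cring_from_type_algebra) (use assms in auto)
  then show ?thesis
    using field_CC by (simp add: vectorspace_def)
qed

text \<open>The rules of a vector space over the ring record \<open>CC\<close>, in a form where the complex numbers act
  directly.\<close>

locale cvs = vectorspace CC V for V (structure)
begin

lemma smult_cl [simp, intro]: "x \<in> carrier V \<Longrightarrow> c \<odot>\<^bsub>V\<^esub> x \<in> carrier V"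
  using smult_closed by simp

lemma smult_add: "x \<in> carrier V \<Longrightarrow> y \<in> carrier V \<Longrightarrow> c \<odot>\<^bsub>V\<^esub> (x \<oplus> y) = c \<odot>\<^bsub>V\<^esub> x \<oplus> c \<odot>\<^bsub>V\<^esub> y"
  using smult_r_distr by simp

lemma add_smult: "x \<in> carrier V \<Longrightarrow> (c + d) \<odot>\<^bsub>V\<^esub> x = c \<odot>\<^bsub>V\<^esub> x \<oplus> d \<odot>\<^bsub>V\<^esub> x"
  using smult_l_distr by simp

lemma smult_smult: "x \<in> carrier V \<Longrightarrow> c \<odot>\<^bsub>V\<^esub> (d \<odot>\<^bsub>V\<^esub> x) = (c * d) \<odot>\<^bsub>V\<^esub> x"
  using smult_assoc1 by simp

lemma one_smult [simp]: "x \<in> carrier V \<Longrightarrow> 1 \<odot>\<^bsub>V\<^esub> x = x"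
  using smult_one by simp

lemma zero_smult [simp]: "x \<in> carrier V \<Longrightarrow> 0 \<odot>\<^bsub>V\<^esub> x = \<zero>"
  using smult_l_null by simp

lemma smult_zero [simp]: "c \<odot>\<^bsub>V\<^esub> \<zero> = \<zero>"
  using smult_r_null by simp

lemma minus_eq_smult: "x \<in> carrier V \<Longrightarrow> \<ominus> x = (-1) \<odot>\<^bsub>V\<^esub> x"
  using add_smult[of x "-1" 1] by (intro minus_equality) auto

lemma smult_eq_zero: "x \<in> carrier V \<Longrightarrow> c \<odot>\<^bsub>V\<^esub> x = \<zero> \<longleftrightarrow> c = 0 \<or> x = \<zero>"
  using smult_smult[of x "inverse c" c] by (cases "c = 0") auto

lemma diff_eq_zero: "x \<in> carrier V \<Longrightarrow> y \<in> carrier V \<Longrightarrow> x \<ominus> y = \<zero> \<longleftrightarrow> x = y"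
  using minus_equality[of x "\<ominus> y"] by (auto simp: minus_eq r_neg)

lemma finsum_const:
  assumes "finite A" "x \<in> carrier V"
  shows "finsum V (\<lambda>_. x) A = of_nat (card A) \<odot>\<^bsub>V\<^esub> x"
  using assms by (induction A rule: finite_induct) (simp_all add: add_smult)

lemma smult_finsum: "finite A \<Longrightarrow> f \<in> A \<rightarrow> carrier V \<Longrightarrow> c \<odot>\<^bsub>V\<^esub> finsum V f A = (\<Oplus>i\<in>A. c \<odot>\<^bsub>V\<^esub> f i)"
  using finsum_smult_ldistr[of A c f] by simp

lemma smult_inj:
  assumes "x \<in> carrier V" "x \<noteq> \<zero>" "c \<odot>\<^bsub>V\<^esub> x = d \<odot>\<^bsub>V\<^esub> x"
  shows "c = d"
proof -
  have "(c - d) \<odot>\<^bsub>V\<^esub> x = c \<odot>\<^bsub>V\<^esub> x \<oplus> (- d) \<odot>\<^bsub>V\<^esub> x"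
    using add_smult[of x c "- d"] assms(1) by simp
  also have "\<dots> = (d - d) \<odot>\<^bsub>V\<^esub> x"
    using add_smult[of x d "- d"] assms by simp
  finally show ?thesis using assms by (simp add: smult_eq_zero)
qed

end

lemma cvsI: "vectorspace CC V \<Longrightarrow> cvs V"
  by (simp add: cvs_def)

lemma vectorspace_complex_line: "vectorspace CC complex_line"
  by (rule complex_vectorspaceI) (auto simp: complex_line_def algebra_simps)

lemma complex_line_simps [simp]:
  "carrier complex_line = UNIV" "\<zero>\<^bsub>complex_line\<^esub> = 0" "x \<oplus>\<^bsub>complex_line\<^esub> y = x + y"
  "c \<odot>\<^bsub>complex_line\<^esub> x = c * x"
  by (simp_all add: complex_line_def)

lemma finsum_complex_line: "finsum complex_line t A = sum t A"
proof -
  interpret C: cvs complex_line by (rule cvsI[OF vectorspace_complex_line])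
  show ?thesis
    by (induction A rule: infinite_finite_induct) (simp_all add: C.finsum_infinite)
qed

lemma subspace_iff:
  assumes "vectorspace CC V"
  shows "subspace CC U V \<longleftrightarrow> U \<subseteq> carrier V \<and> \<zero>\<^bsub>V\<^esub> \<in> U \<and> (\<forall>x\<in>U. \<forall>y\<in>U. x \<oplus>\<^bsub>V\<^esub> y \<in> U) \<and>
    (\<forall>c. \<forall>x\<in>U. c \<odot>\<^bsub>V\<^esub> x \<in> U)"
  using assms unfolding subspace_def submodule_def by (auto simp: vectorspace_def)

lemma subspace_subset: "subspace CC U V \<Longrightarrow> U \<subseteq> carrier V"
  using submodule.subset[of CC U V] by (simp add: subspace_def)

lemma vectorspace_subspace:
  assumes "vectorspace CC V" "subspace CC U V"
  shows "vectorspace CC (V\<lparr>carrier := U\<rparr>)"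
  using vectorspace.subspace_is_vs[OF assms] .

subsection \<open>Spaces of functions\<close>

lemma pointwise_simps [simp]:
  "carrier (pointwise_module D M S) = S" "\<zero>\<^bsub>pointwise_module D M S\<^esub> = (\<lambda>x\<in>D. \<zero>\<^bsub>M\<^esub>)"
  "f \<oplus>\<^bsub>pointwise_module D M S\<^esub> g = (\<lambda>x\<in>D. f x \<oplus>\<^bsub>M\<^esub> g x)"
  "c \<odot>\<^bsub>pointwise_module D M S\<^esub> f = (\<lambda>x\<in>D. c \<odot>\<^bsub>M\<^esub> f x)"
  by (simp_all add: pointwise_module_def)

lemma vectorspace_pointwise:
  assumes "vectorspace CC M" and S: "S \<subseteq> D \<rightarrow>\<^sub>E carrier M"
    and "(\<lambda>x\<in>D. \<zero>\<^bsub>M\<^esub>) \<in> S"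
    and "\<And>f g. f \<in> S \<Longrightarrow> g \<in> S \<Longrightarrow> (\<lambda>x\<in>D. f x \<oplus>\<^bsub>M\<^esub> g x) \<in> S"
    and "\<And>c f. f \<in> S \<Longrightarrow> (\<lambda>x\<in>D. c \<odot>\<^bsub>M\<^esub> f x) \<in> S"
  shows "vectorspace CC (pointwise_module D M S)"
proof -
  interpret M: cvs M by (rule cvsI) fact
  have cl: "f x \<in> carrier M" if "f \<in> S" "x \<in> D" for f x
    using that S by auto
  have ex: "f x = undefined" if "f \<in> S" "x \<notin> D" for f x
    using that S by (auto simp: PiE_def extensional_def)
  show ?thesis
    by (rule complex_vectorspaceI)
      (use assms(3-5) in \<open>auto simp: fun_eq_iff restrict_def cl ex M.a_assoc M.smult_add M.add_smult
        M.smult_smult intro: M.a_comm\<close>)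
qed

lemma finsum_pointwise:
  assumes "vectorspace CC (pointwise_module D M S)" "vectorspace CC M" and S: "S \<subseteq> D \<rightarrow>\<^sub>E carrier M"
    and "finite A" "t \<in> A \<rightarrow> S" "x \<in> D"
  shows "finsum (pointwise_module D M S) t A x = finsum M (\<lambda>i. t i x) A"
  using assms(4,5)
proof (induction A rule: finite_induct)
  case empty
  interpret P: cvs "pointwise_module D M S" by (rule cvsI) fact
  interpret M: cvs M by (rule cvsI) fact
  show ?case using \<open>x \<in> D\<close> by simp
next
  case (insert a A)
  interpret P: cvs "pointwise_module D M S" by (rule cvsI) fact
  interpret M: cvs M by (rule cvsI) fact
  have "(\<lambda>i. t i x) \<in> A \<rightarrow> carrier M" "t a x \<in> carrier M"
    using insert S \<open>x \<in> D\<close> by fastforce+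
  then show ?case using insert \<open>x \<in> D\<close>
    by (subst P.finsum_insert) auto
qed

lemma finsum_supp_eq:
  assumes V: "vectorspace CC V" and S: "finite S" "S \<subseteq> I" "\<And>i. i \<in> I \<Longrightarrow> t i \<noteq> \<zero>\<^bsub>V\<^esub> \<Longrightarrow> i \<in> S"
    and t: "\<And>i. i \<in> S \<Longrightarrow> t i \<in> carrier V"
  shows "finsum_supp V t I = finsum V t S"
proof -
  interpret V: cvs V by (rule cvsI) (rule V)
  show ?thesis unfolding finsum_supp_def
    by (rule V.add.finprod_mono_neutral_cong_left) (use S t in auto)
qed

subsection \<open>Linear maps\<close>

lemma module_homI:
  assumes "\<And>x. x \<in> carrier V \<Longrightarrow> f x \<in> carrier W"
    and "\<And>x y. x \<in> carrier V \<Longrightarrow> y \<in> carrier V \<Longrightarrow> f (x \<oplus>\<^bsub>V\<^esub> y) = f x \<oplus>\<^bsub>W\<^esub> f y"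
    and "\<And>c x. x \<in> carrier V \<Longrightarrow> f (c \<odot>\<^bsub>V\<^esub> x) = c \<odot>\<^bsub>W\<^esub> f x"
  shows "f \<in> module_hom CC V W"
  using assms by (auto simp: module_hom_def)

lemma module_homD:
  assumes "f \<in> module_hom CC V W"
  shows "\<And>x. x \<in> carrier V \<Longrightarrow> f x \<in> carrier W"
    and "\<And>x y. x \<in> carrier V \<Longrightarrow> y \<in> carrier V \<Longrightarrow> f (x \<oplus>\<^bsub>V\<^esub> y) = f x \<oplus>\<^bsub>W\<^esub> f y"
    and "\<And>c x. x \<in> carrier V \<Longrightarrow> f (c \<odot>\<^bsub>V\<^esub> x) = c \<odot>\<^bsub>W\<^esub> f x"
  using assms by (auto simp: module_hom_def)

locale clinear = V: cvs V + W: cvs W for V :: "(complex, 'v) module" and W :: "(complex, 'w) module" +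
  fixes f assumes hom: "f \<in> module_hom CC V W"
begin

lemmas cl [simp, intro] = module_homD(1)[OF hom]
lemmas add = module_homD(2)[OF hom]
lemmas smult = module_homD(3)[OF hom]

lemma zero [simp]: "f \<zero>\<^bsub>V\<^esub> = \<zero>\<^bsub>W\<^esub>"
  using smult[of "\<zero>\<^bsub>V\<^esub>" 0] by simp

lemma uminus: "x \<in> carrier V \<Longrightarrow> f (\<ominus>\<^bsub>V\<^esub> x) = \<ominus>\<^bsub>W\<^esub> f x"
  by (simp add: V.minus_eq_smult W.minus_eq_smult smult)

lemma diff: "x \<in> carrier V \<Longrightarrow> y \<in> carrier V \<Longrightarrow> f (x \<ominus>\<^bsub>V\<^esub> y) = f x \<ominus>\<^bsub>W\<^esub> f y"
  by (simp add: V.minus_eq W.minus_eq uminus add)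

lemma finsum: "finite A \<Longrightarrow> t \<in> A \<rightarrow> carrier V \<Longrightarrow> f (finsum V t A) = finsum W (\<lambda>i. f (t i)) A"
proof (induction A rule: finite_induct)
  case (insert a A)
  have "(\<lambda>i. f (t i)) \<in> A \<rightarrow> carrier W" "f (t a) \<in> carrier W" using insert by auto
  then show ?case using insert by (subst V.finsum_insert) (auto simp: add)
qed auto

lemma subspace_ker: "subspace CC {x \<in> carrier V. f x = \<zero>\<^bsub>W\<^esub>} V"
  by (subst subspace_iff) (auto simp: V.vectorspace_axioms add smult)

lemma subspace_image: "subspace CC U V \<Longrightarrow> subspace CC (f ` U) W"
proof -
  assume "subspace CC U V"
  then have U: "U \<subseteq> carrier V" "\<zero>\<^bsub>V\<^esub> \<in> U" "\<And>x y. x \<in> U \<Longrightarrow> y \<in> U \<Longrightarrow> x \<oplus>\<^bsub>V\<^esub> y \<in> U"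
    "\<And>c x. x \<in> U \<Longrightarrow> c \<odot>\<^bsub>V\<^esub> x \<in> U"
    by (auto simp: subspace_iff[OF V.vectorspace_axioms])
  have "f x \<oplus>\<^bsub>W\<^esub> f y \<in> f ` U" if "x \<in> U" "y \<in> U" for x y
    using that U(1) U(3)[OF that] add[of x y] by (metis imageI subsetD)
  moreover have "c \<odot>\<^bsub>W\<^esub> f x \<in> f ` U" if "x \<in> U" for x c
    using that U(1) U(4)[OF that] smult[of x c] by (metis imageI subsetD)
  moreover have "\<zero>\<^bsub>W\<^esub> \<in> f ` U" using U(2) zero by (metis imageI)
  ultimately show ?thesis
    using U(1) by (auto simp: subspace_iff[OF W.vectorspace_axioms])
qed

end

lemma clinearI: "vectorspace CC V \<Longrightarrow> vectorspace CC W \<Longrightarrow> f \<in> module_hom CC V W \<Longrightarrow> clinear V W f"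
  by (simp add: clinear_def clinear_axioms_def cvsI)

lemma linear_maps_subset: "linear_maps V W \<subseteq> carrier V \<rightarrow>\<^sub>E carrier W"
  by (auto simp: linear_maps_def module_hom_def extensional_def)

lemma linear_mapsI:
  assumes "\<And>x. x \<in> carrier V \<Longrightarrow> f x \<in> carrier W"
    and "\<And>x y. x \<in> carrier V \<Longrightarrow> y \<in> carrier V \<Longrightarrow> f (x \<oplus>\<^bsub>V\<^esub> y) = f x \<oplus>\<^bsub>W\<^esub> f y"
    and "\<And>c x. x \<in> carrier V \<Longrightarrow> f (c \<odot>\<^bsub>V\<^esub> x) = c \<odot>\<^bsub>W\<^esub> f x" "f \<in> extensional (carrier V)"
  shows "f \<in> linear_maps V W"
  using assms by (auto simp: linear_maps_def module_hom_def)

lemma linear_maps_hom: "f \<in> linear_maps V W \<Longrightarrow> f \<in> module_hom CC V W"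
  by (simp add: linear_maps_def)

lemma restrict_hom:
  assumes V: "vectorspace CC V" and f: "f \<in> module_hom CC V W"
  shows "restrict f (carrier V) \<in> linear_maps V W"
proof -
  interpret V: cvs V by (rule cvsI) fact
  show ?thesis using module_homD[OF f] by (intro linear_mapsI) auto
qed

lemma linear_maps_closed:
  assumes "vectorspace CC V" "vectorspace CC W"
  shows "(\<lambda>x\<in>carrier V. \<zero>\<^bsub>W\<^esub>) \<in> linear_maps V W"
    and "\<And>f g. f \<in> linear_maps V W \<Longrightarrow> g \<in> linear_maps V W \<Longrightarrow>
      (\<lambda>x\<in>carrier V. f x \<oplus>\<^bsub>W\<^esub> g x) \<in> linear_maps V W"
    and "\<And>c f. f \<in> linear_maps V W \<Longrightarrow> (\<lambda>x\<in>carrier V. c \<odot>\<^bsub>W\<^esub> f x) \<in> linear_maps V W"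
proof -
  interpret V: cvs V by (rule cvsI) fact
  interpret W: cvs W by (rule cvsI) fact
  show "(\<lambda>x\<in>carrier V. \<zero>\<^bsub>W\<^esub>) \<in> linear_maps V W"
    by (intro linear_mapsI) auto
  show "(\<lambda>x\<in>carrier V. f x \<oplus>\<^bsub>W\<^esub> g x) \<in> linear_maps V W"
    if "f \<in> linear_maps V W" "g \<in> linear_maps V W" for f g
    using that[THEN linear_maps_hom, THEN module_homD(1)]
      that[THEN linear_maps_hom, THEN module_homD(2)] that[THEN linear_maps_hom, THEN module_homD(3)]
    by (intro linear_mapsI) (auto simp: W.smult_add W.add.m_ac)
  show "(\<lambda>x\<in>carrier V. c \<odot>\<^bsub>W\<^esub> f x) \<in> linear_maps V W" if "f \<in> linear_maps V W" for c f
    using module_homD[OF linear_maps_hom[OF that]]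
    by (intro linear_mapsI) (auto simp: W.smult_add W.smult_smult mult.commute)
qed

lemma vectorspace_linear_maps:
  assumes "vectorspace CC V" "vectorspace CC W"
  shows "vectorspace CC (pointwise_module (carrier V) W (linear_maps V W))"
  by (intro vectorspace_pointwise linear_maps_subset linear_maps_closed assms)

subsection \<open>Finite-dimensional spaces\<close>

text \<open>Coordinate functionals of a basis: the form in which finite dimensionality enters the
  constructions of maps below.\<close>

lemma dual_basis:
  assumes V: "vectorspace CC V" and fd: "vectorspace.fin_dim CC V"
  obtains B e where "finite B" "B \<subseteq> carrier V" "e \<in> B \<rightarrow> linear_maps V complex_line"
    "\<And>x. x \<in> carrier V \<Longrightarrow> x = finsum V (\<lambda>b. e b x \<odot>\<^bsub>V\<^esub> b) B"
proof -
  interpret V: cvs V by (rule cvsI) fact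
  obtain B where B: "finite B" "V.basis B" using V.finite_basis_exists[OF fd] by auto
  then have BV: "B \<subseteq> carrier V" by (simp add: V.basis_def)
  then have ex1: "\<exists>!a. a \<in> B \<rightarrow>\<^sub>E UNIV \<and> V.lincomb a B = x" if "x \<in> carrier V" for x
    using V.basis_criterion[OF B(1) BV] B(2) that by simp
  define c where "c x = (THE a. a \<in> B \<rightarrow>\<^sub>E UNIV \<and> V.lincomb a B = x)" for x
  have c: "c x \<in> B \<rightarrow>\<^sub>E UNIV" "V.lincomb (c x) B = x" if "x \<in> carrier V" for x
    using theI'[OF ex1[OF that]] by (auto simp: c_def)
  have cu: "a = c x" if "a \<in> B \<rightarrow>\<^sub>E UNIV" "V.lincomb a B = x" "x \<in> carrier V" for a x
    using ex1[OF that(3)] c[OF that(3)] that by blast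
  have add: "c (x \<oplus>\<^bsub>V\<^esub> y) b = c x b + c y b"
    if "x \<in> carrier V" "y \<in> carrier V" "b \<in> B" for x y b
  proof -
    have "V.lincomb (\<lambda>b\<in>B. c x b + c y b) B = V.lincomb (\<lambda>b. c x b) B \<oplus>\<^bsub>V\<^esub> V.lincomb (\<lambda>b. c y b) B"
      unfolding V.lincomb_def using BV
      by (subst V.finsum_addf[symmetric]) (auto intro!: V.finsum_cong' simp: V.add_smult)
    then have "(\<lambda>b\<in>B. c x b + c y b) = c (x \<oplus>\<^bsub>V\<^esub> y)"
      using that by (intro cu) (auto simp: c)
    from fun_cong[OF this, of b] show ?thesis using that by simp
  qed
  have smult: "c (k \<odot>\<^bsub>V\<^esub> x) b = k * c x b" if "x \<in> carrier V" "b \<in> B" for x k b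
  proof -
    have "V.lincomb (\<lambda>b\<in>B. k * c x b) B = k \<odot>\<^bsub>V\<^esub> V.lincomb (\<lambda>b. c x b) B"
      unfolding V.lincomb_def using BV B
      by (subst V.smult_finsum) (auto intro!: V.finsum_cong' simp: V.smult_smult)
    then have "(\<lambda>b\<in>B. k * c x b) = c (k \<odot>\<^bsub>V\<^esub> x)"
      using that by (intro cu) (auto simp: c)
    from fun_cong[OF this, of b] show ?thesis using that by simp
  qed
  show thesis
  proof (rule that[of B "\<lambda>b. \<lambda>x\<in>carrier V. c x b"])
    show "(\<lambda>b. \<lambda>x\<in>carrier V. c x b) \<in> B \<rightarrow> linear_maps V complex_line"
      using add smult by (auto intro!: linear_mapsI)
    show "x = (\<Oplus>\<^bsub>V\<^esub>b\<in>B. (\<lambda>x\<in>carrier V. c x b) x \<odot>\<^bsub>V\<^esub> b)" if "x \<in> carrier V" for x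
      using c(2)[OF that] that by (simp add: V.lincomb_def)
  qed (use B BV in auto)
qed

text \<open>A lift of \<open>\<beta>\<close> through \<open>q\<close> is prescribed on a basis.\<close>

lemma linear_lift:
  fixes W :: "(complex, 'w) module" and V1 :: "(complex, 'v) module" and V2 :: "(complex, 'u) module"
  assumes W: "vectorspace CC W" "vectorspace.fin_dim CC W" and V1: "vectorspace CC V1" and V2: "vectorspace CC V2"
    and q: "q \<in> module_hom CC V1 V2" and \<beta>: "\<beta> \<in> module_hom CC W V2" "\<beta> ` carrier W \<subseteq> q ` carrier V1"
  obtains s where "s \<in> linear_maps W V1" "\<And>w. w \<in> carrier W \<Longrightarrow> q (s w) = \<beta> w"
proof -
  interpret q: clinear V1 V2 q by (rule clinearI[OF V1 V2 q])
  interpret \<beta>: clinear W V2 \<beta> by (rule clinearI[OF W(1) V2 \<beta>(1)])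
  obtain B e where B: "finite B" "B \<subseteq> carrier W" and e: "e \<in> B \<rightarrow> linear_maps W complex_line"
    and Be: "\<And>w. w \<in> carrier W \<Longrightarrow> w = finsum W (\<lambda>b. e b w \<odot>\<^bsub>W\<^esub> b) B"
    by (rule dual_basis[OF W]) (rule that)
  note e' = e[THEN funcset_mem, THEN linear_maps_hom, THEN module_homD(2)]
    e[THEN funcset_mem, THEN linear_maps_hom, THEN module_homD(3)]
  have "\<forall>b\<in>B. \<exists>x. x \<in> carrier V1 \<and> q x = \<beta> b"
  proof
    fix b assume "b \<in> B"
    then have "\<beta> b \<in> q ` carrier V1" using \<beta>(2) B(2) by blast
    then show "\<exists>x. x \<in> carrier V1 \<and> q x = \<beta> b" by auto
  qed
  from bchoice[OF this] obtain x where x: "\<And>b. b \<in> B \<Longrightarrow> x b \<in> carrier V1" "\<And>b. b \<in> B \<Longrightarrow> q (x b) = \<beta> b"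
    by auto
  define s where "s = (\<lambda>w\<in>carrier W. finsum V1 (\<lambda>b. e b w \<odot>\<^bsub>V1\<^esub> x b) B)"
  have s: "s \<in> linear_maps W V1"
  proof (rule linear_mapsI)
    have ex: "(\<lambda>b. e b w \<odot>\<^bsub>V1\<^esub> x b) \<in> B \<rightarrow> carrier V1" for w
      using x(1) by auto
    show "s w \<in> carrier V1" if "w \<in> carrier W" for w
      using that ex by (simp add: s_def q.V.finsum_closed)
    show "s (w \<oplus>\<^bsub>W\<^esub> w') = s w \<oplus>\<^bsub>V1\<^esub> s w'" if w: "w \<in> carrier W" "w' \<in> carrier W" for w w'
    proof -
      have "finsum V1 (\<lambda>b. e b (w \<oplus>\<^bsub>W\<^esub> w') \<odot>\<^bsub>V1\<^esub> x b) B
        = finsum V1 (\<lambda>b. e b w \<odot>\<^bsub>V1\<^esub> x b \<oplus>\<^bsub>V1\<^esub> e b w' \<odot>\<^bsub>V1\<^esub> x b) B"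
        using x(1) e'(1) w by (intro q.V.finsum_cong') (auto simp: q.V.add_smult)
      then show ?thesis using w ex by (simp add: s_def q.V.finsum_addf)
    qed
    show "s (c \<odot>\<^bsub>W\<^esub> w) = c \<odot>\<^bsub>V1\<^esub> s w" if w: "w \<in> carrier W" for w c
    proof -
      have "finsum V1 (\<lambda>b. e b (c \<odot>\<^bsub>W\<^esub> w) \<odot>\<^bsub>V1\<^esub> x b) B
        = finsum V1 (\<lambda>b. c \<odot>\<^bsub>V1\<^esub> (e b w \<odot>\<^bsub>V1\<^esub> x b)) B"
        using x(1) e'(2) w by (intro q.V.finsum_cong') (auto simp: q.V.smult_smult)
      then show ?thesis using w ex B(1) by (simp add: s_def q.V.smult_finsum)
    qed
  qed (simp add: s_def)
  have qs: "q (s w) = \<beta> w" if w: "w \<in> carrier W" for w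
  proof -
    have "q (s w) = finsum V2 (\<lambda>b. q (e b w \<odot>\<^bsub>V1\<^esub> x b)) B"
      using w x B by (simp add: s_def q.finsum Pi_iff)
    also have "\<dots> = finsum V2 (\<lambda>b. e b w \<odot>\<^bsub>V2\<^esub> \<beta> b) B"
      using x B by (intro q.W.finsum_cong') (auto simp: q.smult)
    also have "\<dots> = \<beta> (finsum W (\<lambda>b. e b w \<odot>\<^bsub>W\<^esub> b) B)"
      using B by (subst \<beta>.finsum) (auto intro!: q.W.finsum_cong' simp: \<beta>.smult subsetD)
    finally show ?thesis using Be[OF w] by simp
  qed
  show thesis by (rule that[OF s]) (rule qs)
qed

lemma dim_le_1I:
  assumes V: "vectorspace CC V" and x: "x \<in> carrier V"
    and sp: "\<And>y. y \<in> carrier V \<Longrightarrow> \<exists>c. y = c \<odot>\<^bsub>V\<^esub> x"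
  shows "vectorspace.fin_dim CC V \<and> vectorspace.dim CC V \<le> 1"
proof -
  interpret V: cvs V by (rule cvsI) fact
  have "V.span {x} = {V.lincomb a {x} | a. a \<in> {x} \<rightarrow> UNIV}"
    using V.finite_span[of "{x}"] x by simp
  also have "\<dots> = {c \<odot>\<^bsub>V\<^esub> x | c. True}"
  proof (intro Set.set_eqI iffI)
    fix y assume "y \<in> {c \<odot>\<^bsub>V\<^esub> x | c. True}"
    then obtain c where "y = c \<odot>\<^bsub>V\<^esub> x" by auto
    then show "y \<in> {V.lincomb a {x} | a. a \<in> {x} \<rightarrow> UNIV}"
      using x by (intro CollectI exI[of _ "\<lambda>_. c"]) (simp add: V.lincomb_def)
  qed (use x in \<open>auto simp: V.lincomb_def\<close>)
  also have "\<dots> = carrier V"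
    using sp x by fast
  finally have g: "V.gen_set {x}" .
  have "V.fin_dim" unfolding V.fin_dim_def
    using g x by (intro exI[of _ "{x}"]) simp
  then show ?thesis using V.dim_le1I[OF g x] by simp
qed

lemma dim_1E:
  assumes V: "vectorspace CC V" "vectorspace.fin_dim CC V" "vectorspace.dim CC V = 1"
  obtains x where "x \<in> carrier V" "x \<noteq> \<zero>\<^bsub>V\<^esub>" "\<And>y. y \<in> carrier V \<Longrightarrow> \<exists>c. y = c \<odot>\<^bsub>V\<^esub> x"
proof -
  interpret V: cvs V by (rule cvsI) fact
  obtain B where B: "finite B" "V.basis B" using V.finite_basis_exists[OF V(2)] by auto
  then have "card B = 1" using V.dim_basis V(3) by simp
  then obtain x where x: "B = {x}" by (auto simp: card_1_singleton_iff)
  then have xc: "x \<in> carrier V" "V.gen_set {x}" "V.lin_indpt {x}" using B by (auto simp: V.basis_def)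
  show thesis
  proof (rule that[of x])
    show "x \<noteq> \<zero>\<^bsub>V\<^esub>" using V.vs_zero_lin_dep[of "{x}"] xc(1,3) by simp
    show "\<exists>c. y = c \<odot>\<^bsub>V\<^esub> x" if y: "y \<in> carrier V" for y
    proof -
      obtain a where "V.lincomb a {x} = y"
        using V.finite_in_span[of "{x}" y] y xc(1) unfolding xc(2) by auto
      then have "y = a x \<odot>\<^bsub>V\<^esub> x" using xc(1) by (simp add: V.lincomb_def)
      then show ?thesis ..
    qed
  qed (rule xc(1))
qed

section \<open>Compact open subgroups\<close>

text \<open>Continuity of the translations is the part of the structure of a topological group on which the
  arguments rest.\<close>

locale translation_group = group G for G :: "'g monoid" (structure) +
  fixes T :: "'g topology"
  assumes topspace: "topspace T = carrier G"
    and l_trans: "g \<in> carrier G \<Longrightarrow> continuous_map T T (\<lambda>x. g \<otimes> x)"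
    and r_trans: "g \<in> carrier G \<Longrightarrow> continuous_map T T (\<lambda>x. x \<otimes> g)"
begin

lemma open_l_trans:
  assumes "openin T U" "g \<in> carrier G"
  shows "openin T ((\<lambda>x. g \<otimes> x) ` U)"
proof -
  have "homeomorphic_maps T T (\<lambda>x. g \<otimes> x) (\<lambda>x. inv g \<otimes> x)"
    using assms(2) by (simp add: homeomorphic_maps_def l_trans topspace m_assoc[symmetric])
  then have "open_map T T (\<lambda>x. g \<otimes> x)"
    by (intro homeomorphic_imp_open_map) (auto simp: homeomorphic_map_maps)
  then show ?thesis using assms(1) by (simp add: open_map_def)
qed

lemma open_r_trans:
  assumes "openin T U" "g \<in> carrier G"
  shows "openin T ((\<lambda>x. x \<otimes> g) ` U)"
proof -
  have "homeomorphic_maps T T (\<lambda>x. x \<otimes> g) (\<lambda>x. x \<otimes> inv g)"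
    using assms(2) by (simp add: homeomorphic_maps_def r_trans topspace m_assoc)
  then have "open_map T T (\<lambda>x. x \<otimes> g)"
    by (intro homeomorphic_imp_open_map) (auto simp: homeomorphic_map_maps)
  then show ?thesis using assms(1) by (simp add: open_map_def)
qed

text \<open>The set \<open>S\<close> is the union of its left translates \<open>s U\<close> of \<open>U\<close>.  Stabilizers are shown to be open in
  this way.\<close>

lemma openI_right_translates:
  assumes U: "openin T U" "\<one> \<in> U" and S: "S \<subseteq> carrier G"
    and SU: "\<And>s u. s \<in> S \<Longrightarrow> u \<in> U \<Longrightarrow> s \<otimes> u \<in> S"
  shows "openin T S"
proof -
  have "S = (\<Union>s\<in>S. (\<lambda>x. s \<otimes> x) ` U)"
  proof (intro equalityI subsetI)
    fix s assume s: "s \<in> S"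
    then have "s = s \<otimes> \<one>" using S by auto
    then show "s \<in> (\<Union>s\<in>S. (\<lambda>x. s \<otimes> x) ` U)" using s U(2) by blast
  qed (use SU in auto)
  also have "openin T \<dots>"
    using S U(1) by (intro openin_Union) (auto intro: open_l_trans)
  finally show ?thesis .
qed

text \<open>Finitely many of the left translates \<open>j U\<close> cover the compact set \<open>K\<close>, and \<open>f\<close> is constant on the
  part of \<open>K\<close> in each of them.\<close>

lemma finite_image_compact:
  assumes K: "compactin T K" and U: "openin T U" "\<one> \<in> U"
    and f: "\<And>j u. j \<in> K \<Longrightarrow> u \<in> U \<Longrightarrow> j \<otimes> u \<in> K \<Longrightarrow> f (j \<otimes> u) = f j"
  shows "finite (f ` K)"
proof -
  have KG: "K \<subseteq> carrier G" using compactin_subset_topspace[OF K] topspace by simp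
  let ?U = "\<lambda>j. (\<lambda>x. j \<otimes> x) ` U"
  have "K \<subseteq> \<Union>(?U ` K)"
  proof
    fix j assume j: "j \<in> K"
    then have "j = j \<otimes> \<one>" using KG by auto
    then show "j \<in> \<Union>(?U ` K)" using j U(2) by blast
  qed
  moreover have "openin T u" if "u \<in> ?U ` K" for u
    using that open_l_trans[OF U(1)] KG by auto
  ultimately obtain \<F> where F: "finite \<F>" "\<F> \<subseteq> ?U ` K" "K \<subseteq> \<Union>\<F>"
    using compactinD[OF K, of "?U ` K"] by metis
  then obtain L where L: "L \<subseteq> K" "finite L" "\<F> = ?U ` L"
    by (meson finite_subset_image)
  have "f ` K \<subseteq> f ` L"
  proof clarify
    fix j assume "j \<in> K"
    then obtain l u where lu: "l \<in> L" "u \<in> U" "j = l \<otimes> u" using F(3) L(3) by auto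
    then have "f j = f l" using f[of l u] L(1) \<open>j \<in> K\<close> by auto
    then show "f j \<in> f ` L" using lu(1) by simp
  qed
  then show ?thesis using L(2) by (meson finite_imageI finite_subset)
qed

text \<open>The blocks \<open>U x\<close> of the partition are compact and open.  By openness a compact closure meets
  finitely many of them.  Conversely a finite union of blocks is compact, and it is closed
  because the union of the remaining blocks is open.  The blocks of interest are the left or
  the right cosets of a compact open subgroup.\<close>

lemma relatively_compact_iff_partition:
  assumes U: "\<And>x. x \<in> carrier G \<Longrightarrow> openin T (U x)" "\<And>x. x \<in> carrier G \<Longrightarrow> compactin T (U x)"
      "\<And>x. x \<in> carrier G \<Longrightarrow> x \<in> U x"
    and eq: "\<And>x y. x \<in> carrier G \<Longrightarrow> y \<in> U x \<Longrightarrow> U y = U x"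
    and D: "D \<subseteq> carrier G"
  shows "compactin T (T closure_of D) \<longleftrightarrow> finite (U ` D)"
proof
  assume c: "compactin T (T closure_of D)"
  have "T closure_of D \<subseteq> \<Union>(U ` carrier G)"
    using closure_of_subset_topspace[of T D] U(3) topspace by auto
  moreover have "openin T u" if "u \<in> U ` carrier G" for u
    using that U(1) by auto
  ultimately obtain \<F> where F: "finite \<F>" "\<F> \<subseteq> U ` carrier G" "T closure_of D \<subseteq> \<Union>\<F>"
    using compactinD[OF c, of "U ` carrier G"] by metis
  have "U ` D \<subseteq> \<F>"
  proof clarify
    fix x assume "x \<in> D"
    then have "x \<in> \<Union>\<F>" using F(3) closure_of_subset[of D T] D topspace by auto
    then obtain y where "y \<in> carrier G" "U y \<in> \<F>" "x \<in> U y" using F(2) by blast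
    then show "U x \<in> \<F>" using eq by simp
  qed
  then show "finite (U ` D)" using F(1) finite_subset by blast
next
  assume fin: "finite (U ` D)"
  let ?E = "\<Union>(U ` D)"
  have DE: "D \<subseteq> ?E" using D U(3) by auto
  have E: "compactin T ?E" using fin U(2) D by (intro compactin_Union) auto
  have EG: "?E \<subseteq> carrier G" using compactin_subset_topspace[OF E] topspace by simp
  have "carrier G - ?E = \<Union>(U ` (carrier G - ?E))"
  proof (intro equalityI subsetI)
    fix y assume "y \<in> \<Union>(U ` (carrier G - ?E))"
    then obtain x where x: "x \<in> carrier G" "x \<notin> ?E" "y \<in> U x" by auto
    then have "y \<in> carrier G" using openin_subset[OF U(1)[OF x(1)]] topspace by auto
    moreover have "y \<notin> ?E"
    proof
      assume "y \<in> ?E"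
      then obtain d where "d \<in> D" "y \<in> U d" by auto
      then have "U x = U d" using eq[OF x(1,3)] eq[of d y] D by auto
      then show False using x U(3)[of x] \<open>d \<in> D\<close> by auto
    qed
    ultimately show "y \<in> carrier G - ?E" by simp
  next
    fix y assume "y \<in> carrier G - ?E"
    then show "y \<in> \<Union>(U ` (carrier G - ?E))" using U(3)[of y] by blast
  qed
  moreover have "openin T (\<Union>(U ` (carrier G - ?E)))"
    using U(1) by (intro openin_Union) auto
  ultimately have "openin T (carrier G - ?E)" by simp
  then have "closedin T ?E"
    using EG by (simp add: closedin_def topspace)
  then have "T closure_of D \<subseteq> ?E"
    using DE by (simp add: closure_of_minimal)
  then show "compactin T (T closure_of D)"
    using closed_compactin[OF E] closedin_closure_of by blast
qed

end

lemma subgroup_carrier_simps [simp]: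
  "mult (G\<lparr>carrier := J\<rparr>) = mult G" "one (G\<lparr>carrier := J\<rparr>) = one G"
  by simp_all

locale compact_open_subgroup = translation_group G T for G :: "'g monoid" (structure) and T +
  fixes J :: "'g set"
  assumes J_subgroup: "subgroup J G" and J_open: "openin T J" and J_compact: "compactin T J"
begin

abbreviation "GJ \<equiv> G\<lparr>carrier := J\<rparr>"

lemma J_simps [simp, intro]:
  "j \<in> J \<Longrightarrow> j \<in> carrier G" "\<one> \<in> J" "j \<in> J \<Longrightarrow> inv j \<in> J"
  "j \<in> J \<Longrightarrow> k \<in> J \<Longrightarrow> j \<otimes> k \<in> J"
  using J_subgroup by (auto simp: subgroup_def)

lemma GJ_inv [simp]: "j \<in> J \<Longrightarrow> inv\<^bsub>GJ\<^esub> j = inv j"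
  using m_inv_consistent[OF J_subgroup] .

lemma open_in_J: "openin (subtopology T J) S \<longleftrightarrow> openin T S \<and> S \<subseteq> J"
  using openin_open_subtopology[OF J_open] .

lemma r_coset_iff: "x \<in> carrier G \<Longrightarrow> y \<in> carrier G \<Longrightarrow> y \<in> J #> x \<longleftrightarrow> y \<otimes> inv x \<in> J"
  unfolding r_coset_def
  by (auto simp: m_assoc intro!: bexI[of _ "y \<otimes> inv x"])

lemma l_coset_iff: "x \<in> carrier G \<Longrightarrow> y \<in> carrier G \<Longrightarrow> y \<in> x <# J \<longleftrightarrow> inv x \<otimes> y \<in> J"
  unfolding l_coset_def
  by (auto simp: m_assoc[symmetric] intro!: bexI[of _ "inv x \<otimes> y"])

lemma r_coset_image: "J #> x = (\<lambda>j. j \<otimes> x) ` J"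
  by (auto simp: r_coset_def)

lemma l_coset_image: "x <# J = (\<lambda>j. x \<otimes> j) ` J"
  by (auto simp: l_coset_def)

lemma r_coset_eq: "x \<in> carrier G \<Longrightarrow> y \<in> J #> x \<Longrightarrow> J #> y = J #> x"
  using repr_independence[OF _ _ J_subgroup] by metis

lemma l_coset_eq: "x \<in> carrier G \<Longrightarrow> y \<in> x <# J \<Longrightarrow> y <# J = x <# J"
  using l_repr_independence[OF _ _ J_subgroup] by metis

lemma relatively_compact_iff_r:
  "D \<subseteq> carrier G \<Longrightarrow> compactin T (T closure_of D) \<longleftrightarrow> finite ((\<lambda>x. J #> x) ` D)"
  by (rule relatively_compact_iff_partition)
    (auto simp: r_coset_eq, auto simp: r_coset_image intro: open_r_trans J_open
      image_compactin[OF J_compact r_trans] intro!: image_eqI[of _ _ \<one>])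

lemma relatively_compact_iff_l:
  "D \<subseteq> carrier G \<Longrightarrow> compactin T (T closure_of D) \<longleftrightarrow> finite ((\<lambda>x. x <# J) ` D)"
  by (rule relatively_compact_iff_partition)
    (auto simp: l_coset_eq, auto simp: l_coset_image intro: open_l_trans J_open
      image_compactin[OF J_compact l_trans] intro!: image_eqI[of _ _ \<one>])

lemma coset_rep_r:
  assumes "x \<in> carrier G"
  obtains j where "j \<in> J" "coset_rep (J #> x) = j \<otimes> x"
proof -
  have "x \<in> J #> x" using assms by (auto simp: r_coset_image intro!: image_eqI[of _ _ \<one>])
  then have "coset_rep (J #> x) \<in> J #> x" unfolding coset_rep_def by (rule someI)
  then show thesis using that by (auto simp: r_coset_image)
qed

lemma coset_rep_l:
  assumes "x \<in> carrier G"
  obtains j where "j \<in> J" "coset_rep (x <# J) = x \<otimes> j"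
proof -
  have "x \<in> x <# J" using assms by (auto simp: l_coset_image intro!: image_eqI[of _ _ \<one>])
  then have "coset_rep (x <# J) \<in> x <# J" unfolding coset_rep_def by (rule someI)
  then show thesis using that by (auto simp: l_coset_image)
qed

lemma rcosetsE:
  assumes "C \<in> rcosets J"
  shows "coset_rep C \<in> carrier G" "J #> coset_rep C = C"
proof -
  obtain x where x: "x \<in> carrier G" "C = J #> x" using assms by (auto simp: RCOSETS_def)
  obtain j where j: "j \<in> J" "coset_rep C = j \<otimes> x"
    using coset_rep_r[OF x(1)] unfolding x(2) by blast
  show "coset_rep C \<in> carrier G" using x j by simp
  have "j \<otimes> x \<in> C" using j(1) unfolding x(2) by (auto simp: r_coset_image)
  then show "J #> coset_rep C = C" unfolding j(2) using r_coset_eq[OF x(1), of "j \<otimes> x"] x(2) by simp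
qed

lemma lcosetsE:
  assumes "C \<in> lcosets J"
  shows "coset_rep C \<in> carrier G" "coset_rep C <# J = C"
proof -
  obtain x where x: "x \<in> carrier G" "C = x <# J" using assms by (auto simp: LCOSETS_def)
  obtain j where j: "j \<in> J" "coset_rep C = x \<otimes> j"
    using coset_rep_l[OF x(1)] unfolding x(2) by blast
  show "coset_rep C \<in> carrier G" using x j by simp
  have "x \<otimes> j \<in> C" using j(1) unfolding x(2) by (auto simp: l_coset_image)
  then show "coset_rep C <# J = C" unfolding j(2) using l_coset_eq[OF x(1), of "x \<otimes> j"] x(2) by simp
qed

end

section \<open>Representations\<close>

lemma is_repD:
  assumes "is_rep G (V, \<rho>)"
  shows "vectorspace CC V" "\<And>g. g \<in> carrier G \<Longrightarrow> \<rho> g \<in> module_hom CC V V"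
    "\<And>g v. g \<in> carrier G \<Longrightarrow> v \<in> carrier V \<Longrightarrow> \<rho> g v \<in> carrier V"
    "\<And>v. v \<in> carrier V \<Longrightarrow> \<rho> \<one>\<^bsub>G\<^esub> v = v"
    "\<And>g h v. g \<in> carrier G \<Longrightarrow> h \<in> carrier G \<Longrightarrow> v \<in> carrier V \<Longrightarrow> \<rho> (g \<otimes>\<^bsub>G\<^esub> h) v = \<rho> g (\<rho> h v)"
  using assms by (auto simp: is_rep_def module_hom_def)

lemma is_repI:
  assumes "vectorspace CC V" "\<And>g. g \<in> carrier G \<Longrightarrow> \<rho> g \<in> module_hom CC V V"
    "\<And>v. v \<in> carrier V \<Longrightarrow> \<rho> \<one>\<^bsub>G\<^esub> v = v"
    "\<And>g h v. g \<in> carrier G \<Longrightarrow> h \<in> carrier G \<Longrightarrow> v \<in> carrier V \<Longrightarrow> \<rho> (g \<otimes>\<^bsub>G\<^esub> h) v = \<rho> g (\<rho> h v)"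
  shows "is_rep G (V, \<rho>)"
  using assms by (auto simp: is_rep_def)

lemma subrep_is_rep:
  assumes "is_rep G (V, \<rho>)" "subrep G (V, \<rho>) U"
  shows "is_rep G (V\<lparr>carrier := U\<rparr>, \<rho>)"
proof -
  note V = is_repD[OF assms(1)]
  have U: "subspace CC U V" "\<And>g u. g \<in> carrier G \<Longrightarrow> u \<in> U \<Longrightarrow> \<rho> g u \<in> U"
    using assms(2) by (auto simp: subrep_def)
  have UV: "U \<subseteq> carrier V" by (rule subspace_subset[OF U(1)])
  show ?thesis
  proof (rule is_repI)
    show "vectorspace CC (V\<lparr>carrier := U\<rparr>)" by (rule vectorspace_subspace[OF V(1) U(1)])
    show "\<rho> g \<in> module_hom CC (V\<lparr>carrier := U\<rparr>) (V\<lparr>carrier := U\<rparr>)" if "g \<in> carrier G" for g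
      using module_homD[OF V(2)[OF that]] U(2)[OF that]
      by (intro module_homI) (simp_all add: subsetD[OF UV])
  qed (use V UV in auto)
qed

lemma smooth_repD:
  assumes "smooth_rep G T (V, \<rho>)"
  shows "is_rep G (V, \<rho>)" "\<And>v. v \<in> carrier V \<Longrightarrow> openin T {g \<in> carrier G. \<rho> g v = v}"
  using assms by (auto simp: smooth_rep_def)

lemma intertwinersI:
  assumes "\<alpha> \<in> linear_maps V W"
    "\<And>g v. g \<in> carrier G \<Longrightarrow> v \<in> carrier V \<Longrightarrow> \<alpha> (\<rho> g v) = \<sigma> g (\<alpha> v)"
  shows "\<alpha> \<in> intertwiners G (V, \<rho>) (W, \<sigma>)"
  using assms by (auto simp: intertwiners_def)

lemma intertwinersD:
  assumes "\<alpha> \<in> intertwiners G (V, \<rho>) (W, \<sigma>)"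
  shows "\<alpha> \<in> linear_maps V W" "\<alpha> \<in> module_hom CC V W"
    "\<And>g v. g \<in> carrier G \<Longrightarrow> v \<in> carrier V \<Longrightarrow> \<alpha> (\<rho> g v) = \<sigma> g (\<alpha> v)"
  using assms by (auto simp: intertwiners_def linear_maps_def)

lemma subrep_ker:
  assumes V: "is_rep G (V, \<rho>)" and W: "is_rep G (W, \<sigma>)" and a: "\<alpha> \<in> intertwiners G (V, \<rho>) (W, \<sigma>)"
  shows "subrep G (V, \<rho>) {v \<in> carrier V. \<alpha> v = \<zero>\<^bsub>W\<^esub>}"
proof -
  interpret clinear V W \<alpha>
    by (rule clinearI[OF is_repD(1)[OF V] is_repD(1)[OF W] intertwinersD(2)[OF a]])
  have "\<sigma> g \<zero>\<^bsub>W\<^esub> = \<zero>\<^bsub>W\<^esub>" if "g \<in> carrier G" for g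
    using clinear.zero[OF clinearI[OF is_repD(1)[OF W] is_repD(1)[OF W] is_repD(2)[OF W that]]] .
  then show ?thesis
    using subspace_ker is_repD(3)[OF V] intertwinersD(3)[OF a] by (auto simp: subrep_def)
qed

lemma subrep_image:
  assumes V: "is_rep G (V, \<rho>)" and W: "is_rep G (W, \<sigma>)" and a: "\<alpha> \<in> intertwiners G (V, \<rho>) (W, \<sigma>)"
    and U: "subrep G (V, \<rho>) U"
  shows "subrep G (W, \<sigma>) (\<alpha> ` U)"
proof -
  interpret clinear V W \<alpha>
    by (rule clinearI[OF is_repD(1)[OF V] is_repD(1)[OF W] intertwinersD(2)[OF a]])
  have U': "subspace CC U V" "\<And>g u. g \<in> carrier G \<Longrightarrow> u \<in> U \<Longrightarrow> \<rho> g u \<in> U"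
    using U by (auto simp: subrep_def)
  have UV: "U \<subseteq> carrier V" by (rule subspace_subset[OF U'(1)])
  have "\<sigma> g (\<alpha> u) \<in> \<alpha> ` U" if "g \<in> carrier G" "u \<in> U" for g u
    using U'(2)[OF that] intertwinersD(3)[OF a that(1), of u] UV that by (metis imageI subsetD)
  then show ?thesis
    using subspace_image[OF U'(1)] by (auto simp: subrep_def)
qed

lemma subrep_carrier:
  assumes "is_rep G (V, \<rho>)"
  shows "subrep G (V, \<rho>) (carrier V)"
proof -
  interpret V: cvs V by (rule cvsI[OF is_repD(1)[OF assms]])
  show ?thesis using is_repD(3)[OF assms]
    by (auto simp: subrep_def subspace_iff[OF V.vectorspace_axioms])
qed

lemma irreducible_repD:
  assumes "irreducible_rep G (V, \<rho>)"
  shows "is_rep G (V, \<rho>)" "carrier V \<noteq> {\<zero>\<^bsub>V\<^esub>}"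
    "\<And>U. subrep G (V, \<rho>) U \<Longrightarrow> U = {\<zero>\<^bsub>V\<^esub>} \<or> U = carrier V"
  using assms by (auto simp: irreducible_rep_def)

text \<open>Schur's lemma in its elementary form.\<close>

lemma irreducible_inj:
  assumes V: "irreducible_rep G (V, \<rho>)" and W: "is_rep G (W, \<sigma>)"
    and a: "\<alpha> \<in> intertwiners G (V, \<rho>) (W, \<sigma>)" and nz: "v \<in> carrier V" "\<alpha> v \<noteq> \<zero>\<^bsub>W\<^esub>"
  shows "inj_on \<alpha> (carrier V)"
proof (rule inj_onI)
  fix x y assume xy: "x \<in> carrier V" "y \<in> carrier V" "\<alpha> x = \<alpha> y"
  have V': "is_rep G (V, \<rho>)" using V by (simp add: irreducible_rep_def)
  interpret clinear V W \<alpha>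
    by (rule clinearI[OF is_repD(1)[OF V'] is_repD(1)[OF W] intertwinersD(2)[OF a]])
  have "{v \<in> carrier V. \<alpha> v = \<zero>\<^bsub>W\<^esub>} = {\<zero>\<^bsub>V\<^esub>}"
    using subrep_ker[OF V' W a] V nz unfolding irreducible_rep_def by blast
  moreover have "\<alpha> (x \<ominus>\<^bsub>V\<^esub> y) = \<zero>\<^bsub>W\<^esub>"
    using xy by (simp add: diff W.diff_eq_zero)
  ultimately have "x \<ominus>\<^bsub>V\<^esub> y = \<zero>\<^bsub>V\<^esub>" using xy by blast
  then show "x = y" using xy by (simp add: V.diff_eq_zero)
qed

lemma irreducible_surj:
  assumes V: "is_rep G (V, \<rho>)" and W: "irreducible_rep G (W, \<sigma>)"
    and a: "\<alpha> \<in> intertwiners G (V, \<rho>) (W, \<sigma>)" and nz: "v \<in> carrier V" "\<alpha> v \<noteq> \<zero>\<^bsub>W\<^esub>"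
  shows "\<alpha> ` carrier V = carrier W"
proof -
  have W': "is_rep G (W, \<sigma>)" using W by (simp add: irreducible_rep_def)
  have "\<alpha> ` carrier V = {\<zero>\<^bsub>W\<^esub>} \<or> \<alpha> ` carrier V = carrier W"
    using subrep_image[OF V W' a subrep_carrier[OF V]] W unfolding irreducible_rep_def by blast
  then show ?thesis using nz by blast
qed

section \<open>Smooth representations of a compact group\<close>

context compact_open_subgroup begin

lemma J_repD:
  assumes "is_rep GJ (V, \<rho>)"
  shows "vectorspace CC V" "\<And>g. g \<in> J \<Longrightarrow> \<rho> g \<in> module_hom CC V V"
    "\<And>g v. g \<in> J \<Longrightarrow> v \<in> carrier V \<Longrightarrow> \<rho> g v \<in> carrier V"
    "\<And>v. v \<in> carrier V \<Longrightarrow> \<rho> \<one> v = v"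
    "\<And>g h v. g \<in> J \<Longrightarrow> h \<in> J \<Longrightarrow> v \<in> carrier V \<Longrightarrow> \<rho> (g \<otimes> h) v = \<rho> g (\<rho> h v)"
  using is_repD[OF assms] by auto

lemma J_intertwinersD:
  assumes "\<alpha> \<in> intertwiners GJ (V, \<rho>) (W, \<sigma>)"
  shows "\<alpha> \<in> linear_maps V W" "\<alpha> \<in> module_hom CC V W"
    "\<And>g v. g \<in> J \<Longrightarrow> v \<in> carrier V \<Longrightarrow> \<alpha> (\<rho> g v) = \<sigma> g (\<alpha> v)"
  using intertwinersD[OF assms] by auto

lemma open_stabilizer:
  assumes "smooth_rep GJ (subtopology T J) (V, \<rho>)" "v \<in> carrier V"
  shows "openin T {j \<in> J. \<rho> j v = v}"
  using smooth_repD(2)[OF assms] by (simp add: open_in_J)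

text \<open>The orbit map is invariant under right translation by the stabilizer, which is open.\<close>

lemma finite_orbit:
  assumes V: "smooth_rep GJ (subtopology T J) (V, \<rho>)" and v: "v \<in> carrier V"
  shows "finite ((\<lambda>j. \<rho> j v) ` J)"
proof (rule finite_image_compact[OF J_compact open_stabilizer[OF V v]])
  note V' = is_repD[OF smooth_repD(1)[OF V]]
  show "\<one> \<in> {j \<in> J. \<rho> j v = v}" using V'(4)[OF v] by simp
  show "\<rho> (j \<otimes> u) v = \<rho> j v" if "j \<in> J" "u \<in> {j \<in> J. \<rho> j v = v}" for j u
    using V'(5)[of j u v] that v by simp
qed

text \<open>The span of a finite orbit is a subrepresentation.\<close>

lemma fin_dim_irreducible:
  assumes V: "smooth_rep GJ (subtopology T J) (V, \<rho>)" and irr: "irreducible_rep GJ (V, \<rho>)"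
  shows "vectorspace.fin_dim CC V"
proof -
  note V' = is_repD[OF smooth_repD(1)[OF V]]
  interpret V: cvs V by (rule cvsI) (rule V'(1))
  obtain v where v: "v \<in> carrier V" "v \<noteq> \<zero>\<^bsub>V\<^esub>"
    using irreducible_repD(2)[OF irr] V.zero_closed by blast
  let ?S = "(\<lambda>j. \<rho> j v) ` J"
  have S: "?S \<subseteq> carrier V" using V'(3) v by auto
  have sub: "subspace CC (V.span ?S) V" by (rule V.span_is_subspace[OF S])
  have "\<rho> j u \<in> V.span ?S" if j: "j \<in> J" and u: "u \<in> V.span ?S" for j u
  proof -
    have j': "\<rho> j \<in> module_hom CC V V" using V'(2) j by simp
    interpret clinear V V "\<rho> j" by (rule clinearI[OF V'(1) V'(1) j'])
    let ?U = "{u \<in> carrier V. \<rho> j u \<in> V.span ?S}"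
    have "subspace CC ?U V"
      using sub unfolding subspace_iff[OF V'(1)] by (auto simp: add smult)
    moreover have "?S \<subseteq> ?U"
    proof clarify
      fix k assume k: "k \<in> J"
      have "\<rho> j (\<rho> k v) = \<rho> (j \<otimes> k) v" using V'(5)[of j k v] j k v by simp
      then have "\<rho> j (\<rho> k v) \<in> ?S" using j k by auto
      then show "\<rho> k v \<in> carrier V \<and> \<rho> j (\<rho> k v) \<in> V.span ?S"
        using V.in_own_span[OF S] V'(3)[of k v] k v by auto
    qed
    ultimately have "V.span ?S \<subseteq> ?U"
      by (intro V.span_is_subset) (auto simp: subspace_def)
    then show ?thesis using u by auto
  qed
  then have "subrep GJ (V, \<rho>) (V.span ?S)" using sub by (simp add: subrep_def)
  moreover have "v \<in> ?S" using V'(4)[OF v(1)] by (intro image_eqI[of _ _ \<one>]) auto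
  then have "v \<in> V.span ?S" using V.in_own_span[OF S] by blast
  ultimately have "V.span ?S = carrier V"
    using irreducible_repD(3)[OF irr, of "V.span ?S"] v by auto
  then show ?thesis
    unfolding V.fin_dim_def using S finite_orbit[OF V v(1)] by (intro exI[of _ ?S]) simp
qed

text \<open>Smooth representations of a compact group are projective relative to linear maps: a linear
  lift is made equivariant by averaging over its orbit, which is finite.\<close>

lemma equivariant_lift:
  assumes W: "smooth_rep GJ (subtopology T J) (W, \<sigma>)" and fd: "vectorspace.fin_dim CC W"
    and V1: "smooth_rep GJ (subtopology T J) (V1, \<rho>1)" and V2: "is_rep GJ (V2, \<rho>2)"
    and q: "q \<in> module_hom CC V1 V2" "\<And>j v. j \<in> J \<Longrightarrow> v \<in> carrier V1 \<Longrightarrow> q (\<rho>1 j v) = \<rho>2 j (q v)"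
    and \<beta>: "\<beta> \<in> intertwiners GJ (W, \<sigma>) (V2, \<rho>2)" "\<beta> ` carrier W \<subseteq> q ` carrier V1"
  obtains s where "s \<in> intertwiners GJ (W, \<sigma>) (V1, \<rho>1)" "\<And>w. w \<in> carrier W \<Longrightarrow> q (s w) = \<beta> w"
proof -
  note W' = J_repD[OF smooth_repD(1)[OF W]]
  note V1' = J_repD[OF smooth_repD(1)[OF V1]]
  note V2' = J_repD[OF V2]
  note \<beta>' = J_intertwinersD[OF \<beta>(1)]
  interpret W: cvs W by (rule cvsI) (rule W'(1))
  interpret q: clinear V1 V2 q by (rule clinearI[OF V1'(1) V2'(1) q(1)])
  interpret \<beta>: clinear W V2 \<beta> by (rule clinearI[OF W'(1) V2'(1) \<beta>'(2)])
  obtain B e where B: "finite B" "B \<subseteq> carrier W" and e: "e \<in> B \<rightarrow> linear_maps W complex_line"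
    and Be: "\<And>w. w \<in> carrier W \<Longrightarrow> w = finsum W (\<lambda>b. e b w \<odot>\<^bsub>W\<^esub> b) B"
    by (rule dual_basis[OF W'(1) fd]) (rule that)
  obtain s0 where s0: "s0 \<in> linear_maps W V1" and qs0: "\<And>w. w \<in> carrier W \<Longrightarrow> q (s0 w) = \<beta> w"
    by (rule linear_lift[OF W'(1) fd V1'(1) V2'(1) q(1) \<beta>'(2) \<beta>(2)]) (rule that)
  interpret s0: clinear W V1 s0 by (rule clinearI[OF W'(1) V1'(1) linear_maps_hom[OF s0]])
  \<comment> \<open>\<open>J\<close> acts on linear maps by conjugation and preserves the set \<open>L\<close> of linear lifts of \<open>\<beta>\<close>\<close>
  define act where "act j t = (\<lambda>w\<in>carrier W. \<rho>1 j (t (\<sigma> (inv j) w)))" for j t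
  define L where "L = {t \<in> linear_maps W V1. \<forall>w\<in>carrier W. q (t w) = \<beta> w}"
  have Lcl: "t w \<in> carrier V1" if "t \<in> L" "w \<in> carrier W" for t w
    using that linear_maps_subset by (fastforce simp: L_def)
  have L_q: "q (t w) = \<beta> w" if "t \<in> L" "w \<in> carrier W" for t w
    using that by (simp add: L_def)
  have actL: "act j t \<in> L" if j: "j \<in> J" and tL: "t \<in> L" for j t
  proof -
    have t: "t \<in> linear_maps W V1" using that(2) by (simp add: L_def)
    interpret t: clinear W V1 t by (rule clinearI[OF W'(1) V1'(1) linear_maps_hom[OF t]])
    interpret r: clinear V1 V1 "\<rho>1 j" by (rule clinearI[OF V1'(1) V1'(1) V1'(2)]) (rule that(1))
    interpret i: clinear W W "\<sigma> (inv j)" by (rule clinearI[OF W'(1) W'(1) W'(2)]) (simp add: that(1))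
    have "act j t \<in> linear_maps W V1"
      unfolding act_def by (rule linear_mapsI) (auto simp: t.add r.add i.add t.smult r.smult i.smult)
    moreover have "q (act j t w) = \<beta> w" if w: "w \<in> carrier W" for w
    proof -
      have "q (act j t w) = \<rho>2 j (\<rho>2 (inv j) (\<beta> w))"
        using w j L_q[OF tL] \<beta>'(3)[of "inv j" w] by (simp add: act_def q(2) Lcl[OF tL] W'(3))
      also have "\<dots> = \<beta> w"
        using w \<open>j \<in> J\<close> V2'(5)[of j "inv j" "\<beta> w"] V2'(4)[of "\<beta> w"] by simp
      finally show ?thesis .
    qed
    ultimately show ?thesis by (simp add: L_def)
  qed
  have act_mult: "act (j \<otimes> k) t = act j (act k t)" if "j \<in> J" "k \<in> J" "t \<in> L" for j k t
  proof
    fix w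
    show "act (j \<otimes> k) t w = act j (act k t) w"
      using that Lcl[OF that(3)] W'(3)[of "inv j" w] W'(3)[of "inv k" "\<sigma> (inv j) w"]
        W'(5)[of "inv k" "inv j" w] V1'(5)[of j k "t (\<sigma> (inv k) (\<sigma> (inv j) w))"]
      by (auto simp: act_def inv_mult_group)
  qed
  have act_one: "act \<one> t = t" if "t \<in> L" for t
  proof
    fix w
    show "act \<one> t w = t w"
      using that Lcl[OF that] W'(4)[of w] V1'(4)[of "t w"]
      by (auto simp: act_def L_def linear_maps_def extensional_def)
  qed
  have s0L: "s0 \<in> L" using s0 qs0 by (simp add: L_def)
  \<comment> \<open>an open set fixing the lift \<open>s0\<close>; so the orbit of \<open>s0\<close> is finite\<close>
  define H where "H = J \<inter> (\<Inter>b\<in>B. {j \<in> J. \<sigma> j b = b} \<inter> {j \<in> J. \<rho>1 j (s0 b) = s0 b})"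
  have "openin T H"
  proof (cases "B = {}")
    case False
    then show ?thesis unfolding H_def using B
      by (intro openin_Int openin_INT2 open_stabilizer[OF W] open_stabilizer[OF V1] J_open) (auto simp: subsetD)
  qed (simp add: H_def J_open)
  moreover have "\<one> \<in> H" using W'(4) V1'(4) B by (auto simp: H_def subsetD)
  moreover have H: "act h s0 = s0" if h: "h \<in> H" for h
  proof -
    have hJ: "h \<in> J" using h by (simp add: H_def)
    interpret sh: clinear W W "\<sigma> h" by (rule clinearI[OF W'(1) W'(1) W'(2)]) (rule hJ)
    interpret rh: clinear V1 V1 "\<rho>1 h" by (rule clinearI[OF V1'(1) V1'(1) V1'(2)]) (rule hJ)
    have sh: "\<sigma> h w = w" if w: "w \<in> carrier W" for w
    proof -
      have "\<sigma> h (finsum W (\<lambda>b. e b w \<odot>\<^bsub>W\<^esub> b) B) = finsum W (\<lambda>b. e b w \<odot>\<^bsub>W\<^esub> b) B"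
        using B h by (subst sh.finsum) (auto intro!: W.finsum_cong' simp: sh.smult subsetD H_def)
      then show ?thesis using Be[OF w] by simp
    qed
    have rh: "\<rho>1 h (s0 w) = s0 w" if w: "w \<in> carrier W" for w
    proof -
      have exp: "s0 w = finsum V1 (\<lambda>b. e b w \<odot>\<^bsub>V1\<^esub> s0 b) B"
        using B by (subst Be[OF w], subst s0.finsum) (auto intro!: q.V.finsum_cong' simp: s0.smult subsetD)
      show ?thesis unfolding exp
        using B h by (subst rh.finsum) (auto intro!: q.V.finsum_cong' simp: rh.smult H_def subsetD)
    qed
    show ?thesis
    proof
      fix w
      show "act h s0 w = s0 w"
      proof (cases "w \<in> carrier W")
        case True
        have "\<sigma> (inv h) w = \<sigma> (inv h) (\<sigma> h w)" using sh[OF True] by simp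
        also have "\<dots> = w" using W'(5)[of "inv h" h w] W'(4)[OF True] hJ True by simp
        finally show ?thesis using True rh[OF True] by (simp add: act_def)
      qed (use s0 in \<open>auto simp: act_def linear_maps_def extensional_def\<close>)
    qed
  qed
  ultimately have fin: "finite ((\<lambda>j. act j s0) ` J)"
    using act_mult[OF _ _ s0L] by (intro finite_image_compact[OF J_compact, of H]) (auto simp: H_def)
  define Orb where "Orb = (\<lambda>j. act j s0) ` J"
  have OrbL: "Orb \<subseteq> L" using actL s0L by (auto simp: Orb_def)
  have "act \<one> s0 \<in> Orb" by (auto simp: Orb_def)
  then have card: "of_nat (card Orb) \<noteq> (0::complex)" using fin by (auto simp: Orb_def)
  have act_img: "act k ` Orb = Orb" "inj_on (act k) Orb" if k: "k \<in> J" for k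
  proof -
    show inj: "inj_on (act k) Orb"
      by (rule inj_on_inverseI[of _ "act (inv k)"])
        (use OrbL k act_mult[of "inv k" k] act_one in auto)
    have "act k ` Orb \<subseteq> Orb"
    proof clarify
      fix t assume "t \<in> Orb"
      then obtain j where "j \<in> J" "t = act j s0" by (auto simp: Orb_def)
      then show "act k t \<in> Orb"
        using k act_mult[OF k _ s0L, of j] by (auto simp: Orb_def intro!: image_eqI[of _ _ "k \<otimes> j"])
    qed
    then show "act k ` Orb = Orb"
      using inj fin by (simp add: endo_inj_surj Orb_def)
  qed
  \<comment> \<open>the mean of the orbit is still a lift, as \<open>L\<close> is an affine space\<close>
  define s where "s = (\<lambda>w\<in>carrier W. inverse (of_nat (card Orb)) \<odot>\<^bsub>V1\<^esub> finsum V1 (\<lambda>t. t w) Orb)"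
  have Oin: "(\<lambda>t. t w) \<in> Orb \<rightarrow> carrier V1" if "w \<in> carrier W" for w
    using OrbL Lcl that by auto
  have finO: "finite Orb" using fin by (simp add: Orb_def)
  have lin: "t (w \<oplus>\<^bsub>W\<^esub> w') = t w \<oplus>\<^bsub>V1\<^esub> t w'" "t (c \<odot>\<^bsub>W\<^esub> w) = c \<odot>\<^bsub>V1\<^esub> t w"
    if "t \<in> Orb" "w \<in> carrier W" "w' \<in> carrier W" for t w w' c
    using that OrbL module_homD(2,3)[OF linear_maps_hom, of t W V1] by (auto simp: L_def)
  have "s \<in> intertwiners GJ (W, \<sigma>) (V1, \<rho>1)"
  proof (rule intertwinersI)
    show "s \<in> linear_maps W V1"
    proof (rule linear_mapsI)
      show "s w \<in> carrier V1" if "w \<in> carrier W" for w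
        using that Oin[OF that] by (simp add: s_def q.V.finsum_closed)
      show "s (w \<oplus>\<^bsub>W\<^esub> w') = s w \<oplus>\<^bsub>V1\<^esub> s w'" if w: "w \<in> carrier W" "w' \<in> carrier W" for w w'
      proof -
        have "finsum V1 (\<lambda>t. t (w \<oplus>\<^bsub>W\<^esub> w')) Orb = finsum V1 (\<lambda>t. t w \<oplus>\<^bsub>V1\<^esub> t w') Orb"
          using w Oin by (intro q.V.finsum_cong') (auto simp: lin)
        then show ?thesis
          using w Oin by (simp add: s_def q.V.finsum_addf q.V.smult_add q.V.finsum_closed)
      qed
      show "s (c \<odot>\<^bsub>W\<^esub> w) = c \<odot>\<^bsub>V1\<^esub> s w" if w: "w \<in> carrier W" for w c
      proof -
        have "finsum V1 (\<lambda>t. t (c \<odot>\<^bsub>W\<^esub> w)) Orb = finsum V1 (\<lambda>t. c \<odot>\<^bsub>V1\<^esub> t w) Orb"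
          using w Oin by (intro q.V.finsum_cong') (auto simp: lin)
        also have "\<dots> = c \<odot>\<^bsub>V1\<^esub> finsum V1 (\<lambda>t. t w) Orb"
          using w Oin finO by (simp add: q.V.smult_finsum)
        finally show ?thesis
          using w Oin by (simp add: s_def q.V.smult_smult q.V.finsum_closed mult.commute)
      qed
    qed (simp add: s_def)
    show "s (\<sigma> k w) = \<rho>1 k (s w)" if "k \<in> carrier GJ" and w: "w \<in> carrier W" for k w
    proof -
      have k: "k \<in> J" using that by simp
      interpret rk: clinear V1 V1 "\<rho>1 k" by (rule clinearI[OF V1'(1) V1'(1) V1'(2)]) (rule k)
      have kw: "\<sigma> k w \<in> carrier W" using k w W'(3) by simp
      have kk: "\<sigma> (inv k) (\<sigma> k w) = w"
        using W'(5)[of "inv k" k w] W'(4)[OF w] k w by simp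
      have "\<rho>1 k (finsum V1 (\<lambda>t. t w) Orb) = finsum V1 (\<lambda>t. act k t (\<sigma> k w)) Orb"
        using finO Oin[OF w] kw kk
        by (subst rk.finsum) (auto intro!: q.V.finsum_cong' simp: act_def)
      also have "\<dots> = finsum V1 (\<lambda>t. t (\<sigma> k w)) (act k ` Orb)"
        using act_img[OF k] Oin[OF kw] by (subst q.V.finsum_reindex) auto
      finally show ?thesis
        using act_img[OF k] w kw Oin[OF w] by (simp add: s_def rk.smult q.V.finsum_closed)
    qed
  qed
  moreover have "q (s w) = \<beta> w" if w: "w \<in> carrier W" for w
  proof -
    have "q (finsum V1 (\<lambda>t. t w) Orb) = finsum V2 (\<lambda>t. \<beta> w) Orb"
      using Oin[OF w] finO OrbL w L_q by (subst q.finsum) (auto intro!: q.W.finsum_cong')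
    also have "\<dots> = of_nat (card Orb) \<odot>\<^bsub>V2\<^esub> \<beta> w"
      using finO w by (simp add: q.W.finsum_const)
    finally show ?thesis
      using w Oin[OF w] card by (simp add: s_def q.smult q.V.finsum_closed q.W.smult_smult)
  qed
  ultimately show thesis using that by blast
qed

end

context compact_open_subgroup begin

lemma rep_restrict:
  assumes "is_rep G (V, \<rho>)"
  shows "is_rep GJ (V, \<rho>)"
  using is_repD[OF assms] by (intro is_repI) auto

lemma smooth_rep_restrict:
  assumes "smooth_rep G T (V, \<rho>)"
  shows "smooth_rep GJ (subtopology T J) (V, \<rho>)"
proof -
  have "openin T {j \<in> J. \<rho> j v = v}" if "v \<in> carrier V" for v
  proof -
    have "{j \<in> J. \<rho> j v = v} = J \<inter> {g \<in> carrier G. \<rho> g v = v}" by auto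
    then show ?thesis using smooth_repD(2)[OF assms that] J_open by (simp add: openin_Int)
  qed
  then show ?thesis
    using rep_restrict[OF smooth_repD(1)[OF assms]] by (auto simp: smooth_rep_def open_in_J)
qed

lemma smooth_subrep:
  assumes V: "smooth_rep G T (V, \<rho>)" and U: "subrep G (V, \<rho>) U"
  shows "smooth_rep G T (V\<lparr>carrier := U\<rparr>, \<rho>)"
proof -
  have "U \<subseteq> carrier V" using U by (auto simp: subrep_def intro: subspace_subset[THEN subsetD])
  then show ?thesis
    using subrep_is_rep[OF smooth_repD(1)[OF V] U] smooth_repD(2)[OF V]
    by (auto simp: smooth_rep_def)
qed

end

section \<open>An irreducible smooth representation of a compact open subgroup, and its dual\<close>

locale induction_datum = compact_open_subgroup G T J
  for G :: "'g monoid" (structure) and T J +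
  fixes W :: "(complex, 'w) module" and lam :: "'g \<Rightarrow> 'w \<Rightarrow> 'w"
  assumes lam_smooth: "smooth_rep GJ (subtopology T J) (W, lam)"
    and lam_irreducible: "irreducible_rep GJ (W, lam)"
begin

lemmas lam_rep = smooth_repD(1)[OF lam_smooth]
lemmas lamD = J_repD[OF lam_rep]
lemmas W_fin_dim = fin_dim_irreducible[OF lam_smooth lam_irreducible]

sublocale W: cvs W by (rule cvsI) (rule lamD(1))

abbreviation "WD \<equiv> W_dual G T J (W, lam)"
abbreviation "lam_dual \<equiv> snd (contra_J G T J (W, lam))"

lemma lam_cl [simp, intro]: "j \<in> J \<Longrightarrow> w \<in> carrier W \<Longrightarrow> lam j w \<in> carrier W"
  by (rule lamD(3))

lemma lam_one [simp]: "w \<in> carrier W \<Longrightarrow> lam \<one> w = w"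
  by (rule lamD(4))

lemma lam_mult: "j \<in> J \<Longrightarrow> k \<in> J \<Longrightarrow> w \<in> carrier W \<Longrightarrow> lam j (lam k w) = lam (j \<otimes> k) w"
  using lamD(5) by simp

lemma lam_inv [simp]:
  assumes "j \<in> J" "w \<in> carrier W"
  shows "lam (inv j) (lam j w) = w" "lam j (lam (inv j) w) = w"
  using assms by (simp_all add: lam_mult)

lemma lam_zero [simp]: "j \<in> J \<Longrightarrow> lam j \<zero>\<^bsub>W\<^esub> = \<zero>\<^bsub>W\<^esub>"
  using clinear.zero[OF clinearI[OF lamD(1) lamD(1) lamD(2)]] .

lemmas lam_add = module_homD(2)[OF lamD(2)]
lemmas lam_smult = module_homD(3)[OF lamD(2)]

text \<open>The kernel of \<open>\<lambda>\<close> is the intersection of the stabilizers of the members of a finite basis.\<close>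

lemma lam_kernel_open: "openin T {j \<in> J. \<forall>w\<in>carrier W. lam j w = w}"
proof -
  obtain B e where B: "finite B" "B \<subseteq> carrier W" and e: "e \<in> B \<rightarrow> linear_maps W complex_line"
    and Be: "\<And>w. w \<in> carrier W \<Longrightarrow> w = finsum W (\<lambda>b. e b w \<odot>\<^bsub>W\<^esub> b) B"
    by (rule dual_basis[OF lamD(1) W_fin_dim]) (rule that)
  have "{j \<in> J. \<forall>w\<in>carrier W. lam j w = w} = J \<inter> (\<Inter>b\<in>B. {j \<in> J. lam j b = b})" (is "_ = ?H")
  proof (intro equalityI subsetI)
    fix h assume h: "h \<in> ?H"
    then have hJ: "h \<in> J" by simp
    interpret sh: clinear W W "lam h" by (rule clinearI[OF lamD(1) lamD(1) lamD(2)]) (rule hJ)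
    have "lam h w = w" if w: "w \<in> carrier W" for w
    proof -
      have "lam h (finsum W (\<lambda>b. e b w \<odot>\<^bsub>W\<^esub> b) B) = finsum W (\<lambda>b. e b w \<odot>\<^bsub>W\<^esub> b) B"
        using B h by (subst sh.finsum) (auto intro!: W.finsum_cong' simp: sh.smult subsetD)
      then show ?thesis using Be[OF w] by simp
    qed
    then show "h \<in> {j \<in> J. \<forall>w\<in>carrier W. lam j w = w}" using hJ by simp
  qed (use B in auto)
  moreover have "openin T ?H"
  proof (cases "B = {}")
    case False
    then show ?thesis using B
      by (intro openin_Int openin_INT2 open_stabilizer[OF lam_smooth] J_open) (auto simp: subsetD)
  qed (simp add: J_open)
  ultimately show ?thesis by simp
qed

lemma lam_fix_inv:
  assumes "j \<in> {j \<in> J. \<forall>w\<in>carrier W. lam j w = w}" "w \<in> carrier W"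
  shows "lam (inv j) w = w"
proof -
  have j: "j \<in> J" and "lam j w = w" using assms by auto
  then show ?thesis using lam_inv(1)[OF j assms(2)] by (simp only:)
qed

lemma lam_dual_eq: "j \<in> J \<Longrightarrow> lam_dual j \<xi> = (\<lambda>w\<in>carrier W. \<xi> (lam (inv j) w))"
  by (simp add: contra_J_def contragredient_def contragredient_action_def)

text \<open>Every functional on \<open>W\<close> is smooth, because the open kernel of \<open>\<lambda>\<close> fixes it.\<close>

lemma WD_eq: "WD = pointwise_module (carrier W) complex_line (linear_maps W complex_line)"
proof -
  have "openin T {j \<in> J. lam_dual j \<xi> = \<xi>}" if \<xi>: "\<xi> \<in> linear_maps W complex_line" for \<xi>
  proof (rule openI_right_translates[OF lam_kernel_open])
    fix s u assume s: "s \<in> {j \<in> J. lam_dual j \<xi> = \<xi>}" and u: "u \<in> {j \<in> J. \<forall>w\<in>carrier W. lam j w = w}"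
    have "lam (inv u) w = w" if "w \<in> carrier W" for w by (rule lam_fix_inv[OF u that])
    then have "lam_dual (s \<otimes> u) \<xi> = lam_dual s \<xi>"
      using s u by (auto simp: lam_dual_eq fun_eq_iff restrict_def inv_mult_group lam_mult[symmetric])
    then show "s \<otimes> u \<in> {j \<in> J. lam_dual j \<xi> = \<xi>}" using s u by simp
  qed auto
  then show ?thesis
    by (auto simp: contra_J_def contragredient_def open_in_J intro!: arg_cong[where f = "pointwise_module _ _"])
qed

lemma WD_simps [simp]:
  "carrier WD = linear_maps W complex_line" "\<zero>\<^bsub>WD\<^esub> = (\<lambda>w\<in>carrier W. 0)"
  "\<xi> \<oplus>\<^bsub>WD\<^esub> \<eta> = (\<lambda>w\<in>carrier W. \<xi> w + \<eta> w)" "c \<odot>\<^bsub>WD\<^esub> \<xi> = (\<lambda>w\<in>carrier W. c * \<xi> w)"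
  unfolding WD_eq by simp_all

lemma WD_vectorspace: "vectorspace CC WD"
  unfolding WD_eq by (rule vectorspace_linear_maps[OF lamD(1) vectorspace_complex_line])

sublocale WD: cvs WD by (rule cvsI) (rule WD_vectorspace)

lemma functionalD:
  assumes "\<xi> \<in> linear_maps W complex_line"
  shows "w \<in> carrier W \<Longrightarrow> w' \<in> carrier W \<Longrightarrow> \<xi> (w \<oplus>\<^bsub>W\<^esub> w') = \<xi> w + \<xi> w'"
    and "w \<in> carrier W \<Longrightarrow> \<xi> (c \<odot>\<^bsub>W\<^esub> w) = c * \<xi> w" and "\<xi> \<zero>\<^bsub>W\<^esub> = 0"
  using module_homD[OF linear_maps_hom[OF assms]]
    clinear.zero[OF clinearI[OF lamD(1) vectorspace_complex_line linear_maps_hom[OF assms]]] by auto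

lemma lam_dual_cl [simp, intro]:
  assumes "j \<in> J" "\<xi> \<in> linear_maps W complex_line"
  shows "lam_dual j \<xi> \<in> linear_maps W complex_line"
  using assms functionalD[OF assms(2)]
  by (auto simp: lam_dual_eq lam_add lam_smult intro!: linear_mapsI)

lemma functionals_separate:
  assumes "u \<in> carrier W" "u' \<in> carrier W" "\<And>\<xi>. \<xi> \<in> linear_maps W complex_line \<Longrightarrow> \<xi> u = \<xi> u'"
  shows "u = u'"
proof -
  obtain B e where B: "finite B" "B \<subseteq> carrier W" and e: "e \<in> B \<rightarrow> linear_maps W complex_line"
    and Be: "\<And>w. w \<in> carrier W \<Longrightarrow> w = finsum W (\<lambda>b. e b w \<odot>\<^bsub>W\<^esub> b) B"
    by (rule dual_basis[OF lamD(1) W_fin_dim]) (rule that)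
  have "e b u = e b u'" if "b \<in> B" for b
    using assms(3) funcset_mem[OF e that] by simp
  then have "finsum W (\<lambda>b. e b u \<odot>\<^bsub>W\<^esub> b) B = finsum W (\<lambda>b. e b u' \<odot>\<^bsub>W\<^esub> b) B"
    using B by (intro W.finsum_cong') auto
  then show ?thesis using Be[OF assms(1)] Be[OF assms(2)] by simp
qed

lemma functionals_separate_zero:
  assumes "u \<in> carrier W" "\<And>\<xi>. \<xi> \<in> linear_maps W complex_line \<Longrightarrow> \<xi> u = 0"
  shows "u = \<zero>\<^bsub>W\<^esub>"
proof (rule functionals_separate[OF assms(1) W.zero_closed])
  show "\<xi> u = \<xi> \<zero>\<^bsub>W\<^esub>" if "\<xi> \<in> linear_maps W complex_line" for \<xi>
    using assms(2)[OF that] functionalD(3)[OF that] by simp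
qed

text \<open>The vector with the coordinates \<open>F (e b)\<close> represents \<open>F\<close>.\<close>

lemma bidual:
  assumes F: "F \<in> module_hom CC WD complex_line"
  shows "\<exists>!u. u \<in> carrier W \<and> (\<forall>\<xi>\<in>linear_maps W complex_line. \<xi> u = F \<xi>)"
proof -
  obtain B e where B: "finite B" "B \<subseteq> carrier W" and e: "e \<in> B \<rightarrow> linear_maps W complex_line"
    and Be: "\<And>w. w \<in> carrier W \<Longrightarrow> w = finsum W (\<lambda>b. e b w \<odot>\<^bsub>W\<^esub> b) B"
    by (rule dual_basis[OF lamD(1) W_fin_dim]) (rule that)
  interpret C: cvs complex_line by (rule cvsI[OF vectorspace_complex_line])
  interpret F: clinear WD complex_line F by (rule clinearI[OF WD_vectorspace vectorspace_complex_line F])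
  define u where "u = finsum W (\<lambda>b. F (e b) \<odot>\<^bsub>W\<^esub> b) B"
  have u: "u \<in> carrier W" using B by (auto simp: u_def intro!: W.finsum_closed)
  have "\<xi> u = F \<xi>" if \<xi>: "\<xi> \<in> linear_maps W complex_line" for \<xi>
  proof -
    interpret \<xi>: clinear W complex_line \<xi>
      by (rule clinearI[OF lamD(1) vectorspace_complex_line linear_maps_hom[OF \<xi>]])
    have t: "(\<lambda>b. \<xi> b \<odot>\<^bsub>WD\<^esub> e b) \<in> B \<rightarrow> carrier WD"
      using e B by (intro funcsetI WD.smult_cl) auto
    have exp: "finsum WD (\<lambda>b. \<xi> b \<odot>\<^bsub>WD\<^esub> e b) B = \<xi>" (is "?s = _")
    proof
      fix w
      have s: "?s \<in> linear_maps W complex_line" using WD.finsum_closed[OF t] by simp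
      show "?s w = \<xi> w"
      proof (cases "w \<in> carrier W")
        case True
        have "?s w = finsum complex_line (\<lambda>b. (\<xi> b \<odot>\<^bsub>WD\<^esub> e b) w) B"
          unfolding WD_eq using t[unfolded WD_eq] B(1) True WD_vectorspace[unfolded WD_eq]
          by (subst finsum_pointwise[OF _ vectorspace_complex_line linear_maps_subset]) auto
        also have "\<dots> = finsum complex_line (\<lambda>b. \<xi> (e b w \<odot>\<^bsub>W\<^esub> b)) B"
          using True B(2) by (intro C.finsum_cong') (auto simp: \<xi>.smult)
        also have "\<dots> = \<xi> (finsum W (\<lambda>b. e b w \<odot>\<^bsub>W\<^esub> b) B)"
          using B by (subst \<xi>.finsum) auto
        finally show ?thesis using Be[OF True] by simp
      qed (use s \<xi> in \<open>auto simp: linear_maps_def extensional_def\<close>)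
    qed
    have "\<xi> u = finsum complex_line (\<lambda>b. \<xi> (F (e b) \<odot>\<^bsub>W\<^esub> b)) B"
      unfolding u_def using B by (subst \<xi>.finsum) auto
    also have "\<dots> = finsum complex_line (\<lambda>b. F (\<xi> b \<odot>\<^bsub>WD\<^esub> e b)) B"
    proof (rule C.finsum_cong')
      show "\<xi> (F (e b) \<odot>\<^bsub>W\<^esub> b) = F (\<xi> b \<odot>\<^bsub>WD\<^esub> e b)" if "b \<in> B" for b
      proof -
        have "e b \<in> carrier WD" "b \<in> carrier W" using that e B by auto
        then show ?thesis by (simp only: \<xi>.smult F.smult) simp
      qed
    qed auto
    also have "\<dots> = F (finsum WD (\<lambda>b. \<xi> b \<odot>\<^bsub>WD\<^esub> e b) B)"
      using F.finsum[OF B(1) t] by simp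
    finally show ?thesis unfolding exp .
  qed
  then show ?thesis
    using u functionals_separate by (intro ex1I[of _ u]) auto
qed

lemma transpose_End:
  assumes B: "B \<in> linear_maps WD WD" and w: "w \<in> carrier W"
  shows "transpose_End W WD B w \<in> carrier W"
    and "\<And>\<xi>. \<xi> \<in> linear_maps W complex_line \<Longrightarrow> \<xi> (transpose_End W WD B w) = B \<xi> w"
proof -
  have "(\<lambda>\<xi>. B \<xi> w) \<in> module_hom CC WD complex_line"
    using module_homD[OF linear_maps_hom[OF B]] w by (intro module_homI) auto
  from theI'[OF bidual[OF this]] w
  show "transpose_End W WD B w \<in> carrier W"
    and "\<And>\<xi>. \<xi> \<in> linear_maps W complex_line \<Longrightarrow> \<xi> (transpose_End W WD B w) = B \<xi> w"
    by (auto simp: transpose_End_def)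
qed

end

section \<open>Compact induction\<close>

context induction_datum begin

abbreviation "IND \<equiv> fst (compact_ind G T J (W, lam))"

definition translate :: "'g \<Rightarrow> ('g \<Rightarrow> 'w) \<Rightarrow> 'g \<Rightarrow> 'w" where
  "translate g f = (\<lambda>x\<in>carrier G. f (x \<otimes> g))"

text \<open>A function in the compactly induced representation is supported on a union of cosets \<open>Jx\<close>, so that
  compactness of its support becomes finiteness of this set.\<close>

definition support_cosets :: "('g \<Rightarrow> 'w) \<Rightarrow> 'g set set" where
  "support_cosets f = (\<lambda>x. J #> x) ` {x \<in> carrier G. f x \<noteq> \<zero>\<^bsub>W\<^esub>}"

lemma compact_ind_eq: "compact_ind G T J (W, lam) = (IND, translate)"
  by (simp add: compact_ind_def translate_def fun_eq_iff)

lemma IND_eq: "IND = pointwise_module (carrier G) W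
  {f \<in> carrier G \<rightarrow>\<^sub>E carrier W. (\<forall>j\<in>J. \<forall>g\<in>carrier G. f (j \<otimes> g) = lam j (f g)) \<and> finite (support_cosets f)}"
  by (simp add: compact_ind_def compactly_supported_def support_cosets_def relatively_compact_iff_r)

lemma IND_iff: "f \<in> carrier IND \<longleftrightarrow> f \<in> carrier G \<rightarrow>\<^sub>E carrier W \<and>
    (\<forall>j\<in>J. \<forall>g\<in>carrier G. f (j \<otimes> g) = lam j (f g)) \<and> finite (support_cosets f)"
  unfolding IND_eq by simp

lemma INDD:
  assumes "f \<in> carrier IND"
  shows "\<And>g. g \<in> carrier G \<Longrightarrow> f g \<in> carrier W"
    and "\<And>g. g \<notin> carrier G \<Longrightarrow> f g = undefined"
    and "\<And>j g. j \<in> J \<Longrightarrow> g \<in> carrier G \<Longrightarrow> f (j \<otimes> g) = lam j (f g)"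
    and "finite (support_cosets f)"
  using assms unfolding IND_iff by (auto simp: PiE_def extensional_def)

lemma INDI:
  assumes "\<And>g. g \<in> carrier G \<Longrightarrow> f g \<in> carrier W" "f \<in> extensional (carrier G)"
    and "\<And>j g. j \<in> J \<Longrightarrow> g \<in> carrier G \<Longrightarrow> f (j \<otimes> g) = lam j (f g)"
    and "finite (support_cosets f)"
  shows "f \<in> carrier IND"
  using assms unfolding IND_iff by (auto simp: PiE_def)

lemma IND_simps [simp]:
  "\<zero>\<^bsub>IND\<^esub> = (\<lambda>x\<in>carrier G. \<zero>\<^bsub>W\<^esub>)" "f \<oplus>\<^bsub>IND\<^esub> f' = (\<lambda>x\<in>carrier G. f x \<oplus>\<^bsub>W\<^esub> f' x)"
  "c \<odot>\<^bsub>IND\<^esub> f = (\<lambda>x\<in>carrier G. c \<odot>\<^bsub>W\<^esub> f x)"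
  unfolding IND_eq by simp_all

lemma support_cosets_add: "support_cosets (\<lambda>x\<in>carrier G. f x \<oplus>\<^bsub>W\<^esub> f' x) \<subseteq> support_cosets f \<union> support_cosets f'"
proof
  fix C assume "C \<in> support_cosets (\<lambda>x\<in>carrier G. f x \<oplus>\<^bsub>W\<^esub> f' x)"
  then obtain x where x: "x \<in> carrier G" "f x \<oplus>\<^bsub>W\<^esub> f' x \<noteq> \<zero>\<^bsub>W\<^esub>" "C = J #> x"
    by (auto simp: support_cosets_def)
  then have "f x \<noteq> \<zero>\<^bsub>W\<^esub> \<or> f' x \<noteq> \<zero>\<^bsub>W\<^esub>" by auto
  then show "C \<in> support_cosets f \<union> support_cosets f'" using x(1,3) by (auto simp: support_cosets_def)
qed

lemma support_cosets_smult: "support_cosets (\<lambda>x\<in>carrier G. c \<odot>\<^bsub>W\<^esub> f x) \<subseteq> support_cosets f"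
  by (auto simp: support_cosets_def)

lemma IND_vectorspace: "vectorspace CC IND"
proof -
  have "(\<lambda>x\<in>carrier G. \<zero>\<^bsub>W\<^esub>) \<in> carrier IND"
    by (rule INDI) (auto simp: support_cosets_def)
  moreover have "(\<lambda>x\<in>carrier G. f x \<oplus>\<^bsub>W\<^esub> f' x) \<in> carrier IND" if f: "f \<in> carrier IND" and f': "f' \<in> carrier IND" for f f'
  proof (rule INDI)
    show "finite (support_cosets (\<lambda>x\<in>carrier G. f x \<oplus>\<^bsub>W\<^esub> f' x))"
      using INDD(4)[OF f] INDD(4)[OF f'] by (intro finite_subset[OF support_cosets_add]) simp
    show "(\<lambda>x\<in>carrier G. f x \<oplus>\<^bsub>W\<^esub> f' x) (j \<otimes> g) = lam j ((\<lambda>x\<in>carrier G. f x \<oplus>\<^bsub>W\<^esub> f' x) g)"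
      if "j \<in> J" "g \<in> carrier G" for j g
      using that INDD(1,3)[OF f] INDD(1,3)[OF f'] by (simp add: lam_add)
  qed (use INDD(1)[OF f] INDD(1)[OF f'] in auto)
  moreover have "(\<lambda>x\<in>carrier G. c \<odot>\<^bsub>W\<^esub> f x) \<in> carrier IND" if f: "f \<in> carrier IND" for c f
  proof (rule INDI)
    show "finite (support_cosets (\<lambda>x\<in>carrier G. c \<odot>\<^bsub>W\<^esub> f x))"
      using INDD(4)[OF f] by (intro finite_subset[OF support_cosets_smult])
    show "(\<lambda>x\<in>carrier G. c \<odot>\<^bsub>W\<^esub> f x) (j \<otimes> g) = lam j ((\<lambda>x\<in>carrier G. c \<odot>\<^bsub>W\<^esub> f x) g)"
      if "j \<in> J" "g \<in> carrier G" for j g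
      using that INDD(1,3)[OF f] by (simp add: lam_smult)
  qed (use INDD(1)[OF f] in auto)
  ultimately show ?thesis
    unfolding IND_iff unfolding IND_eq by (intro vectorspace_pointwise lamD(1)) auto
qed

sublocale IND: cvs IND by (rule cvsI) (rule IND_vectorspace)

lemma translate_cl [simp, intro]:
  assumes f: "f \<in> carrier IND" and g: "g \<in> carrier G"
  shows "translate g f \<in> carrier IND"
proof (rule INDI)
  have "support_cosets (translate g f) \<subseteq> (\<lambda>C. C #> inv g) ` support_cosets f"
  proof
    fix C assume "C \<in> support_cosets (translate g f)"
    then obtain x where x: "x \<in> carrier G" "f (x \<otimes> g) \<noteq> \<zero>\<^bsub>W\<^esub>" "C = J #> x"
      by (auto simp: support_cosets_def translate_def)
    have "C = (J #> (x \<otimes> g)) #> inv g"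
      using x(1) g by (simp add: x(3) coset_mult_assoc subgroup.subset[OF J_subgroup] m_assoc)
    then show "C \<in> (\<lambda>C. C #> inv g) ` support_cosets f"
      using x g by (auto simp: support_cosets_def)
  qed
  then show "finite (support_cosets (translate g f))"
    using INDD(4)[OF f] finite_surj by blast
qed (use INDD[OF f] g in \<open>auto simp: translate_def m_assoc\<close>)

lemma translate_hom:
  assumes g: "g \<in> carrier G"
  shows "translate g \<in> module_hom CC IND IND"
proof (rule module_homI)
  show "translate g (f \<oplus>\<^bsub>IND\<^esub> f') = translate g f \<oplus>\<^bsub>IND\<^esub> translate g f'" for f f'
    using g by (auto simp: translate_def fun_eq_iff)
  show "translate g (c \<odot>\<^bsub>IND\<^esub> f) = c \<odot>\<^bsub>IND\<^esub> translate g f" for f c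
    using g by (auto simp: translate_def fun_eq_iff)
qed (rule translate_cl[OF _ g])

lemma IND_rep: "is_rep G (IND, translate)"
proof (rule is_repI)
  show "translate \<one> f = f" if "f \<in> carrier IND" for f
    using INDD(2)[OF that] by (auto simp: translate_def fun_eq_iff)
  show "translate (g \<otimes> h) f = translate g (translate h f)" if "g \<in> carrier G" "h \<in> carrier G" for g h f
    using that by (auto simp: translate_def fun_eq_iff m_assoc)
qed (auto intro: IND_vectorspace translate_hom)

text \<open>The canonical \<open>J\<close>-equivariant embedding of \<open>W\<close> into the compactly induced representation, often written
  \<open>w \<mapsto> f\<^sub>w\<close>.\<close>

definition delta :: "'w \<Rightarrow> 'g \<Rightarrow> 'w" where
  "delta w = (\<lambda>g\<in>carrier G. if g \<in> J then lam g w else \<zero>\<^bsub>W\<^esub>)"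

lemma J_cancel_left: "j \<in> J \<Longrightarrow> g \<in> carrier G \<Longrightarrow> j \<otimes> g \<in> J \<longleftrightarrow> g \<in> J"
proof
  assume j: "j \<in> J" and g: "g \<in> carrier G" and jg: "j \<otimes> g \<in> J"
  have "inv j \<otimes> (j \<otimes> g) \<in> J" by (rule J_simps(4)[OF J_simps(3)[OF j] jg])
  then show "g \<in> J" using j g by (simp add: m_assoc[symmetric])
qed auto

lemma delta_cl [simp, intro]:
  assumes w: "w \<in> carrier W"
  shows "delta w \<in> carrier IND"
proof (rule INDI)
  have "support_cosets (delta w) \<subseteq> {J}"
    using w coset_join2[OF _ J_subgroup] by (auto simp: support_cosets_def delta_def split: if_splits)
  then show "finite (support_cosets (delta w))" using finite_subset by blast
  show "delta w (j \<otimes> g) = lam j (delta w g)" if "j \<in> J" "g \<in> carrier G" for j g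
    using that w by (auto simp: delta_def J_cancel_left lam_mult)
qed (use w in \<open>auto simp: delta_def\<close>)

lemma delta_hom: "delta \<in> module_hom CC W IND"
proof (rule module_homI)
  show "delta (w \<oplus>\<^bsub>W\<^esub> w') = delta w \<oplus>\<^bsub>IND\<^esub> delta w'" if "w \<in> carrier W" "w' \<in> carrier W" for w w'
    using that by (auto simp: delta_def fun_eq_iff lam_add)
  show "delta (c \<odot>\<^bsub>W\<^esub> w) = c \<odot>\<^bsub>IND\<^esub> delta w" if "w \<in> carrier W" for w c
    using that by (auto simp: delta_def fun_eq_iff lam_smult)
qed (rule delta_cl)

lemma translate_delta: "j \<in> J \<Longrightarrow> w \<in> carrier W \<Longrightarrow> translate j (delta w) = delta (lam j w)"
proof -
  assume j: "j \<in> J" and w: "w \<in> carrier W"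
  have "x \<otimes> j \<in> J \<longleftrightarrow> x \<in> J" if "x \<in> carrier G" for x
  proof
    assume xj: "x \<otimes> j \<in> J"
    have "x \<otimes> j \<otimes> inv j \<in> J" by (rule J_simps(4)[OF xj J_simps(3)[OF j]])
    then show "x \<in> J" using j that by (simp add: m_assoc)
  qed (use j in auto)
  then show ?thesis using j w by (auto simp: translate_def delta_def fun_eq_iff lam_mult)
qed

lemma translate_delta_apply:
  assumes "g \<in> carrier G" "x \<in> carrier G"
  shows "translate g (delta w) x = (if x \<otimes> g \<in> J then lam (x \<otimes> g) w else \<zero>\<^bsub>W\<^esub>)"
  using assms by (simp add: translate_def delta_def)

text \<open>Removing one coset from the support at a time exhibits a compactly supported function as a
  sum of translates of the functions \<open>delta w\<close>.\<close>

lemma IND_generated: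
  assumes U: "subspace CC U IND" and d: "\<And>g w. g \<in> carrier G \<Longrightarrow> w \<in> carrier W \<Longrightarrow> translate g (delta w) \<in> U"
  shows "U = carrier IND"
proof -
  have U': "U \<subseteq> carrier IND" "\<zero>\<^bsub>IND\<^esub> \<in> U" "\<And>x y. x \<in> U \<Longrightarrow> y \<in> U \<Longrightarrow> x \<oplus>\<^bsub>IND\<^esub> y \<in> U"
    using U by (auto simp: subspace_iff[OF IND_vectorspace])
  have "f \<in> U" if "f \<in> carrier IND" for f
    using that
  proof (induction "card (support_cosets f)" arbitrary: f rule: less_induct)
    case less
    note f = INDD[OF less.prems]
    show ?case
    proof (cases "\<exists>x\<in>carrier G. f x \<noteq> \<zero>\<^bsub>W\<^esub>")
      case False
      then have "f = \<zero>\<^bsub>IND\<^esub>" using f(2) by (auto simp: fun_eq_iff)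
      then show ?thesis using U'(2) by simp
    next
      case True
      then obtain x where x: "x \<in> carrier G" "f x \<noteq> \<zero>\<^bsub>W\<^esub>" by auto
      define p where "p = translate (inv x) (delta (f x))"
      have p: "p \<in> carrier IND" "p \<in> U" using x f(1) d by (auto simp: p_def)
      have p_eq: "p y = (if y \<in> J #> x then f y else \<zero>\<^bsub>W\<^esub>)" if y: "y \<in> carrier G" for y
      proof (cases "y \<in> J #> x")
        case True
        then have j: "y \<otimes> inv x \<in> J" using r_coset_iff[OF x(1) y] by simp
        have "f y = f ((y \<otimes> inv x) \<otimes> x)" using x(1) y by (simp add: m_assoc)
        also have "\<dots> = lam (y \<otimes> inv x) (f x)" using f(3)[OF j x(1)] .
        finally show ?thesis using True x(1) y j by (simp add: p_def translate_delta_apply)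
      qed (use x(1) y r_coset_iff[OF x(1) y] in \<open>simp add: p_def translate_delta_apply\<close>)
      define f' where "f' = (\<lambda>y\<in>carrier G. if y \<in> J #> x then \<zero>\<^bsub>W\<^esub> else f y)"
      have f'_in: "f' \<in> carrier IND"
      proof (rule INDI)
        have "support_cosets f' \<subseteq> support_cosets f"
          by (auto simp: support_cosets_def f'_def split: if_splits)
        then show "finite (support_cosets f')" using f(4) finite_subset by blast
        show "f' (j \<otimes> y) = lam j (f' y)" if "j \<in> J" "y \<in> carrier G" for j y
          using that x(1) f(3) J_cancel_left[of j "y \<otimes> inv x"]
          by (auto simp: f'_def r_coset_iff m_assoc)
      qed (use f(1) in \<open>auto simp: f'_def\<close>)
      have "support_cosets f' \<subset> support_cosets f"
      proof
        show "support_cosets f' \<subseteq> support_cosets f"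
          by (auto simp: support_cosets_def f'_def split: if_splits)
        have "J #> x \<notin> support_cosets f'"
        proof
          assume "J #> x \<in> support_cosets f'"
          then obtain y where y: "y \<in> carrier G" "f' y \<noteq> \<zero>\<^bsub>W\<^esub>" "J #> x = J #> y"
            by (auto simp: support_cosets_def)
          have "y \<in> J #> x" unfolding y(3) using y(1) by (simp add: r_coset_iff)
          then show False using y by (simp add: f'_def)
        qed
        moreover have "J #> x \<in> support_cosets f" using x by (auto simp: support_cosets_def)
        ultimately show "support_cosets f' \<noteq> support_cosets f" by blast
      qed
      then have "card (support_cosets f') < card (support_cosets f)"
        by (rule psubset_card_mono[OF f(4)])
      then have "f' \<in> U" using less.hyps f'_in by blast
      moreover have "f = f' \<oplus>\<^bsub>IND\<^esub> p"
        using f(1,2) p_eq by (auto simp: fun_eq_iff f'_def)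
      ultimately show ?thesis using U'(3)[OF _ p(2)] by simp
    qed
  qed
  then show ?thesis using U'(1) by blast
qed

lemma IND_hom_eqI:
  fixes Y :: "(complex, 'y) module"
  assumes Y: "vectorspace CC Y" and A: "A \<in> module_hom CC IND Y" and B: "B \<in> module_hom CC IND Y"
    and eq: "\<And>g w. g \<in> carrier G \<Longrightarrow> w \<in> carrier W \<Longrightarrow> A (translate g (delta w)) = B (translate g (delta w))"
    and f: "f \<in> carrier IND"
  shows "A f = B f"
proof -
  interpret A: clinear IND Y A by (rule clinearI[OF IND_vectorspace Y A])
  interpret B: clinear IND Y B by (rule clinearI[OF IND_vectorspace Y B])
  have "subspace CC {f \<in> carrier IND. A f = B f} IND"
    unfolding subspace_iff[OF IND_vectorspace]
    using A.zero B.zero A.add B.add A.smult B.smult IND.zero_closed IND.a_closed IND.smult_cl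
    by (auto simp del: IND_simps)
  then have "{f \<in> carrier IND. A f = B f} = carrier IND"
    by (rule IND_generated) (use eq in auto)
  then show ?thesis using f by blast
qed

text \<open>If \<open>S\<close> is the stabilizer of \<open>w\<close> in \<open>J\<close>, the translate \<open>g f\<^sub>w\<close> is fixed by the open set \<open>g S g\<^sup>-\<^sup>1\<close>; and
  the vectors with an open set of fixing elements around the identity form a subspace.\<close>

lemma IND_smooth: "smooth_rep G T (IND, translate)"
proof -
  define S where "S = {f \<in> carrier IND. \<exists>U. openin T U \<and> \<one> \<in> U \<and> (\<forall>u\<in>U. translate u f = f)}"
  have "subspace CC S IND"
    unfolding subspace_iff[OF IND_vectorspace]
  proof (intro conjI ballI allI)
    show "S \<subseteq> carrier IND" by (auto simp: S_def)
    have "translate u \<zero>\<^bsub>IND\<^esub> = \<zero>\<^bsub>IND\<^esub>" if "u \<in> carrier G" for u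
      using that by (auto simp: translate_def fun_eq_iff)
    then show "\<zero>\<^bsub>IND\<^esub> \<in> S"
      unfolding S_def using J_open by (intro CollectI conjI IND.zero_closed exI[of _ J]) auto
    show "f \<oplus>\<^bsub>IND\<^esub> f' \<in> S" if fS: "f \<in> S" "f' \<in> S" for f f'
    proof -
      obtain U where U: "openin T U" "\<one> \<in> U" "\<forall>u\<in>U. translate u f = f"
        using fS(1) by (auto simp: S_def)
      obtain U' where U': "openin T U'" "\<one> \<in> U'" "\<forall>u\<in>U'. translate u f' = f'"
        using fS(2) by (auto simp: S_def)
      have "translate u (f \<oplus>\<^bsub>IND\<^esub> f') = f \<oplus>\<^bsub>IND\<^esub> f'" if u: "u \<in> U \<inter> U'" for u
      proof -
        have "u \<in> carrier G" using u openin_subset[OF U(1)] topspace by auto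
        then show ?thesis
          using module_homD(2)[OF translate_hom, of u f f'] u U(3) U'(3) \<open>f \<in> S\<close> \<open>f' \<in> S\<close>
          by (simp add: S_def del: IND_simps)
      qed
      then show ?thesis unfolding S_def using fS U U'
        by (intro CollectI conjI exI[of _ "U \<inter> U'"] IND.a_closed openin_Int) (auto simp: S_def)
    qed
    show "c \<odot>\<^bsub>IND\<^esub> f \<in> S" if fS: "f \<in> S" for c f
    proof -
      obtain U where U: "openin T U" "\<one> \<in> U" "\<forall>u\<in>U. translate u f = f"
        using fS by (auto simp: S_def)
      have "translate u (c \<odot>\<^bsub>IND\<^esub> f) = c \<odot>\<^bsub>IND\<^esub> f" if u: "u \<in> U" for u
      proof -
        have "u \<in> carrier G" using u openin_subset[OF U(1)] topspace by auto
        then show ?thesis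
          using module_homD(3)[OF translate_hom, of u f c] u U(3) \<open>f \<in> S\<close>
          by (simp add: S_def del: IND_simps)
      qed
      then show ?thesis unfolding S_def using fS U
        by (intro CollectI conjI exI[of _ U] IND.smult_cl) (auto simp: S_def)
    qed
  qed
  then have "S = carrier IND"
  proof (rule IND_generated)
    fix g w assume g: "g \<in> carrier G" and w: "w \<in> carrier W"
    define U where "U = (\<lambda>x. x \<otimes> inv g) ` (\<lambda>x. g \<otimes> x) ` {j \<in> J. lam j w = w}"
    have "openin T U" unfolding U_def
      using g open_stabilizer[OF lam_smooth w] by (intro open_r_trans open_l_trans) auto
    moreover have "\<one> \<in> U" unfolding U_def image_image
      using g w by (intro image_eqI[of _ _ \<one>]) auto
    moreover have "translate u (translate g (delta w)) = translate g (delta w)" if uU: "u \<in> U" for u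
    proof -
      obtain j where j: "j \<in> J" "lam j w = w" "u = g \<otimes> j \<otimes> inv g" using uU by (auto simp: U_def)
      have "u \<otimes> g = g \<otimes> j" using j g by (simp add: m_assoc)
      then have "translate u (translate g (delta w)) = translate g (translate j (delta w))"
        using is_repD(5)[OF IND_rep, of u g "delta w"] is_repD(5)[OF IND_rep, of g j "delta w"] j g w by simp
      then show ?thesis using j w by (simp add: translate_delta)
    qed
    ultimately show "translate g (delta w) \<in> S" using g w by (auto simp: S_def)
  qed
  have "openin T {g \<in> carrier G. translate g f = f}" if f: "f \<in> carrier IND" for f
  proof -
    obtain U where U: "openin T U" "\<one> \<in> U" "\<forall>u\<in>U. translate u f = f"
      using f \<open>S = carrier IND\<close> by (auto simp: S_def)
    have "U \<subseteq> carrier G" using openin_subset[OF U(1)] topspace by auto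
    then show ?thesis
      using U(3) is_repD(5)[OF IND_rep] f
      by (intro openI_right_translates[OF U(1,2)]) auto
  qed
  then show ?thesis using IND_rep by (simp add: smooth_rep_def)
qed

subsection \<open>Linear maps out of the compactly induced representation\<close>

text \<open>The universal property of compact induction.  If \<open>\<Theta> (j x) \<circ> \<lambda>(j) = \<Theta> x\<close> for \<open>j\<close> in \<open>J\<close>, the summand does not
  depend on the representatives of the cosets, and the linear map \<open>ind_ext Y \<Theta>\<close> sends \<open>g f\<^sub>w\<close> to \<open>\<Theta> g\<^sup>-\<^sup>1 w\<close>.  It
  serves twice: with values in a representation for Frobenius reciprocity, and with values in the complex numbers
  for the functionals attached to a function in the big Hecke space.\<close>

definition ind_ext :: "(complex, 'y) module \<Rightarrow> ('g \<Rightarrow> 'w \<Rightarrow> 'y) \<Rightarrow> ('g \<Rightarrow> 'w) \<Rightarrow> 'y" where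
  "ind_ext Y \<Theta> f = finsum_supp Y (\<lambda>C. \<Theta> (coset_rep C) (f (coset_rep C))) (rcosets J)"

lemma support_cosets_rep:
  assumes "C \<in> rcosets J" "f (coset_rep C) \<noteq> \<zero>\<^bsub>W\<^esub>"
  shows "C \<in> support_cosets f"
  using rcosetsE[OF assms(1)] assms(2) by (force simp: support_cosets_def)

lemma support_cosets_subset: "support_cosets f \<subseteq> rcosets J"
  by (auto simp: support_cosets_def RCOSETS_def)

lemma ind_ext_eq:
  fixes Y :: "(complex, 'y) module"
  assumes Y: "vectorspace CC Y" and \<Theta>: "\<And>x. x \<in> carrier G \<Longrightarrow> \<Theta> x \<in> module_hom CC W Y"
    and f: "f \<in> carrier IND" and S: "finite S" "S \<subseteq> rcosets J" "support_cosets f \<subseteq> S"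
  shows "ind_ext Y \<Theta> f = finsum Y (\<lambda>C. \<Theta> (coset_rep C) (f (coset_rep C))) S"
  unfolding ind_ext_def
proof (rule finsum_supp_eq[OF Y S(1,2)])
  fix C assume C: "C \<in> rcosets J" and nz: "\<Theta> (coset_rep C) (f (coset_rep C)) \<noteq> \<zero>\<^bsub>Y\<^esub>"
  have "f (coset_rep C) \<noteq> \<zero>\<^bsub>W\<^esub>"
    using nz clinear.zero[OF clinearI[OF lamD(1) Y \<Theta>[OF rcosetsE(1)[OF C]]]] by auto
  then show "C \<in> S" using support_cosets_rep[of C f] C S(3) by blast
next
  fix C assume "C \<in> S"
  then have C: "coset_rep C \<in> carrier G" using rcosetsE S(2) by auto
  show "\<Theta> (coset_rep C) (f (coset_rep C)) \<in> carrier Y"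
    using module_homD(1)[OF \<Theta>[OF C]] INDD(1)[OF f C] by simp
qed

lemma ind_ext_hom:
  fixes Y :: "(complex, 'y) module"
  assumes Y: "vectorspace CC Y" and \<Theta>: "\<And>x. x \<in> carrier G \<Longrightarrow> \<Theta> x \<in> module_hom CC W Y"
  shows "ind_ext Y \<Theta> \<in> module_hom CC IND Y"
proof (rule module_homI)
  interpret Y: cvs Y by (rule cvsI) (rule Y)
  have in_Y: "\<Theta> (coset_rep C) (f (coset_rep C)) \<in> carrier Y" if "C \<in> rcosets J" "f \<in> carrier IND" for C f
    using module_homD(1)[OF \<Theta>] rcosetsE[OF that(1)] INDD(1)[OF that(2)] by simp
  fix f assume f: "f \<in> carrier IND"
  note E = ind_ext_eq[OF Y \<Theta>]
  show "ind_ext Y \<Theta> f \<in> carrier Y"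
    using E[OF _ f INDD(4)[OF f] support_cosets_subset order_refl] in_Y[OF _ f] support_cosets_subset[of f]
    by (auto intro!: Y.finsum_closed)
  show "ind_ext Y \<Theta> (c \<odot>\<^bsub>IND\<^esub> f) = c \<odot>\<^bsub>Y\<^esub> ind_ext Y \<Theta> f" for c
  proof -
    have sub: "support_cosets (c \<odot>\<^bsub>IND\<^esub> f) \<subseteq> support_cosets f" by (simp add: support_cosets_smult)
    have "ind_ext Y \<Theta> (c \<odot>\<^bsub>IND\<^esub> f) = finsum Y (\<lambda>C. \<Theta> (coset_rep C) ((c \<odot>\<^bsub>IND\<^esub> f) (coset_rep C))) (support_cosets f)"
      by (rule E[OF _ IND.smult_cl[OF f] INDD(4)[OF f] support_cosets_subset sub])
    also have "\<dots> = finsum Y (\<lambda>C. c \<odot>\<^bsub>Y\<^esub> \<Theta> (coset_rep C) (f (coset_rep C))) (support_cosets f)"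
      using support_cosets_subset[of f] rcosetsE INDD(1)[OF f] module_homD(3)[OF \<Theta>] in_Y[OF _ f]
      by (intro Y.finsum_cong') auto
    also have "\<dots> = c \<odot>\<^bsub>Y\<^esub> ind_ext Y \<Theta> f"
      using in_Y[OF _ f] support_cosets_subset[of f] INDD(4)[OF f]
      by (subst E[OF _ f INDD(4)[OF f] support_cosets_subset order_refl]) (auto intro!: Y.smult_finsum[symmetric])
    finally show ?thesis .
  qed
  fix f' assume f': "f' \<in> carrier IND"
  let ?S = "support_cosets f \<union> support_cosets f'"
  have S: "finite ?S" "?S \<subseteq> rcosets J" using INDD(4)[OF f] INDD(4)[OF f'] support_cosets_subset by auto
  have "ind_ext Y \<Theta> (f \<oplus>\<^bsub>IND\<^esub> f') = finsum Y (\<lambda>C. \<Theta> (coset_rep C) ((f \<oplus>\<^bsub>IND\<^esub> f') (coset_rep C))) ?S"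
    by (rule E[OF _ IND.a_closed[OF f f'] S]) (simp_all add: support_cosets_add)
  also have "\<dots> = finsum Y (\<lambda>C. \<Theta> (coset_rep C) (f (coset_rep C)) \<oplus>\<^bsub>Y\<^esub> \<Theta> (coset_rep C) (f' (coset_rep C))) ?S"
    using S(2) rcosetsE INDD(1)[OF f] INDD(1)[OF f'] module_homD(2)[OF \<Theta>] in_Y f f'
    by (intro Y.finsum_cong') auto
  also have "\<dots> = ind_ext Y \<Theta> f \<oplus>\<^bsub>Y\<^esub> ind_ext Y \<Theta> f'"
    using E[OF _ f S] E[OF _ f' S] S(2) in_Y f f' by (subst Y.finsum_addf) auto
  finally show "ind_ext Y \<Theta> (f \<oplus>\<^bsub>IND\<^esub> f') = ind_ext Y \<Theta> f \<oplus>\<^bsub>Y\<^esub> ind_ext Y \<Theta> f'" .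
qed

text \<open>The function \<open>g f\<^sub>w\<close> lives on the single coset \<open>J g\<^sup>-\<^sup>1\<close>.\<close>

lemma ind_ext_translate_delta:
  fixes Y :: "(complex, 'y) module"
  assumes Y: "vectorspace CC Y" and \<Theta>: "\<And>x. x \<in> carrier G \<Longrightarrow> \<Theta> x \<in> module_hom CC W Y"
    and inv: "\<And>j x w. j \<in> J \<Longrightarrow> x \<in> carrier G \<Longrightarrow> w \<in> carrier W \<Longrightarrow> \<Theta> (j \<otimes> x) (lam j w) = \<Theta> x w"
    and g: "g \<in> carrier G" and w: "w \<in> carrier W"
  shows "ind_ext Y \<Theta> (translate g (delta w)) = \<Theta> (inv g) w"
proof -
  interpret Y: cvs Y by (rule cvsI) (rule Y)
  let ?C = "J #> inv g"
  have sub: "support_cosets (translate g (delta w)) \<subseteq> {?C}"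
  proof
    fix C assume "C \<in> support_cosets (translate g (delta w))"
    then obtain x where x: "x \<in> carrier G" "x \<otimes> g \<in> J" "C = J #> x"
      using g by (auto simp: support_cosets_def translate_delta_apply split: if_splits)
    then have "x \<in> ?C" using g by (simp add: r_coset_iff)
    then show "C \<in> {?C}" using r_coset_eq[of "inv g" x] g x(3) by simp
  qed
  obtain j where j: "j \<in> J" "coset_rep ?C = j \<otimes> inv g" using coset_rep_r[of "inv g"] g by auto
  have "ind_ext Y \<Theta> (translate g (delta w))
      = finsum Y (\<lambda>C. \<Theta> (coset_rep C) (translate g (delta w) (coset_rep C))) {?C}"
    using g w by (intro ind_ext_eq[OF Y \<Theta> _ _ _ sub]) (auto simp: RCOSETS_def)
  also have "\<dots> = \<Theta> (j \<otimes> inv g) (lam j w)"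
    using g w j module_homD(1)[OF \<Theta>, of "j \<otimes> inv g"]
    by (simp add: j(2) translate_delta_apply m_assoc)
  also have "\<dots> = \<Theta> (inv g) w" using inv[OF j(1) _ w] g by simp
  finally show ?thesis .
qed

subsection \<open>Frobenius reciprocity\<close>

lemma frobenius_eq: "frobenius G J (W, lam) A = (\<lambda>w\<in>carrier W. A (delta w))"
  unfolding frobenius_def delta_def fst_conv snd_conv ..

text \<open>The translates of the \<open>f\<^sub>w\<close> span the compactly induced representation.\<close>

lemma frobenius_inj:
  assumes V: "is_rep G (V, \<rho>)"
  shows "inj_on (frobenius G J (W, lam)) (intertwiners G (IND, translate) (V, \<rho>))"
proof (rule inj_onI)
  fix A B assume A: "A \<in> intertwiners G (IND, translate) (V, \<rho>)" and B: "B \<in> intertwiners G (IND, translate) (V, \<rho>)"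
    and eq: "frobenius G J (W, lam) A = frobenius G J (W, lam) B"
  have d: "A (delta w) = B (delta w)" if "w \<in> carrier W" for w
    using fun_cong[OF eq, of w] that by (simp add: frobenius_eq)
  have "A f = B f" if f: "f \<in> carrier IND" for f
  proof (rule IND_hom_eqI[OF is_repD(1)[OF V] intertwinersD(2)[OF A] intertwinersD(2)[OF B] _ f])
    show "A (translate g (delta w)) = B (translate g (delta w))" if "g \<in> carrier G" "w \<in> carrier W" for g w
      using that d[of w] intertwinersD(3)[OF A, of g "delta w"] intertwinersD(3)[OF B, of g "delta w"]
      by simp
  qed
  then show "A = B"
    using intertwinersD(1)[OF A] intertwinersD(1)[OF B] unfolding linear_maps_def
    by (intro extensionalityI[of A "carrier IND" B]) auto
qed

text \<open>The extension of \<open>\<alpha>\<close> maps \<open>f\<close> to the sum of \<open>\<rho>(x\<^sup>-\<^sup>1) (\<alpha> (f x))\<close> over \<open>x\<close> in \<open>J\G\<close>.\<close>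

lemma frobenius_surj:
  assumes V: "is_rep G (V, \<rho>)" and \<alpha>: "\<alpha> \<in> intertwiners GJ (W, lam) (V, \<rho>)"
  obtains A where "A \<in> intertwiners G (IND, translate) (V, \<rho>)" "frobenius G J (W, lam) A = \<alpha>"
proof -
  note V' = is_repD[OF V]
  note \<alpha>' = J_intertwinersD[OF \<alpha>]
  interpret V: cvs V by (rule cvsI) (rule V'(1))
  define \<Theta> where "\<Theta> = (\<lambda>x w. \<rho> (inv x) (\<alpha> w))"
  have \<Theta>: "\<Theta> x \<in> module_hom CC W V" if "x \<in> carrier G" for x
    using module_homD[OF V'(2)[of "inv x"]] module_homD[OF \<alpha>'(2)] that
    by (intro module_homI) (auto simp: \<Theta>_def)
  have inv: "\<Theta> (j \<otimes> x) (lam j w) = \<Theta> x w" if "j \<in> J" "x \<in> carrier G" "w \<in> carrier W" for j x w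
  proof -
    have a: "\<alpha> w \<in> carrier V" using module_homD(1)[OF \<alpha>'(2)] that by simp
    have "\<Theta> (j \<otimes> x) (lam j w) = \<rho> (inv x \<otimes> inv j) (\<rho> j (\<alpha> w))"
      using that \<alpha>'(3) by (simp add: \<Theta>_def inv_mult_group)
    also have "\<dots> = \<rho> (inv x \<otimes> inv j \<otimes> j) (\<alpha> w)"
      using V'(5)[of "inv x \<otimes> inv j" j] that a by simp
    finally show ?thesis using that by (simp add: \<Theta>_def m_assoc)
  qed
  define A where "A = restrict (ind_ext V \<Theta>) (carrier IND)"
  have A: "A \<in> linear_maps IND V"
    unfolding A_def by (rule restrict_hom[OF IND_vectorspace ind_ext_hom[OF V'(1) \<Theta>]])
  have Ad: "A (translate g (delta w)) = \<rho> g (\<alpha> w)" if "g \<in> carrier G" "w \<in> carrier W" for g w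
    using that ind_ext_translate_delta[OF V'(1) \<Theta> inv, of g w] by (simp add: A_def \<Theta>_def)
  have "A (translate h f) = \<rho> h (A f)" if h: "h \<in> carrier G" and f: "f \<in> carrier IND" for h f
  proof (rule IND_hom_eqI[OF V'(1) _ _ _ f])
    show "(\<lambda>f. A (translate h f)) \<in> module_hom CC IND V"
      using module_homD[OF translate_hom[OF h]] module_homD[OF linear_maps_hom[OF A]]
      by (intro module_homI) (auto simp del: IND_simps)
    show "(\<lambda>f. \<rho> h (A f)) \<in> module_hom CC IND V"
      using module_homD[OF V'(2)[OF h]] module_homD[OF linear_maps_hom[OF A]]
      by (intro module_homI) (auto simp del: IND_simps)
    show "A (translate h (translate g (delta w))) = \<rho> h (A (translate g (delta w)))"
      if "g \<in> carrier G" "w \<in> carrier W" for g w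
      using that h Ad[of "h \<otimes> g" w] Ad[of g w] is_repD(5)[OF IND_rep, of h g "delta w"]
        V'(5)[of h g "\<alpha> w"] module_homD(1)[OF \<alpha>'(2), of w] by simp
  qed
  then have Ai: "A \<in> intertwiners G (IND, translate) (V, \<rho>)"
    using A by (intro intertwinersI) auto
  have "frobenius G J (W, lam) A = \<alpha>"
  proof
    fix w
    show "frobenius G J (W, lam) A w = \<alpha> w"
    proof (cases "w \<in> carrier W")
      case True
      have "A (delta w) = A (translate \<one> (delta w))"
        using is_repD(4)[OF IND_rep, of "delta w"] True by simp
      also have "\<dots> = \<alpha> w"
        using Ad[of \<one> w] True V'(4)[of "\<alpha> w"] module_homD(1)[OF \<alpha>'(2), of w] by simp
      finally show ?thesis using True by (simp add: frobenius_eq)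
    qed (use \<alpha>'(1) in \<open>auto simp: frobenius_eq linear_maps_def extensional_def\<close>)
  qed
  then show thesis by (rule that[OF Ai])
qed

end

section \<open>The Hecke algebra\<close>

context induction_datum begin

abbreviation "HB \<equiv> Hecke_bar G T J (W, lam)"
abbreviation "HA \<equiv> Hecke G T J (W, lam)"
abbreviation "dual \<equiv> linear_maps W complex_line"

lemma End_simps [simp]:
  "carrier (End_space WD) = linear_maps WD WD" "\<zero>\<^bsub>End_space WD\<^esub> = (\<lambda>\<xi>\<in>dual. \<lambda>w\<in>carrier W. 0)"
  "A \<oplus>\<^bsub>End_space WD\<^esub> B = (\<lambda>\<xi>\<in>dual. \<lambda>w\<in>carrier W. A \<xi> w + B \<xi> w)"
  "c \<odot>\<^bsub>End_space WD\<^esub> A = (\<lambda>\<xi>\<in>dual. \<lambda>w\<in>carrier W. c * A \<xi> w)"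
  by (simp_all add: End_space_def)

lemma End_vectorspace: "vectorspace CC (End_space WD)"
  unfolding End_space_def by (rule vectorspace_linear_maps[OF WD_vectorspace WD_vectorspace])

lemma End_cl: "A \<in> linear_maps WD WD \<Longrightarrow> \<xi> \<in> dual \<Longrightarrow> A \<xi> \<in> dual"
  using linear_maps_subset[of WD WD] by auto

lemma lam_dual_apply: "j \<in> J \<Longrightarrow> w \<in> carrier W \<Longrightarrow> lam_dual j \<xi> w = \<xi> (lam (inv j) w)"
  by (simp add: lam_dual_eq)

lemma dual_ext:
  assumes "\<xi> \<in> dual" "\<eta> \<in> dual" "\<And>w. w \<in> carrier W \<Longrightarrow> \<xi> w = \<eta> w"
  shows "\<xi> = \<eta>"
  using assms by (intro extensionalityI[of \<xi> "carrier W" \<eta>]) (auto simp: linear_maps_def)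

lemma lam_dual_one: "\<xi> \<in> dual \<Longrightarrow> lam_dual \<one> \<xi> = \<xi>"
  by (rule dual_ext) (auto simp: lam_dual_apply)

lemma End_ext:
  assumes "A \<in> linear_maps WD WD" "B \<in> linear_maps WD WD"
    "\<And>\<xi> w. \<xi> \<in> dual \<Longrightarrow> w \<in> carrier W \<Longrightarrow> A \<xi> w = B \<xi> w"
  shows "A = B"
proof (rule extensionalityI[of A dual B])
  show "A \<xi> = B \<xi>" if "\<xi> \<in> dual" for \<xi>
    using that assms End_cl by (intro dual_ext) auto
qed (use assms in \<open>auto simp: linear_maps_def\<close>)

lemma End_lin:
  assumes "A \<in> linear_maps WD WD" "w \<in> carrier W"
  shows "\<xi> \<in> dual \<Longrightarrow> \<eta> \<in> dual \<Longrightarrow> A (\<lambda>w\<in>carrier W. \<xi> w + \<eta> w) w = A \<xi> w + A \<eta> w"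
    and "\<xi> \<in> dual \<Longrightarrow> A (\<lambda>w\<in>carrier W. c * \<xi> w) w = c * A \<xi> w"
  using module_homD(2,3)[OF linear_maps_hom[OF assms(1)]] assms(2) by simp_all

text \<open>Evaluating the equivariance at a functional and a vector moves the left action of \<open>J\<close> from the dual to \<open>W\<close>
  itself, and no composition of restricted maps is left.\<close>

lemma HB_iff: "\<Psi> \<in> carrier HB \<longleftrightarrow> \<Psi> \<in> carrier G \<rightarrow>\<^sub>E linear_maps WD WD \<and>
  (\<forall>j1\<in>J. \<forall>j2\<in>J. \<forall>g\<in>carrier G. \<forall>\<xi>\<in>dual. \<forall>w\<in>carrier W.
     \<Psi> (j1 \<otimes> g \<otimes> j2) \<xi> w = \<Psi> g (lam_dual j2 \<xi>) (lam (inv j1) w))" (is "_ \<longleftrightarrow> ?R")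
proof -
  have eq: "\<Psi> (j1 \<otimes> g \<otimes> j2) = compose dual (lam_dual j1) (compose dual (\<Psi> g) (lam_dual j2)) \<longleftrightarrow>
      (\<forall>\<xi>\<in>dual. \<forall>w\<in>carrier W. \<Psi> (j1 \<otimes> g \<otimes> j2) \<xi> w = \<Psi> g (lam_dual j2 \<xi>) (lam (inv j1) w))"
    if \<Psi>: "\<Psi> \<in> carrier G \<rightarrow>\<^sub>E linear_maps WD WD" and j: "j1 \<in> J" "j2 \<in> J" "g \<in> carrier G" for j1 j2 g
  proof
    assume "\<Psi> (j1 \<otimes> g \<otimes> j2) = compose dual (lam_dual j1) (compose dual (\<Psi> g) (lam_dual j2))"
    then show "\<forall>\<xi>\<in>dual. \<forall>w\<in>carrier W. \<Psi> (j1 \<otimes> g \<otimes> j2) \<xi> w = \<Psi> g (lam_dual j2 \<xi>) (lam (inv j1) w)"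
      using j by (simp add: compose_def lam_dual_apply)
  next
    assume R: "\<forall>\<xi>\<in>dual. \<forall>w\<in>carrier W. \<Psi> (j1 \<otimes> g \<otimes> j2) \<xi> w = \<Psi> g (lam_dual j2 \<xi>) (lam (inv j1) w)"
    have P: "\<Psi> (j1 \<otimes> g \<otimes> j2) \<in> linear_maps WD WD" "\<Psi> g \<in> linear_maps WD WD"
      using \<Psi> j by auto
    show "\<Psi> (j1 \<otimes> g \<otimes> j2) = compose dual (lam_dual j1) (compose dual (\<Psi> g) (lam_dual j2))"
    proof (rule extensionalityI[of _ dual])
      show "\<Psi> (j1 \<otimes> g \<otimes> j2) \<xi> = compose dual (lam_dual j1) (compose dual (\<Psi> g) (lam_dual j2)) \<xi>"
        if "\<xi> \<in> dual" for \<xi>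
        using R that j End_cl[OF P(1) that] End_cl[OF P(2) lam_dual_cl[OF j(2) that]]
        by (intro dual_ext) (auto simp: compose_def lam_dual_apply)
    qed (use P in \<open>auto simp: linear_maps_def\<close>)
  qed
  have "\<Psi> \<in> carrier HB \<longleftrightarrow> \<Psi> \<in> carrier G \<rightarrow>\<^sub>E linear_maps WD WD \<and> (\<forall>j1\<in>J. \<forall>j2\<in>J. \<forall>g\<in>carrier G.
     \<Psi> (j1 \<otimes> g \<otimes> j2) = compose dual (lam_dual j1) (compose dual (\<Psi> g) (lam_dual j2)))"
    by (simp add: Hecke_bar_def Let_def)
  then show ?thesis using eq by auto
qed

lemma HBD:
  assumes "\<Psi> \<in> carrier HB"
  shows "\<And>g. g \<in> carrier G \<Longrightarrow> \<Psi> g \<in> linear_maps WD WD"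
    and "\<And>g \<xi>. g \<in> carrier G \<Longrightarrow> \<xi> \<in> dual \<Longrightarrow> \<Psi> g \<xi> \<in> dual"
    and "\<And>g j \<xi> w. g \<in> carrier G \<Longrightarrow> j \<in> J \<Longrightarrow> \<xi> \<in> dual \<Longrightarrow> w \<in> carrier W \<Longrightarrow>
      \<Psi> (j \<otimes> g) \<xi> w = \<Psi> g \<xi> (lam (inv j) w)"
    and "\<And>g j \<xi> w. g \<in> carrier G \<Longrightarrow> j \<in> J \<Longrightarrow> \<xi> \<in> dual \<Longrightarrow> w \<in> carrier W \<Longrightarrow>
      \<Psi> (g \<otimes> j) \<xi> w = \<Psi> g (lam_dual j \<xi>) w"
proof -
  have ext: "\<Psi> \<in> carrier G \<rightarrow>\<^sub>E linear_maps WD WD" and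
    eq: "\<And>j1 j2 g \<xi> w. j1 \<in> J \<Longrightarrow> j2 \<in> J \<Longrightarrow> g \<in> carrier G \<Longrightarrow> \<xi> \<in> dual \<Longrightarrow> w \<in> carrier W \<Longrightarrow>
     \<Psi> (j1 \<otimes> g \<otimes> j2) \<xi> w = \<Psi> g (lam_dual j2 \<xi>) (lam (inv j1) w)"
    using assms unfolding HB_iff by auto
  show 1: "\<And>g. g \<in> carrier G \<Longrightarrow> \<Psi> g \<in> linear_maps WD WD" using ext by auto
  show "\<And>g \<xi>. g \<in> carrier G \<Longrightarrow> \<xi> \<in> dual \<Longrightarrow> \<Psi> g \<xi> \<in> dual" using End_cl[OF 1] .
  show "\<Psi> (j \<otimes> g) \<xi> w = \<Psi> g \<xi> (lam (inv j) w)"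
    if "g \<in> carrier G" "j \<in> J" "\<xi> \<in> dual" "w \<in> carrier W" for g j \<xi> w
    using eq[of j \<one> g \<xi> w] that by (simp add: lam_dual_one)
  show "\<Psi> (g \<otimes> j) \<xi> w = \<Psi> g (lam_dual j \<xi>) w"
    if "g \<in> carrier G" "j \<in> J" "\<xi> \<in> dual" "w \<in> carrier W" for g j \<xi> w
    using eq[of \<one> j g \<xi> w] that by simp
qed

lemma HB_ops [simp]:
  "\<zero>\<^bsub>HB\<^esub> = (\<lambda>g\<in>carrier G. \<lambda>\<xi>\<in>dual. \<lambda>w\<in>carrier W. 0)"
  "\<Psi> \<oplus>\<^bsub>HB\<^esub> \<Phi> = (\<lambda>g\<in>carrier G. \<lambda>\<xi>\<in>dual. \<lambda>w\<in>carrier W. \<Psi> g \<xi> w + \<Phi> g \<xi> w)"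
  "c \<odot>\<^bsub>HB\<^esub> \<Psi> = (\<lambda>g\<in>carrier G. \<lambda>\<xi>\<in>dual. \<lambda>w\<in>carrier W. c * \<Psi> g \<xi> w)"
  by (simp_all add: Hecke_bar_def Let_def)

lemma HB_ext:
  assumes "\<Psi> \<in> carrier HB" "\<Phi> \<in> carrier HB"
    "\<And>g \<xi> w. g \<in> carrier G \<Longrightarrow> \<xi> \<in> dual \<Longrightarrow> w \<in> carrier W \<Longrightarrow> \<Psi> g \<xi> w = \<Phi> g \<xi> w"
  shows "\<Psi> = \<Phi>"
proof (rule extensionalityI[of \<Psi> "carrier G" \<Phi>])
  show "\<Psi> g = \<Phi> g" if "g \<in> carrier G" for g
    using that assms HBD(1) by (intro End_ext) auto
qed (use assms in \<open>auto simp: HB_iff PiE_def\<close>)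

lemma HB_vectorspace: "vectorspace CC HB"
proof -
  interpret E: cvs "End_space WD" by (rule cvsI[OF End_vectorspace])
  have e: "HB = pointwise_module (carrier G) (End_space WD) (carrier HB)"
    by (simp add: Hecke_bar_def Let_def)
  have z: "\<zero>\<^bsub>HB\<^esub> \<in> carrier HB"
    using E.zero_closed unfolding HB_iff by auto
  have a: "\<Psi> \<oplus>\<^bsub>HB\<^esub> \<Phi> \<in> carrier HB" if P: "\<Psi> \<in> carrier HB" "\<Phi> \<in> carrier HB" for \<Psi> \<Phi>
    unfolding HB_iff
  proof (intro conjI ballI)
    show "\<Psi> \<oplus>\<^bsub>HB\<^esub> \<Phi> \<in> carrier G \<rightarrow>\<^sub>E linear_maps WD WD"
      using E.a_closed[of "\<Psi> _" "\<Phi> _"] HBD(1)[OF P(1)] HBD(1)[OF P(2)] by auto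
    show "(\<Psi> \<oplus>\<^bsub>HB\<^esub> \<Phi>) (j1 \<otimes> g \<otimes> j2) \<xi> w = (\<Psi> \<oplus>\<^bsub>HB\<^esub> \<Phi>) g (lam_dual j2 \<xi>) (lam (inv j1) w)"
      if "j1 \<in> J" "j2 \<in> J" "g \<in> carrier G" "\<xi> \<in> dual" "w \<in> carrier W" for j1 j2 g \<xi> w
      using P that unfolding HB_iff by simp
  qed
  have s: "c \<odot>\<^bsub>HB\<^esub> \<Psi> \<in> carrier HB" if P: "\<Psi> \<in> carrier HB" for c \<Psi>
    unfolding HB_iff
  proof (intro conjI ballI)
    show "c \<odot>\<^bsub>HB\<^esub> \<Psi> \<in> carrier G \<rightarrow>\<^sub>E linear_maps WD WD"
      using E.smult_cl[of "\<Psi> _" c] HBD(1)[OF P] by auto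
    show "(c \<odot>\<^bsub>HB\<^esub> \<Psi>) (j1 \<otimes> g \<otimes> j2) \<xi> w = (c \<odot>\<^bsub>HB\<^esub> \<Psi>) g (lam_dual j2 \<xi>) (lam (inv j1) w)"
      if "j1 \<in> J" "j2 \<in> J" "g \<in> carrier G" "\<xi> \<in> dual" "w \<in> carrier W" for j1 j2 g \<xi> w
      using P that unfolding HB_iff by simp
  qed
  show ?thesis
    by (subst e, rule vectorspace_pointwise[OF End_vectorspace])
      (use z a s in \<open>auto simp: HB_iff\<close>)
qed

lemma Hecke_iff: "\<phi> \<in> HA \<longleftrightarrow> \<phi> \<in> carrier HB \<and>
    finite ((\<lambda>x. x <# J) ` {x \<in> carrier G. \<phi> x \<noteq> \<zero>\<^bsub>End_space WD\<^esub>})"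
  unfolding Hecke_def compactly_supported_def
  by (subst relatively_compact_iff_l) auto

lemma r_coset_inv: "g \<in> carrier G \<Longrightarrow> J #> g = m_inv G ` (inv g <# J)"
proof -
  assume g: "g \<in> carrier G"
  have "m_inv G ` (inv g <# J) = (\<lambda>j. inv j \<otimes> g) ` J"
    using g by (auto simp: l_coset_image image_image inv_mult_group)
  also have "\<dots> = (\<lambda>j. j \<otimes> g) ` J"
  proof (intro equalityI subsetI)
    fix y assume "y \<in> (\<lambda>j. j \<otimes> g) ` J"
    then obtain j where "j \<in> J" "y = j \<otimes> g" by auto
    then show "y \<in> (\<lambda>j. inv j \<otimes> g) ` J" by (intro image_eqI[of _ _ "inv j"]) auto
  qed auto
  finally show ?thesis by (simp add: r_coset_image)
qed

lemma l_coset_inv: "g \<in> carrier G \<Longrightarrow> g <# J = m_inv G ` (J #> inv g)"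
proof -
  assume g: "g \<in> carrier G"
  have "m_inv G ` (J #> inv g) = (\<lambda>j. g \<otimes> inv j) ` J"
    using g by (auto simp: r_coset_image image_image inv_mult_group)
  also have "\<dots> = (\<lambda>j. g \<otimes> j) ` J"
  proof (intro equalityI subsetI)
    fix y assume "y \<in> (\<lambda>j. g \<otimes> j) ` J"
    then obtain j where "j \<in> J" "y = g \<otimes> j" by auto
    then show "y \<in> (\<lambda>j. g \<otimes> inv j) ` J" by (intro image_eqI[of _ _ "inv j"]) auto
  qed auto
  finally show ?thesis by (simp add: l_coset_image)
qed

subsection \<open>The action on the generators of the compactly induced representation\<close>

text \<open>This is \<open>\<phi>~ * f\<^sub>w\<close>, by \<open>Hecke_ind_conv_delta\<close> below.\<close>

definition hecke_fun :: "('g \<Rightarrow> ('w \<Rightarrow> complex) \<Rightarrow> 'w \<Rightarrow> complex) \<Rightarrow> 'w \<Rightarrow> 'g \<Rightarrow> 'w" where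
  "hecke_fun \<phi> w = (\<lambda>g\<in>carrier G. transpose_End W WD (\<phi> (inv g)) w)"

lemma hecke_fun_apply:
  assumes "\<phi> \<in> carrier HB" "w \<in> carrier W" "g \<in> carrier G"
  shows "hecke_fun \<phi> w g \<in> carrier W" "\<And>\<xi>. \<xi> \<in> dual \<Longrightarrow> \<xi> (hecke_fun \<phi> w g) = \<phi> (inv g) \<xi> w"
  using transpose_End[OF HBD(1)[OF assms(1)], of "inv g" w] assms by (auto simp: hecke_fun_def)

lemma hecke_fun_in:
  assumes "\<phi> \<in> HA" and w: "w \<in> carrier W"
  shows "hecke_fun \<phi> w \<in> carrier IND"
proof (rule INDI)
  have \<phi>: "\<phi> \<in> carrier HB" and fin: "finite ((\<lambda>x. x <# J) ` {x \<in> carrier G. \<phi> x \<noteq> \<zero>\<^bsub>End_space WD\<^esub>})"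
    using assms(1) by (auto simp: Hecke_iff)
  note h = hecke_fun_apply[OF \<phi> w]
  show "hecke_fun \<phi> w g \<in> carrier W" if "g \<in> carrier G" for g using h(1)[OF that] .
  show "hecke_fun \<phi> w (j \<otimes> g) = lam j (hecke_fun \<phi> w g)" if j: "j \<in> J" and g: "g \<in> carrier G" for j g
  proof (rule functionals_separate)
    fix \<xi> assume \<xi>: "\<xi> \<in> dual"
    have "\<xi> (hecke_fun \<phi> w (j \<otimes> g)) = \<phi> (inv g \<otimes> inv j) \<xi> w"
      using h(2)[of "j \<otimes> g" \<xi>] j g \<xi> by (simp add: inv_mult_group)
    also have "\<dots> = \<phi> (inv g) (lam_dual (inv j) \<xi>) w"
      using HBD(4)[OF \<phi>, of "inv g" "inv j" \<xi> w] j g \<xi> w by simp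
    also have "\<dots> = lam_dual (inv j) \<xi> (hecke_fun \<phi> w g)"
      using h(2)[OF g lam_dual_cl[OF J_simps(3)[OF j] \<xi>]] by simp
    also have "\<dots> = \<xi> (lam j (hecke_fun \<phi> w g))"
      using lam_dual_apply[of "inv j" "hecke_fun \<phi> w g" \<xi>] j h(1)[OF g] by simp
    finally show "\<xi> (hecke_fun \<phi> w (j \<otimes> g)) = \<xi> (lam j (hecke_fun \<phi> w g))" .
  qed (use h(1)[of "j \<otimes> g"] h(1)[OF g] j g in auto)
  have "support_cosets (hecke_fun \<phi> w) \<subseteq>
    (\<lambda>C. m_inv G ` C) ` (\<lambda>x. x <# J) ` {x \<in> carrier G. \<phi> x \<noteq> \<zero>\<^bsub>End_space WD\<^esub>}"
  proof
    fix C assume "C \<in> support_cosets (hecke_fun \<phi> w)"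
    then obtain g where g: "g \<in> carrier G" "hecke_fun \<phi> w g \<noteq> \<zero>\<^bsub>W\<^esub>" "C = J #> g"
      by (auto simp: support_cosets_def)
    have "\<phi> (inv g) \<noteq> \<zero>\<^bsub>End_space WD\<^esub>"
    proof
      assume z: "\<phi> (inv g) = \<zero>\<^bsub>End_space WD\<^esub>"
      have "hecke_fun \<phi> w g = \<zero>\<^bsub>W\<^esub>"
      proof (rule functionals_separate_zero[OF h(1)[OF g(1)]])
        show "\<xi> (hecke_fun \<phi> w g) = 0" if "\<xi> \<in> dual" for \<xi>
          unfolding h(2)[OF g(1) that] z using that w by simp
      qed
      then show False using g(2) by simp
    qed
    then show "C \<in> (\<lambda>C. m_inv G ` C) ` (\<lambda>x. x <# J) ` {x \<in> carrier G. \<phi> x \<noteq> \<zero>\<^bsub>End_space WD\<^esub>}"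
      unfolding g(3) r_coset_inv[OF g(1)] using g(1) by (intro imageI) auto
  qed
  then show "finite (support_cosets (hecke_fun \<phi> w))"
    using fin by (meson finite_imageI finite_subset)
qed (simp add: hecke_fun_def)

text \<open>As \<open>f\<^sub>w\<close> lives on \<open>J\<close>, only the coset \<open>gJ\<close> contributes to the value of the convolution at \<open>g\<close>.\<close>

lemma Hecke_ind_conv_delta:
  assumes "\<phi> \<in> HA" and w: "w \<in> carrier W"
  shows "Hecke_ind_conv G T J (W, lam) \<phi> (delta w) = hecke_fun \<phi> w"
proof
  fix g
  have \<phi>: "\<phi> \<in> carrier HB" using assms(1) by (simp add: Hecke_iff)
  show "Hecke_ind_conv G T J (W, lam) \<phi> (delta w) g = hecke_fun \<phi> w g"
  proof (cases "g \<in> carrier G")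
    case g: True
    let ?t = "\<lambda>C. Hecke_tilde G T J (W, lam) \<phi> (coset_rep C) (delta w (inv (coset_rep C) \<otimes> g))"
    let ?C = "g <# J"
    obtain j where j: "j \<in> J" "coset_rep ?C = g \<otimes> j" by (rule coset_rep_l[OF g])
    have gj: "inv (g \<otimes> j) \<otimes> g = inv j" using g j by (simp add: inv_mult_group m_assoc)
    have B: "\<phi> (inv (g \<otimes> j)) \<in> linear_maps WD WD" using HBD(1)[OF \<phi>] g j by simp
    have jw: "lam (inv j) w \<in> carrier W" using j w by simp
    have "?t ?C = transpose_End W WD (\<phi> (inv (g \<otimes> j))) (lam (inv j) w)"
      using j g gj by (simp add: Hecke_tilde_def delta_def)
    also have "\<dots> = hecke_fun \<phi> w g"
    proof (rule functionals_separate)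
      show "transpose_End W WD (\<phi> (inv (g \<otimes> j))) (lam (inv j) w) \<in> carrier W"
        by (rule transpose_End(1)[OF B jw])
      show "hecke_fun \<phi> w g \<in> carrier W" by (rule hecke_fun_apply(1)[OF \<phi> w g])
      fix \<xi> assume \<xi>: "\<xi> \<in> dual"
      have "\<xi> (transpose_End W WD (\<phi> (inv (g \<otimes> j))) (lam (inv j) w)) = \<phi> (inv j \<otimes> inv g) \<xi> (lam (inv j) w)"
        using transpose_End(2)[OF B jw \<xi>] g j by (simp add: inv_mult_group)
      also have "\<dots> = \<phi> (inv g) \<xi> w"
        using HBD(3)[OF \<phi>, of "inv g" "inv j" \<xi> "lam (inv j) w"] g j \<xi> w jw by simp
      finally show "\<xi> (transpose_End W WD (\<phi> (inv (g \<otimes> j))) (lam (inv j) w)) = \<xi> (hecke_fun \<phi> w g)"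
        using hecke_fun_apply(2)[OF \<phi> w g \<xi>] by simp
    qed
    finally have tC: "?t ?C = hecke_fun \<phi> w g" .
    have "finsum_supp W ?t (lcosets J) = finsum W ?t {?C}"
    proof (rule finsum_supp_eq[OF lamD(1)])
      fix C assume C: "C \<in> lcosets J" and nz: "?t C \<noteq> \<zero>\<^bsub>W\<^esub>"
      note x = lcosetsE[OF C]
      have B: "\<phi> (inv (coset_rep C)) \<in> linear_maps WD WD" using HBD(1)[OF \<phi>] x by simp
      have "transpose_End W WD (\<phi> (inv (coset_rep C))) \<zero>\<^bsub>W\<^esub> = \<zero>\<^bsub>W\<^esub>"
      proof (rule functionals_separate_zero[OF transpose_End(1)[OF B W.zero_closed]])
        show "\<xi> (transpose_End W WD (\<phi> (inv (coset_rep C))) \<zero>\<^bsub>W\<^esub>) = 0" if "\<xi> \<in> dual" for \<xi>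
          unfolding transpose_End(2)[OF B W.zero_closed that] by (rule functionalD(3)[OF End_cl[OF B that]])
      qed
      then have "inv (coset_rep C) \<otimes> g \<in> J"
        using nz g x by (auto simp: Hecke_tilde_def delta_def split: if_splits)
      then have gC: "g \<in> coset_rep C <# J" unfolding l_coset_iff[OF x(1) g] .
      show "C \<in> {?C}" using l_coset_eq[OF x(1) gC] x(2) by simp
    qed (use g tC hecke_fun_apply(1)[OF \<phi> w g] in \<open>auto simp: LCOSETS_def\<close>)
    also have "\<dots> = hecke_fun \<phi> w g"
      using tC hecke_fun_apply(1)[OF \<phi> w g] by simp
    finally show ?thesis using g by (simp add: Hecke_ind_conv_def)
  qed (simp add: Hecke_ind_conv_def hecke_fun_def)
qed

text \<open>Through Frobenius reciprocity, the Hecke module structure on the space of \<open>J\<close>-maps is evaluated on the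
  functions \<open>f\<^sub>w\<close> alone.\<close>

lemma Hecke_act_apply:
  assumes V: "is_rep G (V, \<rho>)" and \<phi>: "\<phi> \<in> HA" and w: "w \<in> carrier W"
    and A: "A \<in> intertwiners G (IND, translate) (V, \<rho>)" "frobenius G J (W, lam) A = \<alpha>"
  shows "Hecke_act G T J (W, lam) (V, \<rho>) \<phi> \<alpha> w = A (hecke_fun \<phi> w)"
proof -
  have "the_inv_into (intertwiners G (compact_ind G T J (W, lam)) (V, \<rho>)) (frobenius G J (W, lam)) \<alpha> = A"
    using the_inv_into_f_f[OF frobenius_inj[OF V] A(1)] A(2) by (subst compact_ind_eq) simp
  then have "Hecke_act G T J (W, lam) (V, \<rho>) \<phi> \<alpha> w
      = frobenius G J (W, lam) (Hecke_act_ind G T J (W, lam) \<phi> A) w"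
    by (simp add: Hecke_act_def)
  also have "\<dots> = A (hecke_fun \<phi> w)"
    using w by (simp add: frobenius_eq Hecke_act_ind_def Hecke_ind_conv_delta[OF \<phi>])
  finally show ?thesis .
qed

text \<open>The element \<open>\<phi>\<close> of the Hecke algebra is recovered from \<open>s\<close> by \<open>\<langle>w, \<phi>(g) \<xi>\<rangle> = \<langle>s w (g\<^sup>-\<^sup>1), \<xi>\<rangle>\<close>.  Its support
  is compact because \<open>s\<close> is determined by its values on a finite basis, each of which has compact support.\<close>

lemma Hom_ind_eq_Hecke:
  assumes s: "s \<in> intertwiners GJ (W, lam) (IND, translate)"
  obtains \<phi> where "\<phi> \<in> HA" "\<And>w. w \<in> carrier W \<Longrightarrow> s w = hecke_fun \<phi> w"
proof -
  note s' = J_intertwinersD[OF s]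
  have sX: "s w \<in> carrier IND" if "w \<in> carrier W" for w using module_homD(1)[OF s'(2) that] .
  have sW: "s w g \<in> carrier W" if "w \<in> carrier W" "g \<in> carrier G" for w g
    using INDD(1)[OF sX] that by simp
  have s_add: "s (w \<oplus>\<^bsub>W\<^esub> w') g = s w g \<oplus>\<^bsub>W\<^esub> s w' g"
    if "w \<in> carrier W" "w' \<in> carrier W" "g \<in> carrier G" for w w' g
    using module_homD(2)[OF s'(2)] that by simp
  have s_smult: "s (c \<odot>\<^bsub>W\<^esub> w) g = c \<odot>\<^bsub>W\<^esub> s w g" if "w \<in> carrier W" "g \<in> carrier G" for c w g
    using module_homD(3)[OF s'(2)] that by simp
  have s_J: "s w (x \<otimes> j) = s (lam j w) x" if "w \<in> carrier W" "x \<in> carrier G" "j \<in> J" for w x j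
    using s'(3)[of j w] that by (simp add: translate_def)
  define \<phi> where "\<phi> = (\<lambda>g\<in>carrier G. \<lambda>\<xi>\<in>dual. \<lambda>w\<in>carrier W. \<xi> (s w (inv g)))"
  have \<phi>_dual: "\<phi> g \<xi> \<in> dual" if "g \<in> carrier G" "\<xi> \<in> dual" for g \<xi>
    using that functionalD[OF that(2)] s_add s_smult sW
    by (intro linear_mapsI) (auto simp: \<phi>_def)
  have \<phi>_lin: "\<phi> g \<in> linear_maps WD WD" if g: "g \<in> carrier G" for g
  proof (rule linear_mapsI)
    show "\<phi> g (\<xi> \<oplus>\<^bsub>WD\<^esub> \<eta>) = \<phi> g \<xi> \<oplus>\<^bsub>WD\<^esub> \<phi> g \<eta>" if "\<xi> \<in> carrier WD" "\<eta> \<in> carrier WD" for \<xi> \<eta>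
      using that g sW WD.a_closed[OF that] by (auto simp: \<phi>_def fun_eq_iff)
    show "\<phi> g (c \<odot>\<^bsub>WD\<^esub> \<xi>) = c \<odot>\<^bsub>WD\<^esub> \<phi> g \<xi>" if "\<xi> \<in> carrier WD" for \<xi> c
      using that g sW WD.smult_cl[OF that, of c] by (auto simp: \<phi>_def fun_eq_iff)
  qed (use g \<phi>_dual in \<open>auto simp: \<phi>_def\<close>)
  have \<phi>: "\<phi> \<in> carrier HB"
    unfolding HB_iff
  proof (intro conjI ballI)
    show "\<phi> \<in> carrier G \<rightarrow>\<^sub>E linear_maps WD WD" using \<phi>_lin by (auto simp: \<phi>_def)
    fix j1 j2 g \<xi> w
    assume j: "j1 \<in> J" "j2 \<in> J" and g: "g \<in> carrier G" and \<xi>: "\<xi> \<in> dual" and w: "w \<in> carrier W"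
    have "s w (inv (j1 \<otimes> g \<otimes> j2)) = s w (inv j2 \<otimes> (inv g \<otimes> inv j1))"
      using j g by (simp add: inv_mult_group m_assoc)
    also have "\<dots> = lam (inv j2) (s w (inv g \<otimes> inv j1))"
      using INDD(3)[OF sX[OF w], of "inv j2" "inv g \<otimes> inv j1"] j g by simp
    also have "\<dots> = lam (inv j2) (s (lam (inv j1) w) (inv g))"
      using s_J[OF w, of "inv g" "inv j1"] j g by simp
    finally have e: "s w (inv (j1 \<otimes> g \<otimes> j2)) = lam (inv j2) (s (lam (inv j1) w) (inv g))" .
    have "\<phi> (j1 \<otimes> g \<otimes> j2) \<xi> w = \<xi> (s w (inv (j1 \<otimes> g \<otimes> j2)))"
      using j g \<xi> w by (simp add: \<phi>_def)
    also have "\<dots> = lam_dual j2 \<xi> (s (lam (inv j1) w) (inv g))"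
      unfolding e using j g w sW[of "lam (inv j1) w" "inv g"] by (simp add: lam_dual_apply)
    also have "\<dots> = \<phi> g (lam_dual j2 \<xi>) (lam (inv j1) w)"
      using j g \<xi> w by (simp add: \<phi>_def)
    finally show "\<phi> (j1 \<otimes> g \<otimes> j2) \<xi> w = \<phi> g (lam_dual j2 \<xi>) (lam (inv j1) w)" .
  qed
  obtain B e where B: "finite B" "B \<subseteq> carrier W" and e: "e \<in> B \<rightarrow> dual"
    and Be: "\<And>w. w \<in> carrier W \<Longrightarrow> w = finsum W (\<lambda>b. e b w \<odot>\<^bsub>W\<^esub> b) B"
    by (rule dual_basis[OF lamD(1) W_fin_dim]) (rule that)
  have "(\<lambda>x. x <# J) ` {x \<in> carrier G. \<phi> x \<noteq> \<zero>\<^bsub>End_space WD\<^esub>}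
      \<subseteq> (\<lambda>C. m_inv G ` C) ` (\<Union>b\<in>B. support_cosets (s b))"
  proof clarify
    fix x assume x: "x \<in> carrier G" and nz: "\<phi> x \<noteq> \<zero>\<^bsub>End_space WD\<^esub>"
    have "\<exists>b\<in>B. s b (inv x) \<noteq> \<zero>\<^bsub>W\<^esub>"
    proof (rule ccontr)
      assume z: "\<not> (\<exists>b\<in>B. s b (inv x) \<noteq> \<zero>\<^bsub>W\<^esub>)"
      have "(\<lambda>w. s w (inv x)) \<in> module_hom CC W W"
        using sW s_add s_smult x by (intro module_homI) auto
      then interpret sx: clinear W W "\<lambda>w. s w (inv x)" by (rule clinearI[OF lamD(1) lamD(1)])
      have "s w (inv x) = \<zero>\<^bsub>W\<^esub>" if w: "w \<in> carrier W" for w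
      proof -
        have "s (finsum W (\<lambda>b. e b w \<odot>\<^bsub>W\<^esub> b) B) (inv x) = finsum W (\<lambda>b. s (e b w \<odot>\<^bsub>W\<^esub> b) (inv x)) B"
          using B by (intro sx.finsum) auto
        also have "\<dots> = finsum W (\<lambda>b. \<zero>\<^bsub>W\<^esub>) B"
          using B z by (intro W.finsum_cong') (auto simp: sx.smult subsetD)
        finally show ?thesis using Be[OF w] by (simp add: W.finsum_zero)
      qed
      then have "\<phi> x = \<zero>\<^bsub>End_space WD\<^esub>"
        unfolding End_simps \<phi>_def using x functionalD(3) by (auto simp: fun_eq_iff)
      then show False using nz by simp
    qed
    then obtain b where b: "b \<in> B" "s b (inv x) \<noteq> \<zero>\<^bsub>W\<^esub>" by auto
    then have "J #> inv x \<in> support_cosets (s b)" using x by (auto simp: support_cosets_def)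
    then show "x <# J \<in> (\<lambda>C. m_inv G ` C) ` (\<Union>b\<in>B. support_cosets (s b))"
      unfolding l_coset_inv[OF x] using b(1) by blast
  qed
  moreover have "finite (\<Union>b\<in>B. support_cosets (s b))"
    using B INDD(4)[OF sX] by auto
  ultimately have HA: "\<phi> \<in> HA"
    using \<phi> unfolding Hecke_iff by (meson finite_imageI finite_subset)
  have "s w = hecke_fun \<phi> w" if w: "w \<in> carrier W" for w
  proof
    fix g
    show "s w g = hecke_fun \<phi> w g"
    proof (cases "g \<in> carrier G")
      case g: True
      show ?thesis
      proof (rule functionals_separate[OF sW[OF w g] hecke_fun_apply(1)[OF \<phi> w g]])
        show "\<xi> (s w g) = \<xi> (hecke_fun \<phi> w g)" if "\<xi> \<in> dual" for \<xi>
          using hecke_fun_apply(2)[OF \<phi> w g that] g w that by (simp add: \<phi>_def)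
      qed
    qed (use INDD(2)[OF sX[OF w]] in \<open>simp add: hecke_fun_def\<close>)
  qed
  then show thesis using that HA by blast
qed

end

context induction_datum begin

section \<open>Eigenfunctions as functionals on the compactly induced representation\<close>

text \<open>The functional \<open>l\<^sub>\<xi>\<close> sending \<open>f\<close> to the sum of \<open>\<langle>f x, \<Psi>(x) \<xi>\<rangle>\<close> over \<open>x\<close> in \<open>J\G\<close>.\<close>

definition eig_functional :: "('g \<Rightarrow> ('w \<Rightarrow> complex) \<Rightarrow> 'w \<Rightarrow> complex) \<Rightarrow> ('w \<Rightarrow> complex) \<Rightarrow> ('g \<Rightarrow> 'w) \<Rightarrow> complex" where
  "eig_functional \<Psi> \<xi> = ind_ext complex_line (\<lambda>x. \<Psi> x \<xi>)"

lemma eig_functional_hom: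
  assumes "\<Psi> \<in> carrier HB" "\<xi> \<in> dual"
  shows "eig_functional \<Psi> \<xi> \<in> module_hom CC IND complex_line"
  unfolding eig_functional_def
  using HBD(2)[OF assms(1) _ assms(2)] linear_maps_hom
  by (intro ind_ext_hom vectorspace_complex_line) blast

lemma eig_functional_lin:
  assumes "\<Psi> \<in> carrier HB" "\<xi> \<in> dual"
  shows "f \<in> carrier IND \<Longrightarrow> f' \<in> carrier IND \<Longrightarrow>
      eig_functional \<Psi> \<xi> (f \<oplus>\<^bsub>IND\<^esub> f') = eig_functional \<Psi> \<xi> f + eig_functional \<Psi> \<xi> f'"
    and "f \<in> carrier IND \<Longrightarrow> eig_functional \<Psi> \<xi> (c \<odot>\<^bsub>IND\<^esub> f) = c * eig_functional \<Psi> \<xi> f"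
    and "eig_functional \<Psi> \<xi> \<zero>\<^bsub>IND\<^esub> = 0"
    and "f \<in> carrier IND \<Longrightarrow> f' \<in> carrier IND \<Longrightarrow>
      eig_functional \<Psi> \<xi> (f \<ominus>\<^bsub>IND\<^esub> f') = eig_functional \<Psi> \<xi> f - eig_functional \<Psi> \<xi> f'"
proof -
  interpret l: clinear IND complex_line "eig_functional \<Psi> \<xi>"
    by (rule clinearI[OF IND_vectorspace vectorspace_complex_line eig_functional_hom[OF assms]])
  have um: "\<ominus>\<^bsub>complex_line\<^esub> c = - c" for c :: complex
    using l.W.minus_eq_smult[of c] by simp
  show "f \<in> carrier IND \<Longrightarrow> f' \<in> carrier IND \<Longrightarrow>
      eig_functional \<Psi> \<xi> (f \<oplus>\<^bsub>IND\<^esub> f') = eig_functional \<Psi> \<xi> f + eig_functional \<Psi> \<xi> f'"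
    using l.add[of f f'] by simp
  show "f \<in> carrier IND \<Longrightarrow> eig_functional \<Psi> \<xi> (c \<odot>\<^bsub>IND\<^esub> f) = c * eig_functional \<Psi> \<xi> f"
    using l.smult[of f c] by simp
  show "eig_functional \<Psi> \<xi> \<zero>\<^bsub>IND\<^esub> = 0" using l.zero by simp
  show "f \<in> carrier IND \<Longrightarrow> f' \<in> carrier IND \<Longrightarrow>
      eig_functional \<Psi> \<xi> (f \<ominus>\<^bsub>IND\<^esub> f') = eig_functional \<Psi> \<xi> f - eig_functional \<Psi> \<xi> f'"
    using l.diff[of f f'] by (simp add: l.W.minus_eq um del: IND_simps)
qed

lemma eig_functional_sum:
  assumes "\<Psi> \<in> carrier HB" "\<xi> \<in> dual" "f \<in> carrier IND"
  shows "eig_functional \<Psi> \<xi> f = (\<Sum>C\<in>support_cosets f. \<Psi> (coset_rep C) \<xi> (f (coset_rep C)))"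
  unfolding eig_functional_def
  using HBD(2)[OF assms(1) _ assms(2)] linear_maps_hom
  by (subst ind_ext_eq[OF vectorspace_complex_line _ assms(3) INDD(4)[OF assms(3)] support_cosets_subset order_refl])
    (blast, rule finsum_complex_line)

lemma support_rep:
  assumes "f \<in> carrier IND" "C \<in> support_cosets f"
  shows "coset_rep C \<in> carrier G" "f (coset_rep C) \<in> carrier W"
  using rcosetsE(1)[of C] support_cosets_subset[of f] assms(2) INDD(1)[OF assms(1)] by auto

lemma eig_functional_delta:
  assumes \<Psi>: "\<Psi> \<in> carrier HB" and \<xi>: "\<xi> \<in> dual" and g: "g \<in> carrier G" and w: "w \<in> carrier W"
  shows "eig_functional \<Psi> \<xi> (translate g (delta w)) = \<Psi> (inv g) \<xi> w"
  unfolding eig_functional_def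
proof (rule ind_ext_translate_delta[OF vectorspace_complex_line _ _ g w])
  show "\<Psi> x \<xi> \<in> module_hom CC W complex_line" if "x \<in> carrier G" for x
    using HBD(2)[OF \<Psi> that \<xi>] by (rule linear_maps_hom)
  show "\<Psi> (j \<otimes> x) \<xi> (lam j w) = \<Psi> x \<xi> w" if "j \<in> J" "x \<in> carrier G" "w \<in> carrier W" for j x w
    using HBD(3)[OF \<Psi> that(2,1) \<xi>, of "lam j w"] that by simp
qed

lemma dual_hom_eqI:
  assumes "A \<in> module_hom CC IND complex_line" "B \<in> module_hom CC IND complex_line" "f \<in> carrier IND"
    "\<And>g w. g \<in> carrier G \<Longrightarrow> w \<in> carrier W \<Longrightarrow> A (translate g (delta w)) = B (translate g (delta w))"
  shows "A f = B f"
  by (rule IND_hom_eqI[OF vectorspace_complex_line assms(1,2,4,3)])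

lemma eig_functional_J:
  assumes \<Psi>: "\<Psi> \<in> carrier HB" and \<xi>: "\<xi> \<in> dual" and j: "j \<in> J" and f: "f \<in> carrier IND"
  shows "eig_functional \<Psi> \<xi> (translate j f) = eig_functional \<Psi> (lam_dual (inv j) \<xi>) f"
proof (rule dual_hom_eqI[OF _ eig_functional_hom[OF \<Psi> lam_dual_cl[OF J_simps(3)[OF j] \<xi>]] f])
  show "(\<lambda>f. eig_functional \<Psi> \<xi> (translate j f)) \<in> module_hom CC IND complex_line"
    using module_homD[OF translate_hom, of j] module_homD[OF eig_functional_hom[OF \<Psi> \<xi>]] j
    by (intro module_homI) (auto simp del: IND_simps)
  fix g w assume g: "g \<in> carrier G" and w: "w \<in> carrier W"
  have "eig_functional \<Psi> \<xi> (translate j (translate g (delta w))) = eig_functional \<Psi> \<xi> (translate (j \<otimes> g) (delta w))"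
    using is_repD(5)[OF IND_rep, of j g "delta w"] j g w by simp
  also have "\<dots> = \<Psi> (inv g \<otimes> inv j) \<xi> w"
    using eig_functional_delta[OF \<Psi> \<xi> _ w, of "j \<otimes> g"] j g by (simp add: inv_mult_group)
  also have "\<dots> = \<Psi> (inv g) (lam_dual (inv j) \<xi>) w"
    using HBD(4)[OF \<Psi>, of "inv g" "inv j" \<xi> w] j g \<xi> w by simp
  also have "\<dots> = eig_functional \<Psi> (lam_dual (inv j) \<xi>) (translate g (delta w))"
    using eig_functional_delta[OF \<Psi> lam_dual_cl[OF J_simps(3)[OF j] \<xi>] g w] by simp
  finally show "eig_functional \<Psi> \<xi> (translate j (translate g (delta w))) =
    eig_functional \<Psi> (lam_dual (inv j) \<xi>) (translate g (delta w))" .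
qed

text \<open>By the definition of \<open>\<phi>~ * f\<^sub>w\<close> as a transpose, \<open>\<langle>w, \<phi>(g x\<^sup>-\<^sup>1) \<Psi>(x) \<xi>\<rangle>\<close> is the pairing of \<open>(\<phi>~ * f\<^sub>w) (x g\<^sup>-\<^sup>1)\<close> with
  \<open>\<Psi>(x) \<xi>\<close>; so the convolution, a sum over \<open>J\G\<close>, is a value of \<open>l\<^sub>\<xi>\<close>.\<close>

lemma Hecke_conv_apply:
  assumes \<phi>: "\<phi> \<in> HA" and \<Psi>: "\<Psi> \<in> carrier HB" and g: "g \<in> carrier G"
  shows "Hecke_conv G T J (W, lam) \<phi> \<Psi> g \<in> linear_maps WD WD"
    and "\<And>\<xi> w. \<xi> \<in> dual \<Longrightarrow> w \<in> carrier W \<Longrightarrow>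
      Hecke_conv G T J (W, lam) \<phi> \<Psi> g \<xi> w = eig_functional \<Psi> \<xi> (translate (inv g) (hecke_fun \<phi> w))"
proof -
  have \<phi>B: "\<phi> \<in> carrier HB" and fin: "finite ((\<lambda>x. x <# J) ` {x \<in> carrier G. \<phi> x \<noteq> \<zero>\<^bsub>End_space WD\<^esub>})"
    using \<phi> by (auto simp: Hecke_iff)
  let ?t = "\<lambda>C. compose dual (\<phi> (g \<otimes> inv (coset_rep C))) (\<Psi> (coset_rep C))"
  define S0 where "S0 = {C \<in> rcosets J. \<phi> (g \<otimes> inv (coset_rep C)) \<noteq> \<zero>\<^bsub>End_space WD\<^esub>}"
  have "S0 \<subseteq> (\<lambda>D. (m_inv G ` D) #> g) ` (\<lambda>x. x <# J) ` {x \<in> carrier G. \<phi> x \<noteq> \<zero>\<^bsub>End_space WD\<^esub>}"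
  proof
    fix C assume C: "C \<in> S0"
    then have x: "coset_rep C \<in> carrier G" "J #> coset_rep C = C"
      using rcosetsE by (auto simp: S0_def)
    let ?y = "g \<otimes> inv (coset_rep C)"
    have y: "?y \<in> carrier G" using x g by simp
    have "m_inv G ` (?y <# J) = J #> inv ?y"
      using r_coset_inv[of "inv ?y"] y by simp
    then have "(m_inv G ` (?y <# J)) #> g = J #> (coset_rep C)"
      using x g y by (simp add: coset_mult_assoc subgroup.subset[OF J_subgroup] inv_mult_group m_assoc)
    then show "C \<in> (\<lambda>D. (m_inv G ` D) #> g) ` (\<lambda>x. x <# J) ` {x \<in> carrier G. \<phi> x \<noteq> \<zero>\<^bsub>End_space WD\<^esub>}"
      using C x y unfolding image_image by (intro image_eqI[of _ _ ?y]) (auto simp: S0_def)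
  qed
  then have S0: "finite S0" using fin by (meson finite_imageI finite_subset)
  have tE: "?t C \<in> linear_maps WD WD" if "C \<in> rcosets J" for C
  proof -
    have x: "coset_rep C \<in> carrier G" using rcosetsE that by auto
    have P: "\<phi> (g \<otimes> inv (coset_rep C)) \<in> linear_maps WD WD" "\<Psi> (coset_rep C) \<in> linear_maps WD WD"
      using HBD(1) \<phi>B \<Psi> x g by auto
    have c: "\<Psi> (coset_rep C) \<xi> \<in> carrier WD" if "\<xi> \<in> carrier WD" for \<xi>
      using End_cl[OF P(2)] that by simp
    show ?thesis
    proof (rule linear_mapsI)
      show "?t C \<xi> \<in> carrier WD" if "\<xi> \<in> carrier WD" for \<xi>
        using c[OF that] that End_cl[OF P(1)] by (simp add: compose_def)
      show "?t C (\<xi> \<oplus>\<^bsub>WD\<^esub> \<eta>) = ?t C \<xi> \<oplus>\<^bsub>WD\<^esub> ?t C \<eta>"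
        if "\<xi> \<in> carrier WD" "\<eta> \<in> carrier WD" for \<xi> \<eta>
        using that c WD.a_closed[OF that] module_homD(2)[OF linear_maps_hom[OF P(1)]]
          module_homD(2)[OF linear_maps_hom[OF P(2)]]
        by (simp add: compose_def del: WD_simps(2-))
      show "?t C (k \<odot>\<^bsub>WD\<^esub> \<xi>) = k \<odot>\<^bsub>WD\<^esub> ?t C \<xi>" if "\<xi> \<in> carrier WD" for \<xi> k
        using that c WD.smult_cl[OF that, of k] module_homD(3)[OF linear_maps_hom[OF P(1)]]
          module_homD(3)[OF linear_maps_hom[OF P(2)]]
        by (simp add: compose_def del: WD_simps(2-))
    qed (simp add: compose_def)
  qed
  have conv: "Hecke_conv G T J (W, lam) \<phi> \<Psi> g = finsum (End_space WD) ?t S"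
    if S: "finite S" "S0 \<subseteq> S" "S \<subseteq> rcosets J" for S
  proof -
    have "finsum_supp (End_space WD) ?t (rcosets J) = finsum (End_space WD) ?t S"
    proof (rule finsum_supp_eq[OF End_vectorspace S(1,3)])
      fix C assume C: "C \<in> rcosets J" and nz: "?t C \<noteq> \<zero>\<^bsub>End_space WD\<^esub>"
      have "\<Psi> (coset_rep C) \<xi> \<in> dual" if "\<xi> \<in> dual" for \<xi>
        using HBD(2)[OF \<Psi> rcosetsE(1)[OF C] that] .
      then have "\<phi> (g \<otimes> inv (coset_rep C)) \<noteq> \<zero>\<^bsub>End_space WD\<^esub>"
        using nz by (auto simp: compose_def)
      then show "C \<in> S" using C S(2) by (auto simp: S0_def)
    qed (use tE S(3) in auto)
    then show ?thesis using g by (simp add: Hecke_conv_def Let_def)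
  qed
  interpret E: cvs "End_space WD" by (rule cvsI[OF End_vectorspace])
  show "Hecke_conv G T J (W, lam) \<phi> \<Psi> g \<in> linear_maps WD WD"
    using conv[OF S0 order_refl] tE E.finsum_closed[of ?t S0] by (auto simp: S0_def)
  fix \<xi> w assume \<xi>: "\<xi> \<in> dual" and w: "w \<in> carrier W"
  let ?h = "translate (inv g) (hecke_fun \<phi> w)"
  have h: "?h \<in> carrier IND" using hecke_fun_in[OF \<phi> w] g by simp
  define S where "S = S0 \<union> support_cosets ?h"
  have S: "finite S" "S0 \<subseteq> S" "S \<subseteq> rcosets J" "support_cosets ?h \<subseteq> S"
    using S0 INDD(4)[OF h] support_cosets_subset by (auto simp: S_def S0_def)
  have tS: "?t \<in> S \<rightarrow> linear_maps WD WD" using tE S(3) by auto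
  interpret C: cvs complex_line by (rule cvsI[OF vectorspace_complex_line])
  have t_\<xi>: "(\<lambda>C. ?t C \<xi>) \<in> S \<rightarrow> dual" using tS End_cl \<xi> by auto
  have "Hecke_conv G T J (W, lam) \<phi> \<Psi> g \<xi> w = finsum (End_space WD) ?t S \<xi> w"
    using conv[OF S(1-3)] by simp
  also have "finsum (End_space WD) ?t S \<xi> = finsum WD (\<lambda>C. ?t C \<xi>) S"
    unfolding End_space_def using \<xi> S(1) tS End_vectorspace
    by (intro finsum_pointwise[OF _ WD_vectorspace linear_maps_subset]) (simp_all add: End_space_def)
  also have "finsum WD (\<lambda>C. ?t C \<xi>) S w = finsum complex_line (\<lambda>C. ?t C \<xi> w) S"
    using w S(1) t_\<xi> WD_vectorspace unfolding WD_eq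
    by (intro finsum_pointwise[OF _ vectorspace_complex_line linear_maps_subset]) auto
  also have "\<dots> = finsum complex_line (\<lambda>C. \<Psi> (coset_rep C) \<xi> (?h (coset_rep C))) S"
  proof (rule C.finsum_cong')
    fix C assume "C \<in> S"
    then have x: "coset_rep C \<in> carrier G" using S(3) rcosetsE by auto
    have "\<Psi> (coset_rep C) \<xi> (hecke_fun \<phi> w (coset_rep C \<otimes> inv g))
        = \<phi> (inv (coset_rep C \<otimes> inv g)) (\<Psi> (coset_rep C) \<xi>) w"
      using hecke_fun_apply(2)[OF \<phi>B w _ HBD(2)[OF \<Psi> x \<xi>]] x g by simp
    then show "?t C \<xi> w = \<Psi> (coset_rep C) \<xi> (?h (coset_rep C))"
      using x g \<xi> by (simp add: compose_def translate_def inv_mult_group)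
  qed auto
  also have "\<dots> = eig_functional \<Psi> \<xi> ?h"
    unfolding eig_functional_def
    using HBD(2)[OF \<Psi> _ \<xi>] linear_maps_hom
    by (intro ind_ext_eq[OF vectorspace_complex_line _ h S(1) S(3) S(4), symmetric]) blast
  finally show "Hecke_conv G T J (W, lam) \<phi> \<Psi> g \<xi> w = eig_functional \<Psi> \<xi> ?h" .
qed

text \<open>The eigenvalue equation becomes a condition on the functionals \<open>l\<^sub>\<xi>\<close>, of the shape of the equation
  \<open>A (\<phi>~ * f\<^sub>w) = \<chi>(\<phi>) \<alpha> w\<close> for a \<open>G\<close>-map \<open>A\<close> that spans a Hecke module with character \<open>\<chi>\<close>.\<close>

lemma Hecke_eigen_iff:
  "\<Psi> \<in> carrier (Hecke_bar_eigen G T J (W, lam) chi) \<longleftrightarrow> \<Psi> \<in> carrier HB \<and>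
    (\<forall>\<phi>\<in>HA. \<forall>g\<in>carrier G. \<forall>\<xi>\<in>dual. \<forall>w\<in>carrier W.
      eig_functional \<Psi> \<xi> (translate g (hecke_fun \<phi> w)) = chi \<phi> * \<Psi> (inv g) \<xi> w)"
proof -
  have "Hecke_conv G T J (W, lam) \<phi> \<Psi> = chi \<phi> \<odot>\<^bsub>HB\<^esub> \<Psi> \<longleftrightarrow>
    (\<forall>g\<in>carrier G. \<forall>\<xi>\<in>dual. \<forall>w\<in>carrier W.
      eig_functional \<Psi> \<xi> (translate g (hecke_fun \<phi> w)) = chi \<phi> * \<Psi> (inv g) \<xi> w)"
    (is "?l \<longleftrightarrow> ?r")
    if \<Psi>: "\<Psi> \<in> carrier HB" and \<phi>: "\<phi> \<in> HA" for \<phi>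
  proof
    assume l: ?l
    show ?r
    proof (intro ballI)
      fix g \<xi> w assume g: "g \<in> carrier G" and \<xi>: "\<xi> \<in> dual" and w: "w \<in> carrier W"
      have "Hecke_conv G T J (W, lam) \<phi> \<Psi> (inv g) \<xi> w = chi \<phi> * \<Psi> (inv g) \<xi> w"
        unfolding l using g \<xi> w by simp
      then show "eig_functional \<Psi> \<xi> (translate g (hecke_fun \<phi> w)) = chi \<phi> * \<Psi> (inv g) \<xi> w"
        using Hecke_conv_apply(2)[OF \<phi> \<Psi> _ \<xi> w, of "inv g"] g by simp
    qed
  next
    assume r: ?r
    interpret HB: cvs HB by (rule cvsI[OF HB_vectorspace])
    have s: "chi \<phi> \<odot>\<^bsub>HB\<^esub> \<Psi> \<in> carrier HB" using \<Psi> by (rule HB.smult_cl)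
    show ?l
    proof (rule extensionalityI[of _ "carrier G"])
      fix g assume g: "g \<in> carrier G"
      show "Hecke_conv G T J (W, lam) \<phi> \<Psi> g = (chi \<phi> \<odot>\<^bsub>HB\<^esub> \<Psi>) g"
      proof (rule End_ext[OF Hecke_conv_apply(1)[OF \<phi> \<Psi> g] HBD(1)[OF s g]])
        fix \<xi> w assume \<xi>: "\<xi> \<in> dual" and w: "w \<in> carrier W"
        have "eig_functional \<Psi> \<xi> (translate (inv g) (hecke_fun \<phi> w)) = chi \<phi> * \<Psi> (inv (inv g)) \<xi> w"
          using r g \<xi> w by (meson inv_closed)
        then show "Hecke_conv G T J (W, lam) \<phi> \<Psi> g \<xi> w = (chi \<phi> \<odot>\<^bsub>HB\<^esub> \<Psi>) g \<xi> w"
          using Hecke_conv_apply(2)[OF \<phi> \<Psi> g \<xi> w] g \<xi> w by simp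
      qed
    qed (simp_all add: Hecke_conv_def Let_def)
  qed
  then show ?thesis by (auto simp: Hecke_bar_eigen_def)
qed

lemma eigD:
  assumes "\<Psi> \<in> carrier (Hecke_bar_eigen G T J (W, lam) chi)"
  shows "\<Psi> \<in> carrier HB"
    and "\<And>\<phi> g \<xi> w. \<phi> \<in> HA \<Longrightarrow> g \<in> carrier G \<Longrightarrow> \<xi> \<in> dual \<Longrightarrow> w \<in> carrier W \<Longrightarrow>
      eig_functional \<Psi> \<xi> (translate g (hecke_fun \<phi> w)) = chi \<phi> * \<Psi> (inv g) \<xi> w"
  using assms unfolding Hecke_eigen_iff by auto

lemma eigen_subspace: "subspace CC (carrier (Hecke_bar_eigen G T J (W, lam) chi)) HB"
proof -
  interpret HB: cvs HB by (rule cvsI[OF HB_vectorspace])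
  let ?E = "carrier (Hecke_bar_eigen G T J (W, lam) chi)"
  note sums = eig_functional_sum support_rep sum.distrib sum_distrib_left
  have z: "eig_functional \<zero>\<^bsub>HB\<^esub> \<xi> f = 0" if "\<xi> \<in> dual" "f \<in> carrier IND" for \<xi> f
    using eig_functional_sum[OF HB.zero_closed that] that by (simp add: sums)
  have a: "eig_functional (\<Psi> \<oplus>\<^bsub>HB\<^esub> \<Phi>) \<xi> f = eig_functional \<Psi> \<xi> f + eig_functional \<Phi> \<xi> f"
    if P: "\<Psi> \<in> carrier HB" "\<Phi> \<in> carrier HB" "\<xi> \<in> dual" "f \<in> carrier IND" for \<Psi> \<Phi> \<xi> f
    using eig_functional_sum[OF HB.a_closed[OF P(1,2)] P(3,4)] P by (simp add: sums cong: sum.cong)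
  have s: "eig_functional (c \<odot>\<^bsub>HB\<^esub> \<Psi>) \<xi> f = c * eig_functional \<Psi> \<xi> f"
    if P: "\<Psi> \<in> carrier HB" "\<xi> \<in> dual" "f \<in> carrier IND" for c \<Psi> \<xi> f
    using eig_functional_sum[OF HB.smult_cl[OF P(1)] P(2,3)] P by (simp add: sums cong: sum.cong)
  show ?thesis unfolding subspace_iff[OF HB_vectorspace]
  proof (intro conjI ballI allI)
    show "?E \<subseteq> carrier HB" by (rule subsetI) (rule eigD(1))
    show "\<zero>\<^bsub>HB\<^esub> \<in> ?E"
      unfolding Hecke_eigen_iff using z hecke_fun_in HB.zero_closed by simp
    show "\<Psi> \<oplus>\<^bsub>HB\<^esub> \<Phi> \<in> ?E" if P: "\<Psi> \<in> ?E" "\<Phi> \<in> ?E" for \<Psi> \<Phi>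
      unfolding Hecke_eigen_iff
      using HB.a_closed[OF eigD(1)[OF P(1)] eigD(1)[OF P(2)]] a[OF eigD(1)[OF P(1)] eigD(1)[OF P(2)]]
        eigD(2)[OF P(1)] eigD(2)[OF P(2)] hecke_fun_in by (simp add: algebra_simps)
    show "c \<odot>\<^bsub>HB\<^esub> \<Psi> \<in> ?E" if P: "\<Psi> \<in> ?E" for \<Psi> c
      unfolding Hecke_eigen_iff
      using HB.smult_cl[OF eigD(1)[OF P]] s[OF eigD(1)[OF P]] eigD(2)[OF P] hecke_fun_in
      by (simp add: algebra_simps)
  qed
qed

end

section \<open>Eigenspaces have dimension at most one\<close>

context induction_datum begin

lemma W_nonzero: obtains w where "w \<in> carrier W" "w \<noteq> \<zero>\<^bsub>W\<^esub>"
  using irreducible_repD(2)[OF lam_irreducible] W.zero_closed that by auto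

lemma eig_functional_dual_lin:
  assumes \<Psi>: "\<Psi> \<in> carrier HB" and f: "f \<in> carrier IND"
  shows "(\<lambda>\<xi>. eig_functional \<Psi> \<xi> f) \<in> module_hom CC WD complex_line"
proof (rule module_homI)
  have WD: "\<xi> \<oplus>\<^bsub>WD\<^esub> \<eta> \<in> dual" "c \<odot>\<^bsub>WD\<^esub> \<xi> \<in> dual" if "\<xi> \<in> dual" "\<eta> \<in> dual" for \<xi> \<eta> c
    using WD.a_closed[of \<xi> \<eta>] WD.smult_cl[of \<xi> c] that by simp_all
  note sums = eig_functional_sum[OF \<Psi> _ f] support_rep[OF f] sum.distrib sum_distrib_left
    End_lin[OF HBD(1)[OF \<Psi>]]
  show "eig_functional \<Psi> (\<xi> \<oplus>\<^bsub>WD\<^esub> \<eta>) f = eig_functional \<Psi> \<xi> f \<oplus>\<^bsub>complex_line\<^esub> eig_functional \<Psi> \<eta> f"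
    if "\<xi> \<in> carrier WD" "\<eta> \<in> carrier WD" for \<xi> \<eta>
    using that eig_functional_sum[OF \<Psi> WD(1) f, of \<xi> \<eta>] by (simp add: sums cong: sum.cong)
  show "eig_functional \<Psi> (c \<odot>\<^bsub>WD\<^esub> \<xi>) f = c \<odot>\<^bsub>complex_line\<^esub> eig_functional \<Psi> \<xi> f"
    if "\<xi> \<in> carrier WD" for \<xi> c
    using that eig_functional_sum[OF \<Psi> WD(2) f, of \<xi> \<xi> c] by (simp add: sums cong: sum.cong)
qed simp

text \<open>The functionals \<open>l\<^sub>\<xi>\<close> depend linearly on \<open>\<xi>\<close>, so by biduality they are the components of a single map to \<open>W\<close>.\<close>

lemma eig_intertwiner:
  assumes \<Psi>: "\<Psi> \<in> carrier HB"
  obtains \<beta> where "\<beta> \<in> intertwiners GJ (IND, translate) (W, lam)"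
    "\<And>f \<xi>. f \<in> carrier IND \<Longrightarrow> \<xi> \<in> dual \<Longrightarrow> \<xi> (\<beta> f) = eig_functional \<Psi> \<xi> f"
proof -
  define \<beta> where "\<beta> = (\<lambda>f\<in>carrier IND. THE u. u \<in> carrier W \<and> (\<forall>\<xi>\<in>dual. \<xi> u = eig_functional \<Psi> \<xi> f))"
  have \<beta>: "\<beta> f \<in> carrier W" "\<And>\<xi>. \<xi> \<in> dual \<Longrightarrow> \<xi> (\<beta> f) = eig_functional \<Psi> \<xi> f"
    if "f \<in> carrier IND" for f
    using theI'[OF bidual[OF eig_functional_dual_lin[OF \<Psi> that]]] that by (auto simp: \<beta>_def)
  have "\<beta> \<in> intertwiners GJ (IND, translate) (W, lam)"
  proof (rule intertwinersI)
    show "\<beta> \<in> linear_maps IND W"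
    proof (rule linear_mapsI)
      show "\<beta> (f \<oplus>\<^bsub>IND\<^esub> f') = \<beta> f \<oplus>\<^bsub>W\<^esub> \<beta> f'" if f: "f \<in> carrier IND" and f': "f' \<in> carrier IND" for f f'
      proof (rule functionals_separate)
        show "\<beta> (f \<oplus>\<^bsub>IND\<^esub> f') \<in> carrier W" by (rule \<beta>(1)[OF IND.a_closed[OF f f']])
        show "\<beta> f \<oplus>\<^bsub>W\<^esub> \<beta> f' \<in> carrier W" using \<beta>(1) f f' by simp
        show "\<xi> (\<beta> (f \<oplus>\<^bsub>IND\<^esub> f')) = \<xi> (\<beta> f \<oplus>\<^bsub>W\<^esub> \<beta> f')" if \<xi>: "\<xi> \<in> dual" for \<xi>
          unfolding functionalD(1)[OF \<xi> \<beta>(1)[OF f] \<beta>(1)[OF f']] \<beta>(2)[OF f \<xi>] \<beta>(2)[OF f' \<xi>]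
            \<beta>(2)[OF IND.a_closed[OF f f'] \<xi>]
          by (rule eig_functional_lin(1)[OF \<Psi> \<xi> f f'])
      qed
      show "\<beta> (c \<odot>\<^bsub>IND\<^esub> f) = c \<odot>\<^bsub>W\<^esub> \<beta> f" if f: "f \<in> carrier IND" for f c
      proof (rule functionals_separate)
        show "\<beta> (c \<odot>\<^bsub>IND\<^esub> f) \<in> carrier W" by (rule \<beta>(1)[OF IND.smult_cl[OF f]])
        show "c \<odot>\<^bsub>W\<^esub> \<beta> f \<in> carrier W" using \<beta>(1) f by simp
        show "\<xi> (\<beta> (c \<odot>\<^bsub>IND\<^esub> f)) = \<xi> (c \<odot>\<^bsub>W\<^esub> \<beta> f)" if \<xi>: "\<xi> \<in> dual" for \<xi>
          unfolding functionalD(2)[OF \<xi> \<beta>(1)[OF f]] \<beta>(2)[OF f \<xi>] \<beta>(2)[OF IND.smult_cl[OF f] \<xi>]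
          by (rule eig_functional_lin(2)[OF \<Psi> \<xi> f])
      qed
    qed (use \<beta>(1) in \<open>auto simp: \<beta>_def\<close>)
    show "\<beta> (translate j f) = lam j (\<beta> f)" if "j \<in> carrier GJ" and f: "f \<in> carrier IND" for j f
    proof -
      have j: "j \<in> J" using that by simp
      have t: "translate j f \<in> carrier IND" using j f by simp
      show ?thesis
      proof (rule functionals_separate[OF \<beta>(1)[OF t] lam_cl[OF j \<beta>(1)[OF f]]])
        show "\<xi> (\<beta> (translate j f)) = \<xi> (lam j (\<beta> f))" if \<xi>: "\<xi> \<in> dual" for \<xi>
          unfolding \<beta>(2)[OF t \<xi>] eig_functional_J[OF \<Psi> \<xi> j f]
          using \<beta>(2)[OF f lam_dual_cl[OF J_simps(3)[OF j] \<xi>]] lam_dual_apply[of "inv j" "\<beta> f" \<xi>] j \<beta>(1)[OF f]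
          by simp
      qed
    qed
  qed
  then show thesis using that \<beta>(2) by blast
qed

text \<open>An eigenfunction is determined by its value at the identity.  Otherwise the associated map
  from the compactly induced representation to \<open>W\<close> is onto; lifting the identity of \<open>W\<close> produces an
  element of the Hecke algebra on which the eigenvalue equation fails.\<close>

lemma eigenfunction_zero:
  assumes E: "\<Psi> \<in> carrier (Hecke_bar_eigen G T J (W, lam) chi)"
    and one: "\<And>\<xi> w. \<xi> \<in> dual \<Longrightarrow> w \<in> carrier W \<Longrightarrow> \<Psi> \<one> \<xi> w = 0"
    and g: "g \<in> carrier G" "\<xi> \<in> dual" "w \<in> carrier W"
  shows "\<Psi> g \<xi> w = 0"
proof (rule ccontr)
  assume nz: "\<Psi> g \<xi> w \<noteq> 0"
  note \<Psi> = eigD(1)[OF E]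
  obtain \<beta> where \<beta>: "\<beta> \<in> intertwiners GJ (IND, translate) (W, lam)"
    "\<And>f \<xi>. f \<in> carrier IND \<Longrightarrow> \<xi> \<in> dual \<Longrightarrow> \<xi> (\<beta> f) = eig_functional \<Psi> \<xi> f"
    by (rule eig_intertwiner[OF \<Psi>]) (rule that)
  note INDJ = smooth_rep_restrict[OF IND_smooth]
  let ?f = "translate (inv g) (delta w)"
  have f: "?f \<in> carrier IND" using g by simp
  have "\<xi> (\<beta> ?f) \<noteq> 0"
    using \<beta>(2)[OF f g(2)] eig_functional_delta[OF \<Psi> g(2) _ g(3), of "inv g"] g nz by simp
  then have "\<beta> ?f \<noteq> \<zero>\<^bsub>W\<^esub>" using functionalD(3)[OF g(2)] by auto
  then have surj: "\<beta> ` carrier IND = carrier W"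
    using irreducible_surj[OF smooth_repD(1)[OF INDJ] lam_irreducible \<beta>(1) f] by simp
  have id: "(\<lambda>w\<in>carrier W. w) \<in> intertwiners GJ (W, lam) (W, lam)"
    by (intro intertwinersI linear_mapsI) auto
  obtain s where s: "s \<in> intertwiners GJ (W, lam) (IND, translate)"
    "\<And>w. w \<in> carrier W \<Longrightarrow> \<beta> (s w) = (\<lambda>w\<in>carrier W. w) w"
  proof (rule equivariant_lift[OF lam_smooth W_fin_dim INDJ lam_rep _ _ id])
    show "\<beta> \<in> module_hom CC IND W" using J_intertwinersD(2)[OF \<beta>(1)] .
    show "\<beta> (translate j v) = lam j (\<beta> v)" if "j \<in> J" "v \<in> carrier IND" for j v
      using J_intertwinersD(3)[OF \<beta>(1)] that by simp
    show "(\<lambda>w\<in>carrier W. w) ` carrier W \<subseteq> \<beta> ` carrier IND" unfolding surj by auto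
  qed (rule that)
  obtain \<phi> where \<phi>: "\<phi> \<in> HA" "\<And>w. w \<in> carrier W \<Longrightarrow> s w = hecke_fun \<phi> w"
    by (rule Hom_ind_eq_Hecke[OF s(1)]) (rule that)
  have "w = \<zero>\<^bsub>W\<^esub>" if w: "w \<in> carrier W" for w
  proof (rule functionals_separate_zero[OF w])
    fix \<xi> assume \<xi>: "\<xi> \<in> dual"
    note h = hecke_fun_in[OF \<phi>(1) w]
    have "\<xi> w = eig_functional \<Psi> \<xi> (hecke_fun \<phi> w)"
      using s(2)[OF w] \<phi>(2)[OF w] \<beta>(2)[OF h \<xi>] w by simp
    also have "\<dots> = eig_functional \<Psi> \<xi> (translate \<one> (hecke_fun \<phi> w))"
      using is_repD(4)[OF IND_rep h] by simp
    also have "\<dots> = 0" using eigD(2)[OF E \<phi>(1) _ \<xi> w, of \<one>] one[OF \<xi> w] by simp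
    finally show "\<xi> w = 0" .
  qed
  then show False using W_nonzero by blast
qed

text \<open>The transpose of \<open>\<Psi>(1)\<close> commutes with \<open>J\<close>, so its composition with \<open>\<alpha>\<close> is again a \<open>J\<close>-map, hence a
  multiple of \<open>\<alpha>\<close>, and \<open>\<alpha>\<close> is injective.\<close>

lemma eigenfunction_one_scalar:
  assumes \<Psi>: "\<Psi> \<in> carrier HB" and V: "is_rep G (V, \<rho>)"
    and \<alpha>: "\<alpha> \<in> intertwiners GJ (W, lam) (V, \<rho>)" "\<And>w. w \<in> carrier W \<Longrightarrow> w \<noteq> \<zero>\<^bsub>W\<^esub> \<Longrightarrow> \<alpha> w \<noteq> \<zero>\<^bsub>V\<^esub>"
    and line: "\<And>\<beta>. \<beta> \<in> intertwiners GJ (W, lam) (V, \<rho>) \<Longrightarrow>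
      \<exists>c. \<forall>w\<in>carrier W. \<beta> w = c \<odot>\<^bsub>V\<^esub> \<alpha> w"
  obtains c where "\<And>\<xi> w. \<xi> \<in> dual \<Longrightarrow> w \<in> carrier W \<Longrightarrow> \<Psi> \<one> \<xi> w = c * \<xi> w"
proof -
  note \<alpha>' = J_intertwinersD[OF \<alpha>(1)]
  interpret \<alpha>: clinear W V \<alpha> by (rule clinearI[OF lamD(1) is_repD(1)[OF V] \<alpha>'(2)])
  define t where "t = transpose_End W WD (\<Psi> \<one>)"
  have P: "\<Psi> \<one> \<in> linear_maps WD WD" using HBD(1)[OF \<Psi>] by simp
  have t: "t w \<in> carrier W" "\<And>\<xi>. \<xi> \<in> dual \<Longrightarrow> \<xi> (t w) = \<Psi> \<one> \<xi> w" if "w \<in> carrier W" for w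
    using transpose_End[OF P that] by (auto simp: t_def)
  have P\<xi>: "\<Psi> \<one> \<xi> \<in> dual" if "\<xi> \<in> dual" for \<xi> using End_cl[OF P that] .
  have t_lin: "t \<in> module_hom CC W W"
  proof (rule module_homI)
    show "t (w \<oplus>\<^bsub>W\<^esub> w') = t w \<oplus>\<^bsub>W\<^esub> t w'" if w: "w \<in> carrier W" "w' \<in> carrier W" for w w'
    proof (rule functionals_separate)
      show "\<xi> (t (w \<oplus>\<^bsub>W\<^esub> w')) = \<xi> (t w \<oplus>\<^bsub>W\<^esub> t w')" if \<xi>: "\<xi> \<in> dual" for \<xi>
        unfolding functionalD(1)[OF \<xi> t(1)[OF w(1)] t(1)[OF w(2)]] t(2)[OF w(1) \<xi>] t(2)[OF w(2) \<xi>]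
          t(2)[OF W.a_closed[OF w] \<xi>]
        by (rule functionalD(1)[OF P\<xi>[OF \<xi>] w])
    qed (use w t in auto)
    show "t (c \<odot>\<^bsub>W\<^esub> w) = c \<odot>\<^bsub>W\<^esub> t w" if w: "w \<in> carrier W" for w c
    proof (rule functionals_separate)
      show "\<xi> (t (c \<odot>\<^bsub>W\<^esub> w)) = \<xi> (c \<odot>\<^bsub>W\<^esub> t w)" if \<xi>: "\<xi> \<in> dual" for \<xi>
        unfolding functionalD(2)[OF \<xi> t(1)[OF w]] t(2)[OF w \<xi>] t(2)[OF W.smult_cl[OF w] \<xi>]
        by (rule functionalD(2)[OF P\<xi>[OF \<xi>] w])
    qed (use w t in auto)
  qed (use t in auto)
  have t_J: "t (lam j w) = lam j (t w)" if j: "j \<in> J" and w: "w \<in> carrier W" for j w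
  proof (rule functionals_separate[OF t(1)[OF lam_cl[OF j w]] lam_cl[OF j t(1)[OF w]]])
    fix \<xi> assume \<xi>: "\<xi> \<in> dual"
    have "\<xi> (t (lam j w)) = \<Psi> \<one> \<xi> (lam j w)" using t(2)[OF lam_cl[OF j w] \<xi>] .
    also have "\<dots> = \<Psi> (inv j) \<xi> w"
      using HBD(3)[OF \<Psi>, of \<one> "inv j" \<xi> w] j \<xi> w by simp
    also have "\<dots> = \<Psi> \<one> (lam_dual (inv j) \<xi>) w"
      using HBD(4)[OF \<Psi>, of \<one> "inv j" \<xi> w] j \<xi> w by simp
    also have "\<dots> = lam_dual (inv j) \<xi> (t w)"
      using t(2)[OF w lam_dual_cl[OF J_simps(3)[OF j] \<xi>]] by simp
    also have "\<dots> = \<xi> (lam j (t w))"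
      using lam_dual_apply[of "inv j" "t w" \<xi>] j t(1)[OF w] by simp
    finally show "\<xi> (t (lam j w)) = \<xi> (lam j (t w))" .
  qed
  have "(\<lambda>w\<in>carrier W. \<alpha> (t w)) \<in> intertwiners GJ (W, lam) (V, \<rho>)"
  proof (rule intertwinersI)
    show "(\<lambda>w\<in>carrier W. \<alpha> (t w)) \<in> linear_maps W V"
      using module_homD[OF t_lin] by (intro linear_mapsI) (auto simp: \<alpha>.add \<alpha>.smult)
    show "(\<lambda>w\<in>carrier W. \<alpha> (t w)) (lam j w) = \<rho> j ((\<lambda>w\<in>carrier W. \<alpha> (t w)) w)"
      if "j \<in> carrier GJ" "w \<in> carrier W" for j w
      using that t_J t(1) \<alpha>'(3)[of j "t w"] by simp
  qed
  from line[OF this] obtain c where c: "\<And>w. w \<in> carrier W \<Longrightarrow> \<alpha> (t w) = c \<odot>\<^bsub>V\<^esub> \<alpha> w" by auto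
  have tc: "t w = c \<odot>\<^bsub>W\<^esub> w" if w: "w \<in> carrier W" for w
  proof (rule ccontr)
    assume "t w \<noteq> c \<odot>\<^bsub>W\<^esub> w"
    then have "t w \<ominus>\<^bsub>W\<^esub> c \<odot>\<^bsub>W\<^esub> w \<noteq> \<zero>\<^bsub>W\<^esub>" using t(1)[OF w] w by (simp add: W.diff_eq_zero)
    then have "\<alpha> (t w \<ominus>\<^bsub>W\<^esub> c \<odot>\<^bsub>W\<^esub> w) \<noteq> \<zero>\<^bsub>V\<^esub>" using \<alpha>(2) t(1)[OF w] w by simp
    then show False
      using c[OF w] t(1)[OF w] w by (simp add: \<alpha>.diff \<alpha>.smult \<alpha>.W.diff_eq_zero)
  qed
  show thesis
  proof (rule that)
    show "\<Psi> \<one> \<xi> w = c * \<xi> w" if "\<xi> \<in> dual" "w \<in> carrier W" for \<xi> w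
      using t(2)[OF that(2,1)] tc[OF that(2)] functionalD(2)[OF that] by simp
  qed
qed

text \<open>The values of two eigenfunctions at the identity are scalars, so a nontrivial combination of the two vanishes
  there, and therefore everywhere.\<close>

lemma eigenspace_dim_le_1:
  fixes chi :: "('g \<Rightarrow> ('w \<Rightarrow> complex) \<Rightarrow> 'w \<Rightarrow> complex) \<Rightarrow> complex"
  assumes V: "is_rep G (V, \<rho>)"
    and \<alpha>: "\<alpha> \<in> intertwiners GJ (W, lam) (V, \<rho>)" "\<And>w. w \<in> carrier W \<Longrightarrow> w \<noteq> \<zero>\<^bsub>W\<^esub> \<Longrightarrow> \<alpha> w \<noteq> \<zero>\<^bsub>V\<^esub>"
    and line: "\<And>\<beta>. \<beta> \<in> intertwiners GJ (W, lam) (V, \<rho>) \<Longrightarrow>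
      \<exists>c. \<forall>w\<in>carrier W. \<beta> w = c \<odot>\<^bsub>V\<^esub> \<alpha> w"
  defines "E \<equiv> Hecke_bar_eigen G T J (W, lam) chi"
  shows "vectorspace CC E \<and> vectorspace.fin_dim CC E \<and> vectorspace.dim CC E \<le> 1"
proof -
  have E_eq: "E = HB\<lparr>carrier := carrier E\<rparr>" by (simp add: E_def Hecke_bar_eigen_def)
  have vE: "vectorspace CC E"
    by (subst E_eq, rule vectorspace_subspace[OF HB_vectorspace]) (simp add: E_def eigen_subspace)
  interpret E: cvs E by (rule cvsI[OF vE])
  have ops: "\<zero>\<^bsub>E\<^esub> = \<zero>\<^bsub>HB\<^esub>" "\<And>x y. x \<oplus>\<^bsub>E\<^esub> y = x \<oplus>\<^bsub>HB\<^esub> y" "\<And>c x. c \<odot>\<^bsub>E\<^esub> x = c \<odot>\<^bsub>HB\<^esub> x"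
    by (simp_all add: E_def Hecke_bar_eigen_def)
  have EHB: "\<Psi> \<in> carrier HB" if "\<Psi> \<in> carrier E" for \<Psi> using eigD(1) that by (simp add: E_def)
  have zero: "\<Psi> = \<zero>\<^bsub>E\<^esub>"
    if \<Psi>: "\<Psi> \<in> carrier E" and one: "\<And>\<xi> w. \<xi> \<in> dual \<Longrightarrow> w \<in> carrier W \<Longrightarrow> \<Psi> \<one> \<xi> w = 0" for \<Psi>
  proof (rule HB_ext)
    show "\<Psi> g \<xi> w = \<zero>\<^bsub>E\<^esub> g \<xi> w" if "g \<in> carrier G" "\<xi> \<in> dual" "w \<in> carrier W" for g \<xi> w
      using eigenfunction_zero[OF \<Psi>[unfolded E_def] one that] that by (simp add: ops)
  qed (use EHB \<Psi> E.zero_closed in auto)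
  show ?thesis
  proof (cases "\<exists>\<Psi>\<in>carrier E. \<Psi> \<noteq> \<zero>\<^bsub>E\<^esub>")
    case False
    then show ?thesis
      using vE by (intro conjI[OF vE] dim_le_1I[OF vE E.zero_closed]) auto
  next
    case True
    then obtain \<Psi>0 where \<Psi>0: "\<Psi>0 \<in> carrier E" "\<Psi>0 \<noteq> \<zero>\<^bsub>E\<^esub>" by auto
    obtain c0 where c0: "\<And>\<xi> w. \<xi> \<in> dual \<Longrightarrow> w \<in> carrier W \<Longrightarrow> \<Psi>0 \<one> \<xi> w = c0 * \<xi> w"
      by (rule eigenfunction_one_scalar[OF EHB[OF \<Psi>0(1)] V \<alpha> line]) (assumption+, rule that)
    have "c0 \<noteq> 0" using zero[OF \<Psi>0(1)] \<Psi>0(2) c0 by auto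
    have "\<exists>k. \<Psi> = k \<odot>\<^bsub>E\<^esub> \<Psi>0" if \<Psi>: "\<Psi> \<in> carrier E" for \<Psi>
    proof -
      obtain c where c: "\<And>\<xi> w. \<xi> \<in> dual \<Longrightarrow> w \<in> carrier W \<Longrightarrow> \<Psi> \<one> \<xi> w = c * \<xi> w"
        by (rule eigenfunction_one_scalar[OF EHB[OF \<Psi>] V \<alpha> line]) (assumption+, rule that)
      let ?k = "c / c0"
      have d: "\<Psi> \<oplus>\<^bsub>E\<^esub> (- ?k) \<odot>\<^bsub>E\<^esub> \<Psi>0 \<in> carrier E" using \<Psi> \<Psi>0(1) by simp
      have "\<Psi> \<oplus>\<^bsub>E\<^esub> (- ?k) \<odot>\<^bsub>E\<^esub> \<Psi>0 = \<zero>\<^bsub>E\<^esub>"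
        using \<open>c0 \<noteq> 0\<close> c c0 by (intro zero[OF d]) (simp add: ops)
      then have z: "(\<Psi> \<oplus>\<^bsub>E\<^esub> (- ?k) \<odot>\<^bsub>E\<^esub> \<Psi>0) g \<xi> w = \<zero>\<^bsub>E\<^esub> g \<xi> w" for g \<xi> w by simp
      have "\<Psi> = ?k \<odot>\<^bsub>E\<^esub> \<Psi>0"
      proof (rule HB_ext)
        show "\<Psi> g \<xi> w = (?k \<odot>\<^bsub>E\<^esub> \<Psi>0) g \<xi> w" if "g \<in> carrier G" "\<xi> \<in> dual" "w \<in> carrier W" for g \<xi> w
          using z[of g \<xi> w] that by (simp add: ops)
      qed (use EHB \<Psi> \<Psi>0(1) E.smult_cl in auto)
      then show ?thesis by blast
    qed
    then show ?thesis by (intro conjI[OF vE] dim_le_1I[OF vE \<Psi>0(1)])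
  qed
qed

end

section \<open>Transporting quotients to another type\<close>

text \<open>The quotient of \<open>V\<close> by \<open>K\<close>, with the classes replaced by chosen representatives and these by their images under
  \<open>i\<close>.  The result is a representation on the type \<open>'u\<close>, as required for an appeal to the type condition, which
  ranges over the representations on one type.\<close>

lemma quotient_rep_transport:
  fixes V :: "(complex, 'v) module" and \<rho> :: "'g \<Rightarrow> 'v \<Rightarrow> 'v" and G :: "'g monoid"
    and i :: "'v \<Rightarrow> 'u"
  assumes V: "is_rep G (V, \<rho>)" and K: "subrep G (V, \<rho>) K" and i: "inj_on i (carrier V)"
    and group: "group G"
  obtains R :: "(complex, 'u) module" and \<tau> p where "is_rep G (R, \<tau>)" "p \<in> intertwiners G (V, \<rho>) (R, \<tau>)"
    "p ` carrier V = carrier R" "\<And>v. v \<in> carrier V \<Longrightarrow> p v = \<zero>\<^bsub>R\<^esub> \<longleftrightarrow> v \<in> K"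
proof -
  note V' = is_repD[OF V]
  interpret V: cvs V by (rule cvsI) (rule V'(1))
  interpret G: group G by (rule group)
  have K': "K \<subseteq> carrier V" "\<zero>\<^bsub>V\<^esub> \<in> K" "\<And>x y. x \<in> K \<Longrightarrow> y \<in> K \<Longrightarrow> x \<oplus>\<^bsub>V\<^esub> y \<in> K"
    "\<And>c x. x \<in> K \<Longrightarrow> c \<odot>\<^bsub>V\<^esub> x \<in> K" "\<And>g x. g \<in> carrier G \<Longrightarrow> x \<in> K \<Longrightarrow> \<rho> g x \<in> K"
    using K unfolding subrep_def by (auto simp: subspace_iff[OF V'(1)])
  define rel where "rel x y \<longleftrightarrow> x \<in> carrier V \<and> y \<in> carrier V \<and> x \<ominus>\<^bsub>V\<^esub> y \<in> K" for x y
  have rel_add: "rel (x \<oplus>\<^bsub>V\<^esub> x') (y \<oplus>\<^bsub>V\<^esub> y')" if "rel x y" "rel x' y'" for x y x' y'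
  proof -
    have "(x \<oplus>\<^bsub>V\<^esub> x') \<ominus>\<^bsub>V\<^esub> (y \<oplus>\<^bsub>V\<^esub> y') = (x \<ominus>\<^bsub>V\<^esub> y) \<oplus>\<^bsub>V\<^esub> (x' \<ominus>\<^bsub>V\<^esub> y')"
      using that by (simp add: rel_def V.minus_eq V.minus_add V.a_ac)
    then show ?thesis using that K'(3) by (simp add: rel_def)
  qed
  have rel_smult: "rel (c \<odot>\<^bsub>V\<^esub> x) (c \<odot>\<^bsub>V\<^esub> y)" if "rel x y" for c x y
  proof -
    have "(c \<odot>\<^bsub>V\<^esub> x) \<ominus>\<^bsub>V\<^esub> (c \<odot>\<^bsub>V\<^esub> y) = c \<odot>\<^bsub>V\<^esub> (x \<ominus>\<^bsub>V\<^esub> y)"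
      using that by (simp add: rel_def V.minus_eq V.minus_eq_smult V.smult_add V.smult_smult mult.commute)
    then show ?thesis using that K'(4) by (simp add: rel_def)
  qed
  have rel_\<rho>: "rel (\<rho> g x) (\<rho> g y)" if "rel x y" "g \<in> carrier G" for g x y
  proof -
    interpret r: clinear V V "\<rho> g" by (rule clinearI[OF V'(1) V'(1) V'(2)[OF that(2)]])
    show ?thesis using that K'(5) by (simp add: rel_def r.diff[symmetric])
  qed
  have rel_refl: "rel x x" if "x \<in> carrier V" for x
  proof -
    have z: "x \<ominus>\<^bsub>V\<^esub> x = \<zero>\<^bsub>V\<^esub>" using V.diff_eq_zero[OF that that] by blast
    show ?thesis unfolding rel_def z using that K'(2) by simp
  qed
  have rel_sym: "rel y x" if "rel x y" for x y
  proof -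
    have "y \<ominus>\<^bsub>V\<^esub> x = (-1) \<odot>\<^bsub>V\<^esub> (x \<ominus>\<^bsub>V\<^esub> y)"
      using that by (simp add: rel_def V.minus_eq V.minus_eq_smult V.smult_add V.smult_smult V.a_comm)
    then show ?thesis using that K'(4) by (simp add: rel_def)
  qed
  have rel_trans: "rel x z" if "rel x y" "rel y z" for x y z
  proof -
    have c: "x \<in> carrier V" "y \<in> carrier V" "z \<in> carrier V" using that by (auto simp: rel_def)
    have "(x \<ominus>\<^bsub>V\<^esub> y) \<oplus>\<^bsub>V\<^esub> (y \<ominus>\<^bsub>V\<^esub> z) = x \<oplus>\<^bsub>V\<^esub> (\<ominus>\<^bsub>V\<^esub> y \<oplus>\<^bsub>V\<^esub> y) \<oplus>\<^bsub>V\<^esub> \<ominus>\<^bsub>V\<^esub> z"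
      using c by (simp add: V.minus_eq V.a_assoc del: V.l_neg)
    also have "\<dots> = x \<ominus>\<^bsub>V\<^esub> z" using c by (simp add: V.l_neg V.minus_eq)
    finally show ?thesis using that K'(3)[of "x \<ominus>\<^bsub>V\<^esub> y" "y \<ominus>\<^bsub>V\<^esub> z"] by (simp add: rel_def)
  qed
  define rp where "rp x = (SOME y. rel y x)" for x
  have rp: "rel (rp x) x" if "x \<in> carrier V" for x
    unfolding rp_def by (rule someI[of "\<lambda>y. rel y x"]) (rule rel_refl[OF that])
  have rp_eq: "rp x = rp y \<longleftrightarrow> rel x y" if "x \<in> carrier V" "y \<in> carrier V" for x y
  proof
    assume "rp x = rp y"
    then show "rel x y" using rp[OF that(1)] rp[OF that(2)] rel_sym rel_trans by metis
  next
    assume "rel x y"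
    then have "rel z x \<longleftrightarrow> rel z y" for z using rel_sym rel_trans by blast
    then show "rp x = rp y" by (simp add: rp_def)
  qed
  define p where "p = (\<lambda>x\<in>carrier V. i (rp x))"
  have p_eq: "p x = p y \<longleftrightarrow> rel x y" if "x \<in> carrier V" "y \<in> carrier V" for x y
  proof -
    have "rp x \<in> carrier V" "rp y \<in> carrier V" using rp that by (auto simp: rel_def)
    then show ?thesis using i that rp_eq[OF that] by (auto simp: p_def inj_on_eq_iff)
  qed
  define s where "s = inv_into (carrier V) p"
  have s: "s (p x) \<in> carrier V" "rel (s (p x)) x" if "x \<in> carrier V" for x
  proof -
    show sc: "s (p x) \<in> carrier V" unfolding s_def using that by (intro inv_into_into) simp
    have "p (s (p x)) = p x" unfolding s_def using that by (intro f_inv_into_f) simp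
    then show "rel (s (p x)) x" using p_eq[OF sc that] by simp
  qed
  define R :: "(complex, 'u) module" where "R = \<lparr>carrier = p ` carrier V, mult = undefined, one = undefined,
    ring.zero = p \<zero>\<^bsub>V\<^esub>, add = (\<lambda>a b. p (s a \<oplus>\<^bsub>V\<^esub> s b)), smult = (\<lambda>c a. p (c \<odot>\<^bsub>V\<^esub> s a))\<rparr>"
  define \<tau> where "\<tau> g a = p (\<rho> g (s a))" for g a
  have R_simps: "carrier R = p ` carrier V" "\<zero>\<^bsub>R\<^esub> = p \<zero>\<^bsub>V\<^esub>" by (simp_all add: R_def)
  have R_add: "p x \<oplus>\<^bsub>R\<^esub> p y = p (x \<oplus>\<^bsub>V\<^esub> y)" if "x \<in> carrier V" "y \<in> carrier V" for x y
    using that s rel_add by (simp add: R_def p_eq)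
  have R_smult: "c \<odot>\<^bsub>R\<^esub> p x = p (c \<odot>\<^bsub>V\<^esub> x)" if "x \<in> carrier V" for c x
    using that s rel_smult by (simp add: R_def p_eq)
  have R_\<tau>: "\<tau> g (p x) = p (\<rho> g x)" if "g \<in> carrier G" "x \<in> carrier V" for g x
    using that s rel_\<rho> V'(3) by (simp add: \<tau>_def p_eq)
  have R_vs: "vectorspace CC R"
    by (rule complex_vectorspaceI)
      (auto simp: R_simps R_add R_smult V.a_ac V.smult_add V.add_smult V.smult_smult)
  have p_hom: "p \<in> linear_maps V R"
    by (rule linear_mapsI) (auto simp: R_simps R_add R_smult, simp add: p_def)
  have rep: "is_rep G (R, \<tau>)"
  proof (rule is_repI[OF R_vs])
    show "\<tau> g \<in> module_hom CC R R" if g: "g \<in> carrier G" for g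
      using module_homD[OF V'(2)[OF g]] g
      by (intro module_homI) (auto simp: R_simps R_add R_smult R_\<tau>)
  qed (auto simp: R_simps R_\<tau> V'(3,4,5))
  have int: "p \<in> intertwiners G (V, \<rho>) (R, \<tau>)"
    using p_hom R_\<tau> by (intro intertwinersI) auto
  have ker: "p v = \<zero>\<^bsub>R\<^esub> \<longleftrightarrow> v \<in> K" if v: "v \<in> carrier V" for v
  proof -
    have "v \<ominus>\<^bsub>V\<^esub> \<zero>\<^bsub>V\<^esub> = v" using v by (simp add: V.minus_eq V.minus_eq_smult)
    then show ?thesis using v p_eq[OF v V.zero_closed] by (simp add: R_simps rel_def)
  qed
  show thesis by (rule that[OF rep int R_simps(1)[symmetric] ker])
qed

section \<open>The type condition applied to a quotient of the compactly induced representation\<close>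

lemma is_type_subquotient:
  fixes R S :: "('g, 'u) rep"
  assumes type: "is_type TYPE('u) G T J lam" and R: "R \<in> S_cat G T J lam" and S: "subquotient G S R"
  shows "S \<in> S_cat G T J lam"
proof -
  have "\<forall>(R :: ('g, 'u) rep) (S :: ('g, 'u) rep).
      R \<in> S_cat G T J lam \<and> subquotient G S R \<longrightarrow> S \<in> S_cat G T J lam"
    using type unfolding is_type_def by (elim conjE)
  from this[rule_format, OF conjI[OF R S]] show ?thesis .
qed

context induction_datum begin

text \<open>A function in the compactly induced representation is determined by its values on representatives of the finitely
  many cosets in its support, hence, \<open>\<alpha>\<close> embedding \<open>W\<close> into \<open>V\<close>, by a finite set of pairs of a coset and an
  element of \<open>V\<close>.  As \<open>V\<close> is infinite
  and the cosets are countable in number, there are no more such finite sets than elements of \<open>V\<close>.\<close>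

lemma IND_embeds:
  fixes V :: "(complex, 'u) module"
  assumes V: "vectorspace CC V" and \<alpha>: "\<alpha> \<in> module_hom CC W V" "inj_on \<alpha> (carrier W)"
    and count: "countable (rcosets J)"
  obtains i :: "('g \<Rightarrow> 'w) \<Rightarrow> 'u" where "inj_on i (carrier IND)"
proof -
  interpret V: cvs V by (rule cvsI[OF V])
  interpret \<alpha>: clinear W V \<alpha> by (rule clinearI[OF lamD(1) V \<alpha>(1)])
  obtain w0 where w0: "w0 \<in> carrier W" "w0 \<noteq> \<zero>\<^bsub>W\<^esub>" by (rule W_nonzero)
  have v0: "\<alpha> w0 \<in> carrier V" "\<alpha> w0 \<noteq> \<zero>\<^bsub>V\<^esub>"
    using w0 inj_onD[OF \<alpha>(2), of w0 "\<zero>\<^bsub>W\<^esub>"] by auto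
  have "inj (\<lambda>c. c \<odot>\<^bsub>V\<^esub> \<alpha> w0)"
    using V.smult_inj[OF v0] by (auto intro: injI)
  moreover have "range (\<lambda>c. c \<odot>\<^bsub>V\<^esub> \<alpha> w0) \<subseteq> carrier V" using v0 by auto
  ultimately have inf: "infinite (carrier V)"
    using infinite_UNIV_char_0[where 'a = complex] by (meson finite_imageD finite_subset)
  define P where "P = (rcosets J) \<times> carrier V"
  have ne: "(rcosets J) \<noteq> {}" by (auto simp: RCOSETS_def)
  have "lepoll (rcosets J) (carrier V)"
    using count inf by (meson countable_def infinite_le_lepoll lepoll_def lepoll_trans subset_UNIV)
  then have "(card_of (rcosets J), card_of (carrier V)) \<in> ordLeq" by (simp add: lepoll_def card_of_ordLeq)
  then have PV: "P \<approx> carrier V"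
    unfolding P_def eqpoll_iff_card_of_ordIso using card_of_Times_infinite[OF inf ne] by blast
  have infP: "infinite P" using inf ne by (auto simp: P_def finite_cartesian_product_iff)
  have "lepoll (Fpow P) (carrier V)"
    by (rule eqpoll_imp_lepoll[OF eqpoll_trans[OF eqpoll_Fpow[OF infP] PV]])
  then obtain k :: "('g set \<times> 'u) set \<Rightarrow> 'u" where k: "inj_on k (Fpow P)" by (auto simp: lepoll_def)
  define F where "F f = (\<lambda>C. (C, \<alpha> (f (coset_rep C)))) ` support_cosets f" for f
  have F_in: "F f \<in> Fpow P" if f: "f \<in> carrier IND" for f
    using INDD(1)[OF f] INDD(4)[OF f] support_cosets_subset[of f] rcosetsE(1)
    by (auto simp: F_def Fpow_def P_def)
  have ne_zero: "f' x = f x"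
    if f: "f \<in> carrier IND" and f': "f' \<in> carrier IND" and eq: "F f = F f'"
      and x: "x \<in> carrier G" "f x \<noteq> \<zero>\<^bsub>W\<^esub>" for f f' x
  proof -
    obtain j where j: "j \<in> J" "coset_rep (J #> x) = j \<otimes> x" by (rule coset_rep_r[OF x(1)])
    have "(J #> x, \<alpha> (f (j \<otimes> x))) \<in> F f" using x j by (force simp: F_def support_cosets_def)
    then have "\<alpha> (f' (j \<otimes> x)) = \<alpha> (f (j \<otimes> x))" unfolding eq using j by (auto simp: F_def)
    then have "f' (j \<otimes> x) = f (j \<otimes> x)"
      using inj_onD[OF \<alpha>(2)] INDD(1)[OF f] INDD(1)[OF f'] j x by simp
    then have "lam j (f' x) = lam j (f x)" using INDD(3)[OF f] INDD(3)[OF f'] j x by simp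
    then have "lam (inv j) (lam j (f' x)) = lam (inv j) (lam j (f x))" by simp
    then show ?thesis using lam_inv(1)[OF j(1)] INDD(1)[OF f] INDD(1)[OF f'] x by simp
  qed
  have "inj_on F (carrier IND)"
  proof (rule inj_onI)
    fix f f' assume f: "f \<in> carrier IND" and f': "f' \<in> carrier IND" and eq: "F f = F f'"
    show "f = f'"
    proof
      fix x
      show "f x = f' x"
        using ne_zero[OF f f' eq, of x] ne_zero[OF f' f eq[symmetric], of x] INDD(2)[OF f, of x] INDD(2)[OF f', of x]
        by (cases "x \<in> carrier G") metis+
    qed
  qed
  then have "inj_on (k \<circ> F) (carrier IND)"
    using F_in by (intro comp_inj_on inj_on_subset[OF k]) auto
  then show thesis by (rule that)
qed

text \<open>The map \<open>w \<mapsto> p f\<^sub>w\<close> embeds \<open>\<lambda>\<close>, so the isotypic component contains the vectors \<open>p f\<^sub>w\<close>, and these generate.\<close>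

lemma quotient_IND_in_S_cat:
  assumes R_smooth: "smooth_rep G T (R, \<tau>)"
    and p: "p \<in> intertwiners G (IND, translate) (R, \<tau>)" "p ` carrier IND = carrier R"
    and w0: "w0 \<in> carrier W" "p (delta w0) \<noteq> \<zero>\<^bsub>R\<^esub>"
  shows "(R, \<tau>) \<in> S_cat G T J (W, lam)"
proof -
  note R = smooth_repD(1)[OF R_smooth]
  note R' = is_repD[OF R]
  note p' = intertwinersD[OF p(1)]
  interpret p: clinear IND R p by (rule clinearI[OF IND_vectorspace R'(1) p'(2)])
  define a where "a = (\<lambda>w\<in>carrier W. p (delta w))"
  have a_in: "a \<in> intertwiners GJ (W, lam) (R, \<tau>)"
  proof (rule intertwinersI)
    show "a \<in> linear_maps W R"
    proof (rule linear_mapsI)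
      show "a (w \<oplus>\<^bsub>W\<^esub> w') = a w \<oplus>\<^bsub>R\<^esub> a w'" if "w \<in> carrier W" "w' \<in> carrier W" for w w'
        using that p.add[of "delta w" "delta w'"] module_homD(2)[OF delta_hom that]
        by (simp add: a_def del: IND_simps)
      show "a (c \<odot>\<^bsub>W\<^esub> w) = c \<odot>\<^bsub>R\<^esub> a w" if "w \<in> carrier W" for w c
        using that p.smult[of "delta w" c] module_homD(3)[OF delta_hom that, of c]
        by (simp add: a_def del: IND_simps)
    qed (auto simp: a_def)
    show "a (lam j w) = \<tau> j (a w)" if "j \<in> carrier GJ" "w \<in> carrier W" for j w
      using that p'(3)[of j "delta w"] translate_delta[of j w] by (simp add: a_def)
  qed
  have a_inj: "inj_on a (carrier W)"
    by (rule irreducible_inj[OF lam_irreducible rep_restrict[OF R] a_in w0(1)])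
      (use w0 in \<open>simp add: a_def\<close>)
  show ?thesis
    unfolding S_cat_def
  proof (intro CollectI conjI allI impI R_smooth)
    fix U assume "subrep G (R, \<tau>) U \<and> isotypic_component G J (W, lam) (R, \<tau>) \<subseteq> U"
    then have U: "subrep G (R, \<tau>) U" and iso: "isotypic_component G J (W, lam) (R, \<tau>) \<subseteq> U" by auto
    have U': "subspace CC U R" "\<And>g u. g \<in> carrier G \<Longrightarrow> u \<in> U \<Longrightarrow> \<tau> g u \<in> U"
      using U by (auto simp: subrep_def)
    let ?S = "\<Union>{\<alpha> ` carrier W | \<alpha>. \<alpha> \<in> intertwiners GJ (W, lam) (R, \<tau>) \<and> inj_on \<alpha> (carrier W)}"
    have S: "?S \<subseteq> carrier R" using module_homD(1)[OF J_intertwinersD(2)] by fastforce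
    have "p (delta w) \<in> U" if w: "w \<in> carrier W" for w
    proof -
      have "a w \<in> ?S" using a_in a_inj w by blast
      then have "a w \<in> LinearCombinations.module.span CC R ?S" using p.W.in_own_span[OF S] by blast
      then show ?thesis using iso w by (auto simp: isotypic_component_def a_def)
    qed
    then have gen: "p (translate g (delta w)) \<in> U" if "g \<in> carrier G" "w \<in> carrier W" for g w
      using that U'(2)[of g "p (delta w)"] p'(3)[of g "delta w"] by simp
    have "subspace CC {x \<in> carrier IND. p x \<in> U} IND"
      using U'(1) unfolding subspace_iff[OF IND_vectorspace] subspace_iff[OF R'(1)]
      using IND.zero_closed IND.a_closed IND.smult_cl
      by (auto simp: p.add p.smult p.zero simp del: IND_simps)
    then have eq: "{x \<in> carrier IND. p x \<in> U} = carrier IND"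
      by (rule IND_generated) (use gen in auto)
    have "carrier R \<subseteq> U"
    proof
      fix y assume "y \<in> carrier R"
      then have "y \<in> p ` carrier IND" unfolding p(2) .
      then obtain x where x: "x \<in> carrier IND" "y = p x" by (rule imageE)
      have "x \<in> {x \<in> carrier IND. p x \<in> U}" unfolding eq by (rule x(1))
      then show "y \<in> U" using x(2) by simp
    qed
    then show "U = carrier (fst (R, \<tau>))"
      unfolding fst_conv by (rule subset_antisym[OF subspace_subset[OF U'(1)]])
  qed
qed

text \<open>If there is no copy of \<open>\<lambda>\<close>, the isotypic component is zero, and it is supposed to generate.\<close>

lemma S_cat_trivial:
  assumes S_S: "(S, \<tau>) \<in> S_cat G T J (W, lam)"
    and S_zero: "\<And>\<beta> w. \<beta> \<in> intertwiners GJ (W, lam) (S, \<tau>) \<Longrightarrow> w \<in> carrier W \<Longrightarrow> \<beta> w = \<zero>\<^bsub>S\<^esub>"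
  shows "carrier S = {\<zero>\<^bsub>S\<^esub>}"
proof -
  have S_rep: "is_rep G (S, \<tau>)" using S_S by (simp add: S_cat_def smooth_rep_def)
  interpret S: cvs S by (rule cvsI[OF is_repD(1)[OF S_rep]])
  have "{\<beta> ` carrier W | \<beta>. \<beta> \<in> intertwiners GJ (W, lam) (S, \<tau>) \<and> inj_on \<beta> (carrier W)} = {}"
  proof -
    have False if \<beta>: "\<beta> \<in> intertwiners GJ (W, lam) (S, \<tau>)" "inj_on \<beta> (carrier W)" for \<beta>
    proof -
      obtain w0 where w0: "w0 \<in> carrier W" "w0 \<noteq> \<zero>\<^bsub>W\<^esub>" by (rule W_nonzero)
      then show False
        using S_zero[OF \<beta>(1) w0(1)] S_zero[OF \<beta>(1) W.zero_closed] inj_onD[OF \<beta>(2), of w0 "\<zero>\<^bsub>W\<^esub>"] by simp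
    qed
    then show ?thesis by blast
  qed
  then have "isotypic_component G J (W, lam) (S, \<tau>) = {\<zero>\<^bsub>S\<^esub>}"
    unfolding isotypic_component_def fst_conv by (simp only: Union_empty S.span_empty)
  moreover have "subrep G (S, \<tau>) {\<zero>\<^bsub>S\<^esub>}"
  proof -
    have "\<tau> g \<zero>\<^bsub>S\<^esub> = \<zero>\<^bsub>S\<^esub>" if "g \<in> carrier G" for g
      using clinear.zero[OF clinearI[OF is_repD(1)[OF S_rep] is_repD(1)[OF S_rep] is_repD(2)[OF S_rep that]]] .
    then show ?thesis by (auto simp: subrep_def subspace_iff[OF is_repD(1)[OF S_rep]])
  qed
  ultimately show ?thesis
    using S_S unfolding S_cat_def by auto
qed

text \<open>The functionals \<open>l\<^sub>\<xi>\<close> vanish on the kernel \<open>N\<close> of \<open>A\<close>.  Let \<open>K\<close> be the part of \<open>N\<close> on all of whose translates they vanish, and let \<open>S\<close>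
  be the copy of \<open>N/K\<close> in the quotient \<open>R\<close> of the compactly induced representation by \<open>K\<close>.  A \<open>J\<close>-map from \<open>W\<close> to
  \<open>S\<close> lifts to \<open>N\<close> and so comes from an element of the Hecke algebra; on the latter \<open>\<chi>\<close> vanishes because \<open>A\<close> does so on
  \<open>N\<close>, and by the eigenvalue equation the image of the lift lies in \<open>K\<close>.  So \<open>S\<close> has no \<open>\<lambda>\<close>-isotypic
  vectors.  Being a subquotient of \<open>R\<close>, it is generated by them, because \<open>\<lambda>\<close> is a type.\<close>

lemma kernel_eig_functional:
  fixes V :: "(complex, 'u) module"
  assumes type: "is_type TYPE('u) G T J (W, lam)"
    and V: "is_rep G (V, \<rho>)" and A: "A \<in> intertwiners G (IND, translate) (V, \<rho>)"
    and \<alpha>: "\<alpha> \<in> intertwiners GJ (W, lam) (V, \<rho>)" "inj_on \<alpha> (carrier W)"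
    and A_delta: "\<And>w. w \<in> carrier W \<Longrightarrow> A (delta w) = \<alpha> w"
    and A_hecke: "\<And>\<phi> w. \<phi> \<in> HA \<Longrightarrow> w \<in> carrier W \<Longrightarrow> A (hecke_fun \<phi> w) = chi \<phi> \<odot>\<^bsub>V\<^esub> \<alpha> w"
    and count: "countable (rcosets J)"
    and E: "\<Psi> \<in> carrier (Hecke_bar_eigen G T J (W, lam) chi)"
    and f: "f \<in> carrier IND" "A f = \<zero>\<^bsub>V\<^esub>" and \<xi>: "\<xi> \<in> dual"
  shows "eig_functional \<Psi> \<xi> f = 0"
proof -
  note V' = is_repD[OF V]
  note \<Psi> = eigD(1)[OF E]
  note A' = intertwinersD[OF A]
  interpret A: clinear IND V A by (rule clinearI[OF IND_vectorspace V'(1) A'(2)])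
  note \<alpha>' = J_intertwinersD[OF \<alpha>(1)]
  interpret \<alpha>: clinear W V \<alpha> by (rule clinearI[OF lamD(1) V'(1) \<alpha>'(2)])
  define N where "N = {f \<in> carrier IND. A f = \<zero>\<^bsub>V\<^esub>}"
  have N: "subrep G (IND, translate) N" unfolding N_def by (rule subrep_ker[OF IND_rep V A])
  define K where "K = {f \<in> carrier IND. A f = \<zero>\<^bsub>V\<^esub> \<and>
    (\<forall>g\<in>carrier G. \<forall>\<xi>\<in>dual. eig_functional \<Psi> \<xi> (translate g f) = 0)}"
  have K: "subrep G (IND, translate) K"
  proof -
    note L = eig_functional_lin[OF \<Psi>]
    note tr = module_homD[OF translate_hom]
    have tz: "translate g \<zero>\<^bsub>IND\<^esub> = \<zero>\<^bsub>IND\<^esub>" if "g \<in> carrier G" for g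
      using clinear.zero[OF clinearI[OF IND_vectorspace IND_vectorspace translate_hom[OF that]]] .
    have "subspace CC K IND" unfolding subspace_iff[OF IND_vectorspace]
    proof (intro conjI ballI allI)
      show "\<zero>\<^bsub>IND\<^esub> \<in> K" using A.zero L(3) tz by (simp add: K_def del: IND_simps)
      show "x \<oplus>\<^bsub>IND\<^esub> y \<in> K" if "x \<in> K" "y \<in> K" for x y
        using that A.add[of x y] L(1) tr(1,2) by (simp add: K_def del: IND_simps)
      show "c \<odot>\<^bsub>IND\<^esub> x \<in> K" if "x \<in> K" for c x
        using that A.smult[of x c] L(2) tr(1,3) by (simp add: K_def del: IND_simps)
    qed (auto simp: K_def)
    moreover have "translate h x \<in> K" if h: "h \<in> carrier G" and x: "x \<in> K" for h x
    proof -
      have xI: "x \<in> carrier IND" using x by (simp add: K_def)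
      have "translate g (translate h x) = translate (g \<otimes> h) x" if "g \<in> carrier G" for g
        using is_repD(5)[OF IND_rep that h xI] by simp
      moreover have "A (translate h x) = \<zero>\<^bsub>V\<^esub>"
        using subrep_ker[OF IND_rep V A] x h by (auto simp: subrep_def K_def)
      ultimately show ?thesis using x h by (auto simp: K_def)
    qed
    ultimately show ?thesis by (simp add: subrep_def)
  qed
  obtain i :: "('g \<Rightarrow> 'w) \<Rightarrow> 'u" where i: "inj_on i (carrier IND)"
    by (rule IND_embeds[OF V'(1) \<alpha>'(2) \<alpha>(2) count])
  obtain R :: "(complex, 'u) module" and \<tau> p where R: "is_rep G (R, \<tau>)"
    and p: "p \<in> intertwiners G (IND, translate) (R, \<tau>)" "p ` carrier IND = carrier R"
    and pK: "\<And>v. v \<in> carrier IND \<Longrightarrow> p v = \<zero>\<^bsub>R\<^esub> \<longleftrightarrow> v \<in> K"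
    by (rule quotient_rep_transport[OF IND_rep K i is_group]) (rule that)
  note R' = is_repD[OF R]
  note p' = intertwinersD[OF p(1)]
  interpret p: clinear IND R p by (rule clinearI[OF IND_vectorspace R'(1) p'(2)])
  have R_smooth: "smooth_rep G T (R, \<tau>)"
  proof -
    have "openin T {g \<in> carrier G. \<tau> g a = a}" if a: "a \<in> carrier R" for a
    proof -
      obtain x where x: "x \<in> carrier IND" "a = p x" using a p(2) by auto
      show ?thesis
      proof (rule openI_right_translates)
        show "openin T {g \<in> carrier G. translate g x = x}" by (rule smooth_repD(2)[OF IND_smooth x(1)])
        show "\<one> \<in> {g \<in> carrier G. translate g x = x}" using is_repD(4)[OF IND_rep x(1)] by simp
        fix t u assume t: "t \<in> {g \<in> carrier G. \<tau> g a = a}" and u: "u \<in> {g \<in> carrier G. translate g x = x}"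
        have "\<tau> u a = a" using p'(3)[of u x] u x by simp
        then show "t \<otimes> u \<in> {g \<in> carrier G. \<tau> g a = a}" using R'(5)[of t u a] t u a by simp
      qed auto
    qed
    then show ?thesis using R by (simp add: smooth_rep_def)
  qed
  obtain w0 where w0: "w0 \<in> carrier W" "w0 \<noteq> \<zero>\<^bsub>W\<^esub>" by (rule W_nonzero)
  have \<alpha>_w0: "\<alpha> w0 \<noteq> \<zero>\<^bsub>V\<^esub>" using inj_onD[OF \<alpha>(2), of w0 "\<zero>\<^bsub>W\<^esub>"] w0 by auto
  have "p (delta w0) \<noteq> \<zero>\<^bsub>R\<^esub>"
    using pK[OF delta_cl[OF w0(1)]] A_delta[OF w0(1)] \<alpha>_w0 by (simp add: K_def)
  then have R_S: "(R, \<tau>) \<in> S_cat G T J (W, lam)"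
    by (rule quotient_IND_in_S_cat[OF R_smooth p w0(1)])
  define S where "S = R\<lparr>carrier := p ` N\<rparr>"
  have pN: "subrep G (R, \<tau>) (p ` N)" by (rule subrep_image[OF IND_rep R p(1) N])
  have S_rep: "is_rep G (S, \<tau>)" unfolding S_def by (rule subrep_is_rep[OF R pN])
  have "subquotient G (S, \<tau>) (R, \<tau>)"
    unfolding subquotient_def prod.case
  proof (intro conjI exI)
    show "(\<lambda>u\<in>p ` N. u) \<in> intertwiners G (R\<lparr>carrier := p ` N\<rparr>, \<tau>) (S, \<tau>)"
      using is_repD(3)[OF S_rep] is_repD(1)[OF S_rep] pN
      by (intro intertwinersI linear_mapsI)
        (auto simp: S_def subrep_def subspace_iff[OF R'(1)])
  qed (use S_rep pN in \<open>auto simp: S_def\<close>)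
  then have S_S: "(S, \<tau>) \<in> S_cat G T J (W, lam)"
    by (rule is_type_subquotient[OF type R_S])
  note NR = smooth_rep_restrict[OF smooth_subrep[OF IND_smooth N]]
  have S_zero: "\<beta> w = \<zero>\<^bsub>S\<^esub>" if \<beta>: "\<beta> \<in> intertwiners GJ (W, lam) (S, \<tau>)" and w: "w \<in> carrier W" for \<beta> w
  proof -
    obtain s where s: "s \<in> intertwiners GJ (W, lam) (IND\<lparr>carrier := N\<rparr>, translate)"
      "\<And>w. w \<in> carrier W \<Longrightarrow> p (s w) = \<beta> w"
    proof (rule equivariant_lift[OF lam_smooth W_fin_dim NR rep_restrict[OF S_rep] _ _ \<beta>])
      show "p \<in> module_hom CC (IND\<lparr>carrier := N\<rparr>) S"
        using p.add p.smult by (intro module_homI) (auto simp: S_def N_def simp del: IND_simps)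
      show "p (translate j v) = \<tau> j (p v)" if "j \<in> J" "v \<in> carrier (IND\<lparr>carrier := N\<rparr>)" for j v
        using that p'(3)[of j v] by (simp add: N_def)
      show "\<beta> ` carrier W \<subseteq> p ` carrier (IND\<lparr>carrier := N\<rparr>)"
        using module_homD(1)[OF J_intertwinersD(2)[OF \<beta>]] by (auto simp: S_def)
    qed (rule that)
    have sN: "s w \<in> N" if "w \<in> carrier W" for w
      using module_homD(1)[OF J_intertwinersD(2)[OF s(1)] that] by simp
    have s_IND: "s \<in> intertwiners GJ (W, lam) (IND, translate)"
    proof (rule intertwinersI)
      show "s \<in> linear_maps W IND"
      proof (rule linear_mapsI)
        show "s w \<in> carrier IND" if "w \<in> carrier W" for w using sN[OF that] by (simp add: N_def)
        show "s (w \<oplus>\<^bsub>W\<^esub> w') = s w \<oplus>\<^bsub>IND\<^esub> s w'" if "w \<in> carrier W" "w' \<in> carrier W" for w w'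
          using module_homD(2)[OF J_intertwinersD(2)[OF s(1)] that] by simp
        show "s (c \<odot>\<^bsub>W\<^esub> w) = c \<odot>\<^bsub>IND\<^esub> s w" if "w \<in> carrier W" for w c
          using module_homD(3)[OF J_intertwinersD(2)[OF s(1)] that] by simp
        show "s \<in> extensional (carrier W)" using J_intertwinersD(1)[OF s(1)] by (simp add: linear_maps_def)
      qed
      show "s (lam j w) = translate j (s w)" if "j \<in> carrier GJ" "w \<in> carrier W" for j w
        using J_intertwinersD(3)[OF s(1)] that by simp
    qed
    obtain \<phi> where \<phi>: "\<phi> \<in> HA" "\<And>w. w \<in> carrier W \<Longrightarrow> s w = hecke_fun \<phi> w"
      by (rule Hom_ind_eq_Hecke[OF s_IND]) (rule that)
    have "chi \<phi> \<odot>\<^bsub>V\<^esub> \<alpha> w0 = \<zero>\<^bsub>V\<^esub>"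
      using A_hecke[OF \<phi>(1) w0(1)] \<phi>(2)[OF w0(1)] sN[OF w0(1)] by (simp add: N_def)
    then have chi: "chi \<phi> = 0" using \<alpha>_w0 w0(1) by (simp add: A.W.smult_eq_zero)
    have "s w \<in> K"
      using sN[OF w] eigD(2)[OF E \<phi>(1) _ _ w] \<phi>(2)[OF w] chi by (simp add: K_def N_def)
    then have "p (s w) = \<zero>\<^bsub>R\<^esub>" using pK sN[OF w] by (simp add: N_def)
    then show ?thesis using s(2)[OF w] by (simp add: S_def)
  qed
  have "carrier S = {\<zero>\<^bsub>S\<^esub>}" by (rule S_cat_trivial[OF S_S]) (rule S_zero)
  moreover have "f \<in> N" using f by (simp add: N_def)
  ultimately have "p f = \<zero>\<^bsub>R\<^esub>" unfolding S_def by auto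
  then have "f \<in> K" using pK f by simp
  then have "eig_functional \<Psi> \<xi> (translate \<one> f) = 0" using \<xi> by (simp add: K_def)
  then show ?thesis using is_repD(4)[OF IND_rep f(1)] by simp
qed

text \<open>The functional \<open>l\<^sub>\<xi>\<close> vanishes on the kernel of \<open>A\<close>, so it induces a functional \<open>\<zeta>\<close> on \<open>V\<close>, and \<open>\<zeta>\<close> is smooth as it is
  fixed by the open kernel of \<open>\<lambda>\<close>.\<close>

lemma eigenfunction_matrix_coefficient:
  fixes V :: "(complex, 'u) module"
  assumes type: "is_type TYPE('u) G T J (W, lam)"
    and V: "irreducible_rep G (V, \<rho>)" and A: "A \<in> intertwiners G (IND, translate) (V, \<rho>)"
    and \<alpha>: "\<alpha> \<in> intertwiners GJ (W, lam) (V, \<rho>)" "inj_on \<alpha> (carrier W)"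
    and A_delta: "\<And>w. w \<in> carrier W \<Longrightarrow> A (delta w) = \<alpha> w"
    and A_hecke: "\<And>\<phi> w. \<phi> \<in> HA \<Longrightarrow> w \<in> carrier W \<Longrightarrow> A (hecke_fun \<phi> w) = chi \<phi> \<odot>\<^bsub>V\<^esub> \<alpha> w"
    and count: "countable (rcosets J)"
    and E: "\<Psi> \<in> carrier (Hecke_bar_eigen G T J (W, lam) chi)"
    and w: "w \<in> carrier W" and \<xi>: "\<xi> \<in> dual"
  shows "matrix_coefficient G T (V, \<rho>) (\<lambda>g. \<Psi> (inv g) \<xi> w)"
proof -
  note V0 = irreducible_repD(1)[OF V]
  note V' = is_repD[OF V0]
  note \<Psi> = eigD(1)[OF E]
  note A' = intertwinersD[OF A]
  interpret A: clinear IND V A by (rule clinearI[OF IND_vectorspace V'(1) A'(2)])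
  interpret l: clinear IND complex_line "eig_functional \<Psi> \<xi>"
    by (rule clinearI[OF IND_vectorspace vectorspace_complex_line eig_functional_hom[OF \<Psi> \<xi>]])
  have surj: "A ` carrier IND = carrier V"
  proof -
    obtain w0 where w0: "w0 \<in> carrier W" "w0 \<noteq> \<zero>\<^bsub>W\<^esub>" by (rule W_nonzero)
    have "\<alpha> w0 \<noteq> \<zero>\<^bsub>V\<^esub>"
    proof
      interpret \<alpha>: clinear W V \<alpha> by (rule clinearI[OF lamD(1) V'(1) J_intertwinersD(2)[OF \<alpha>(1)]])
      assume "\<alpha> w0 = \<zero>\<^bsub>V\<^esub>"
      then show False using inj_onD[OF \<alpha>(2), of w0 "\<zero>\<^bsub>W\<^esub>"] w0 by simp
    qed
    then show ?thesis
      using irreducible_surj[OF IND_rep V A, of "delta w0"] A_delta[OF w0(1)] w0(1) by simp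
  qed
  have preim: "\<exists>f\<in>carrier IND. v = A f" if "v \<in> carrier V" for v
  proof -
    have "v \<in> A ` carrier IND" unfolding surj by (rule that)
    then show ?thesis by auto
  qed
  define \<zeta> where "\<zeta> = (\<lambda>v\<in>carrier V. eig_functional \<Psi> \<xi> (inv_into (carrier IND) A v))"
  have \<zeta>: "\<zeta> (A f) = eig_functional \<Psi> \<xi> f" if f: "f \<in> carrier IND" for f
  proof -
    let ?f = "inv_into (carrier IND) A (A f)"
    have f': "?f \<in> carrier IND" "A ?f = A f"
      using f by (simp_all add: inv_into_into f_inv_into_f)
    have "A (?f \<ominus>\<^bsub>IND\<^esub> f) = \<zero>\<^bsub>V\<^esub>" using f f' by (simp add: A.diff A.W.diff_eq_zero)
    then have "eig_functional \<Psi> \<xi> (?f \<ominus>\<^bsub>IND\<^esub> f) = 0"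
      using kernel_eig_functional[OF type V0 A \<alpha> A_delta A_hecke count E _ _ \<xi>] f f' by simp
    then have "eig_functional \<Psi> \<xi> ?f = eig_functional \<Psi> \<xi> f"
      using eig_functional_lin(4)[OF \<Psi> \<xi> f'(1) f] by simp
    then show ?thesis using f by (simp add: \<zeta>_def)
  qed
  have \<zeta>_lin: "\<zeta> \<in> linear_maps V complex_line"
  proof (rule linear_mapsI)
    show "\<zeta> (x \<oplus>\<^bsub>V\<^esub> y) = \<zeta> x \<oplus>\<^bsub>complex_line\<^esub> \<zeta> y" if "x \<in> carrier V" "y \<in> carrier V" for x y
    proof -
      obtain f f' where f: "f \<in> carrier IND" "f' \<in> carrier IND" "x = A f" "y = A f'"
        using preim[OF \<open>x \<in> carrier V\<close>] preim[OF \<open>y \<in> carrier V\<close>] by blast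
      have "\<zeta> (x \<oplus>\<^bsub>V\<^esub> y) = \<zeta> (A (f \<oplus>\<^bsub>IND\<^esub> f'))" using f by (simp only: A.add)
      also have "\<dots> = \<zeta> x \<oplus>\<^bsub>complex_line\<^esub> \<zeta> y"
        using f by (simp only: \<zeta> IND.a_closed l.add)
      finally show ?thesis .
    qed
    show "\<zeta> (c \<odot>\<^bsub>V\<^esub> x) = c \<odot>\<^bsub>complex_line\<^esub> \<zeta> x" if "x \<in> carrier V" for x c
    proof -
      obtain f where f: "f \<in> carrier IND" "x = A f" using preim[OF \<open>x \<in> carrier V\<close>] by blast
      have "\<zeta> (c \<odot>\<^bsub>V\<^esub> x) = \<zeta> (A (c \<odot>\<^bsub>IND\<^esub> f))" using f by (simp only: A.smult)
      also have "\<dots> = c \<odot>\<^bsub>complex_line\<^esub> \<zeta> x"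
        using f by (simp only: \<zeta> IND.smult_cl l.smult)
      finally show ?thesis .
    qed
  qed (simp_all add: \<zeta>_def)
  have \<zeta>_J: "\<zeta> (\<rho> j v) = \<zeta> v" if j: "j \<in> J" "\<forall>w\<in>carrier W. lam j w = w" and v: "v \<in> carrier V" for j v
  proof -
    obtain f where f: "f \<in> carrier IND" "v = A f" using preim[OF v] by blast
    have "lam_dual (inv j) \<xi> = \<xi>"
      using j \<xi> by (intro dual_ext) (auto simp: lam_dual_apply)
    then have "eig_functional \<Psi> \<xi> (translate j f) = eig_functional \<Psi> \<xi> f"
      using eig_functional_J[OF \<Psi> \<xi> j(1) f(1)] by simp
    moreover have "\<rho> j v = A (translate j f)" using A'(3)[of j f] f j by simp
    ultimately show ?thesis using f j \<zeta> by simp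
  qed
  have "openin T {g \<in> carrier G. contragredient_action G (V, \<rho>) g \<zeta> = \<zeta>}"
  proof (rule openI_right_translates[OF lam_kernel_open])
    fix s u
    assume s: "s \<in> {g \<in> carrier G. contragredient_action G (V, \<rho>) g \<zeta> = \<zeta>}"
      and u: "u \<in> {j \<in> J. \<forall>w\<in>carrier W. lam j w = w}"
    have ui: "lam (inv u) w = w" if "w \<in> carrier W" for w by (rule lam_fix_inv[OF u that])
    have "\<zeta> (\<rho> (inv (s \<otimes> u)) v) = \<zeta> (\<rho> (inv s) v)" if v: "v \<in> carrier V" for v
    proof -
      have "\<rho> (inv (s \<otimes> u)) v = \<rho> (inv u) (\<rho> (inv s) v)"
        using V'(5)[of "inv u" "inv s" v] s u v by (simp add: inv_mult_group)
      then show ?thesis using \<zeta>_J[of "inv u" "\<rho> (inv s) v"] ui u s v V'(3) by simp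
    qed
    then have "contragredient_action G (V, \<rho>) (s \<otimes> u) \<zeta> = contragredient_action G (V, \<rho>) s \<zeta>"
      by (auto simp: contragredient_action_def fun_eq_iff)
    then show "s \<otimes> u \<in> {g \<in> carrier G. contragredient_action G (V, \<rho>) g \<zeta> = \<zeta>}"
      using s u by simp
  qed auto
  then have "\<zeta> \<in> carrier (fst (contragredient G T (V, \<rho>)))"
    using \<zeta>_lin by (simp add: contragredient_def)
  moreover have "\<Psi> (inv g) \<xi> w = \<zeta> (\<rho> g (\<alpha> w))" if g: "g \<in> carrier G" for g
    using \<zeta>[of "translate g (delta w)"] A'(3)[of g "delta w"] A_delta[OF w]
      eig_functional_delta[OF \<Psi> \<xi> g w] g w by simp
  moreover have "\<alpha> w \<in> carrier V"
    using module_homD(1)[OF J_intertwinersD(2)[OF \<alpha>(1)] w] .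
  ultimately show ?thesis
    unfolding matrix_coefficient_def prod.case
    by (intro bexI[of _ "\<alpha> w"] bexI[of _ \<zeta>]) auto
qed

end

text \<open>The symbol \<open>$\<close> is kept for the components of vectors and matrices.\<close>

no_notation fps_nth (infixl \<open>$\<close> 75)

section \<open>Non-archimedean local fields are separable\<close>

context nonarch_local_field begin

lemma v_zero [simp]: "v 0 = 0"
  using eq_0_iff by simp

lemma v_one [simp]: "v 1 = 1"
  using mult[of 1 1] eq_0_iff[of 1] by simp

lemma v_minus [simp]: "v (- x) = v x"
proof -
  have "v (-1) * v (-1) = 1" using mult[of "-1" "-1"] by simp
  then have "v (-1) = 1" using nonneg[of "-1"] by (auto simp: square_eq_1_iff)
  then show ?thesis using mult[of "-1" x] by simp
qed

lemma v_diff_commute: "v (x - y) = v (y - x)"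
  using v_minus[of "x - y"] by simp

lemma v_power: "v (x ^ n) = v x ^ n"
  by (induction n) (simp_all add: mult)

lemma v_inverse: "x \<noteq> 0 \<Longrightarrow> v (inverse x) = inverse (v x)"
  using mult[of x "inverse x"] eq_0_iff[of x] by (simp add: field_simps)

lemma v_triangle: "v (x - z) < e" if "v (x - y) < e" "v (y - z) < e"
  using ultrametric[of "x - y" "y - z"] that by simp

lemma v_sum_less: "finite K \<Longrightarrow> e > 0 \<Longrightarrow> (\<And>k. k \<in> K \<Longrightarrow> v (f k) < e) \<Longrightarrow> v (sum f K) < e"
proof (induction K rule: finite_induct)
  case (insert k K)
  then show ?case using ultrametric[of "f k" "sum f K"] by fastforce
qed simp

lemmas v_nonneg = nonneg

sublocale Metric_space UNIV "\<lambda>x y. v (x - y)"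
proof
  fix x y z :: 'f
  show "v (x - z) \<le> v (x - y) + v (y - z)"
    using ultrametric[of "x - y" "y - z"] nonneg[of "x - y"] nonneg[of "y - z"] by simp
qed (use nonneg v_diff_commute eq_0_iff in auto)

lemma field_topology_eq: "field_topology v = mtopology"
  by (simp add: field_topology_def)

lemma exists_v_gt_1: obtains a where "v a > 1"
proof -
  obtain x where x: "x \<noteq> 0" "v x \<noteq> 1" using nontrivial by auto
  show thesis
  proof (cases "v x > 1")
    case False
    then have "v x < 1" "v x > 0" using x v_nonneg[of x] eq_0_iff[of x] by auto
    then have "v (inverse x) > 1" using v_inverse[OF x(1)] by (simp add: one_less_inverse)
    then show thesis by (rule that)
  qed (rule that)
qed

text \<open>A compact neighbourhood of zero is totally bounded, and its dilations exhaust the field.\<close>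

lemma countable_dense:
  obtains D where "countable D" "\<And>x e. e > 0 \<Longrightarrow> \<exists>d\<in>D. v (x - d) < e"
proof -
  obtain U K where U: "openin mtopology U" "compactin mtopology K" "0 \<in> U" "U \<subseteq> K"
    using locally_compact unfolding field_topology_eq locally_compact_space_def by force
  obtain r where r: "r > 0" "mball 0 r \<subseteq> K"
    using U unfolding openin_mtopology by blast
  have "mtotally_bounded K" by (rule compactin_imp_mtotally_bounded[OF U(2)])
  then have "\<forall>m. \<exists>C. finite C \<and> K \<subseteq> (\<Union>x\<in>C. mball x (inverse (real (Suc m))))"
    unfolding mtotally_bounded_def by (metis inverse_positive_iff_positive of_nat_0_less_iff zero_less_Suc)
  then obtain C where C: "\<And>m. finite (C m)" "\<And>m. K \<subseteq> (\<Union>x\<in>C m. mball x (inverse (real (Suc m))))"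
    by metis
  obtain a where a: "v a > 1" by (rule exists_v_gt_1)
  have a0: "a \<noteq> 0" using a by auto
  define D where "D = (\<Union>n. \<Union>m. (\<lambda>c. a ^ n * c) ` C m)"
  show thesis
  proof
    show "countable D" unfolding D_def using C(1) by (intro countable_UN) (auto intro: countable_finite)
    fix x and e :: real assume e: "e > 0"
    obtain n where n: "v x / r < v a ^ n" using real_arch_pow[OF a] by blast
    have an: "v a ^ n > 0" using a by simp
    define y where "y = x * inverse (a ^ n)"
    have x: "x = a ^ n * y" using a0 by (simp add: y_def)
    have "v y * v a ^ n = v x" unfolding x by (simp add: mult v_power)
    then have "v y * v a ^ n < r * v a ^ n" using n r(1) an by (simp add: field_simps)
    then have "v y < r" using an by (simp add: mult_less_cancel_right_pos)
    then have "y \<in> K" using r(2) by (auto simp: subset_eq in_mball)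
    obtain m where m: "inverse (real (Suc m)) < e / v a ^ n"
      using reals_Archimedean[of "e / v a ^ n"] e an by auto
    obtain c where c: "c \<in> C m" "v (c - y) < inverse (real (Suc m))"
      using C(2)[of m] \<open>y \<in> K\<close> by (auto simp: in_mball)
    have "v (x - a ^ n * c) = v a ^ n * v (c - y)"
      using v_diff_commute[of y c] mult[of "a ^ n" "y - c"] by (simp add: x v_power right_diff_distrib)
    also have "\<dots> < v a ^ n * (e / v a ^ n)" using c(2) m an by (intro mult_strict_left_mono) auto
    also have "\<dots> = e" using a0 a by simp
    finally have "v (x - a ^ n * c) < e" .
    then show "\<exists>d\<in>D. v (x - d) < e" using c(1) unfolding D_def by blast
  qed
qed

end

section \<open>The group of rational points\<close>

lemma group_gl_group: "group (gl_group :: ('a::field ^ 'n ^ 'n) monoid)"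
proof (rule groupI)
  show "\<exists>y\<in>carrier gl_group. y \<otimes>\<^bsub>gl_group\<^esub> x = \<one>\<^bsub>gl_group\<^esub>"
    if "x \<in> carrier (gl_group :: ('a ^ 'n ^ 'n) monoid)" for x
  proof -
    obtain y where "x ** y = mat 1" "y ** x = mat 1"
      using \<open>x \<in> carrier gl_group\<close> by (auto simp: gl_group_def invertible_def)
    then show ?thesis
      by (intro bexI[of _ y]) (auto simp: gl_group_def invertible_def)
  qed
  show "\<one>\<^bsub>gl_group\<^esub> \<in> carrier (gl_group :: ('a ^ 'n ^ 'n) monoid)"
    by (auto simp: gl_group_def invertible_def intro!: exI[of _ "mat 1"])
qed (simp_all add: gl_group_def matrix_mul_assoc invertible_mult)

abbreviation ac_matrix :: "'f::field ^ 'n ^ 'n \<Rightarrow> 'f alg_closure ^ 'n ^ 'n" where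
  "ac_matrix A \<equiv> (\<chi> i j. to_ac (A $ i $ j))"

lemma ac_matrix_mult: "ac_matrix (A ** B) = ac_matrix A ** ac_matrix B"
  by (simp add: matrix_matrix_mult_def vec_eq_iff to_ac_sum)

lemma ac_matrix_one: "ac_matrix (mat 1) = mat 1"
  by (simp add: mat_def vec_eq_iff)

lemma det_ac_matrix: "det (ac_matrix A) = to_ac (det A)"
  by (simp add: det_def to_ac_sum to_ac_prod)

text \<open>The inverse over the algebraic closure of a matrix with entries in the field has its entries in the field, because
  invertibility is seen on the determinant.\<close>

lemma group_rational_points:
  fixes GG :: "('f::field alg_closure ^ 'n ^ 'n) set"
  assumes GG: "subgroup GG gl_group"
  shows "group (rational_points GG)"
proof -
  interpret gl: group "gl_group :: ('f alg_closure ^ 'n ^ 'n) monoid" by (rule group_gl_group)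
  have simps: "carrier (rational_points GG) = {A. ac_matrix A \<in> GG}"
    "A \<otimes>\<^bsub>rational_points GG\<^esub> B = A ** B" "\<one>\<^bsub>rational_points GG\<^esub> = mat 1" for A B
    by (simp_all add: rational_points_def gl_group_def)
  have gl_simps: "A \<otimes>\<^bsub>gl_group\<^esub> B = A ** B" "\<one>\<^bsub>gl_group\<^esub> = mat 1"
    "A \<in> carrier gl_group \<longleftrightarrow> invertible A" for A B :: "'f alg_closure ^ 'n ^ 'n"
    by (simp_all add: gl_group_def)
  show ?thesis
  proof (rule groupI)
    show "x \<otimes>\<^bsub>rational_points GG\<^esub> y \<in> carrier (rational_points GG)"
      if "x \<in> carrier (rational_points GG)" "y \<in> carrier (rational_points GG)" for x y
      using that subgroup.m_closed[OF GG] by (simp add: simps ac_matrix_mult gl_simps)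
    show "\<one>\<^bsub>rational_points GG\<^esub> \<in> carrier (rational_points GG)"
      using subgroup.one_closed[OF GG] by (simp add: simps ac_matrix_one gl_simps)
    show "\<exists>y\<in>carrier (rational_points GG). y \<otimes>\<^bsub>rational_points GG\<^esub> x = \<one>\<^bsub>rational_points GG\<^esub>"
      if x: "x \<in> carrier (rational_points GG)" for x
    proof -
      have xG: "ac_matrix x \<in> GG" using x by (simp add: simps)
      then have xgl: "ac_matrix x \<in> carrier gl_group" using subgroup.mem_carrier[OF GG] by simp
      then have "det (ac_matrix x) \<noteq> 0" by (simp add: gl_simps invertible_det_nz)
      then have "invertible x" by (simp add: det_ac_matrix invertible_det_nz)
      then obtain y where y: "x ** y = mat 1" "y ** x = mat 1" by (auto simp: invertible_def)
      have yx: "ac_matrix y ** ac_matrix x = mat 1" "ac_matrix x ** ac_matrix y = mat 1"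
        using ac_matrix_mult[of y x] ac_matrix_mult[of x y] y by (simp_all add: ac_matrix_one)
      have "inv\<^bsub>gl_group\<^esub> (ac_matrix x) = ac_matrix y"
      proof (rule gl.inv_equality[OF _ xgl])
        show "ac_matrix y \<otimes>\<^bsub>gl_group\<^esub> ac_matrix x = \<one>\<^bsub>gl_group\<^esub>" using yx by (simp add: gl_simps)
        show "ac_matrix y \<in> carrier gl_group" using yx unfolding gl_simps invertible_def by blast
      qed
      then have "ac_matrix y \<in> GG" using subgroup.m_inv_closed[OF GG xG] by simp
      then show ?thesis using y by (auto simp: simps)
    qed
  qed (auto simp: simps matrix_mul_assoc)
qed

context nonarch_local_field begin

text \<open>There are finitely many matrix entries, so a box around a matrix contains a cube.\<close>

lemma openin_rational_points:
  fixes GG :: "('f alg_closure ^ 'n ^ 'n) set"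
  defines "H \<equiv> carrier (rational_points GG)"
  shows "openin (rational_points_topology v GG) U \<longleftrightarrow>
    U \<subseteq> H \<and> (\<forall>x\<in>U. \<exists>e>0. \<forall>y\<in>H. (\<forall>i j. v (y $ i $ j - x $ i $ j) < e) \<longrightarrow> y \<in> U)"
    (is "_ \<longleftrightarrow> ?R U")
proof -
  let ?f = "\<lambda>A :: 'f ^ 'n ^ 'n. \<lambda>(i, j). A $ i $ j"
  let ?P = "product_topology (\<lambda>_ :: 'n \<times> 'n. mtopology) UNIV"
  have ball: "y \<in> mball x e \<longleftrightarrow> v (y - x) < e" for x y e
    using v_diff_commute[of x y] by (simp add: in_mball)
  have T: "openin (rational_points_topology v GG) U \<longleftrightarrow> (\<exists>S. openin ?P S \<and> U = ?f -` S \<inter> H)" for U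
    unfolding rational_points_topology_def field_topology_eq openin_subtopology openin_pullback_topology H_def
    by auto
  show ?thesis
  proof
    assume "openin (rational_points_topology v GG) U"
    then obtain S where S: "openin ?P S" "U = ?f -` S \<inter> H" unfolding T by auto
    have "\<exists>e>0. \<forall>y\<in>H. (\<forall>i j. v (y $ i $ j - x $ i $ j) < e) \<longrightarrow> y \<in> U" if x: "x \<in> U" for x
    proof -
      have "?f x \<in> S" using x S by auto
      from bspec[OF S(1)[unfolded openin_product_topology_alt] this]
      obtain B where B: "\<And>k. openin mtopology (B k)" "?f x \<in> Pi\<^sub>E UNIV B" "Pi\<^sub>E UNIV B \<subseteq> S"
        by auto
      have "\<forall>k. \<exists>e>0. mball (?f x k) e \<subseteq> B k"
      proof
        fix k
        have "?f x k \<in> B k" using PiE_mem[OF B(2)] by simp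
        then show "\<exists>e>0. mball (?f x k) e \<subseteq> B k" using B(1)[of k] unfolding openin_mtopology by auto
      qed
      from choice[OF this] obtain e where e: "\<And>k. e k > 0" "\<And>k. mball (?f x k) (e k) \<subseteq> B k"
        by auto
      define e0 where "e0 = Min (range e)"
      have e0: "e0 > 0" "e0 \<le> e k" for k
        using e(1) by (auto simp: e0_def Min_gr_iff)
      have "y \<in> U" if y: "y \<in> H" "\<forall>i j. v (y $ i $ j - x $ i $ j) < e0" for y
      proof -
        have "?f y k \<in> B k" for k
        proof -
          have "v (?f y k - ?f x k) < e k" using y(2) e0(2)[of k] by (cases k) (auto intro: less_le_trans)
          then show ?thesis using e(2)[of k] ball by blast
        qed
        then have "?f y \<in> S" using B(3) by (intro subsetD[OF B(3)]) auto
        then show ?thesis using S(2) y(1) by simp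
      qed
      then show ?thesis using e0(1) by blast
    qed
    then show "?R U" using S(2) by auto
  next
    assume R: "?R U"
    then obtain e where e: "\<And>x. x \<in> U \<Longrightarrow> e x > 0"
      "\<And>x y. x \<in> U \<Longrightarrow> y \<in> H \<Longrightarrow> (\<forall>i j. v (y $ i $ j - x $ i $ j) < e x) \<Longrightarrow> y \<in> U"
      by metis
    let ?B = "\<lambda>x. Pi\<^sub>E UNIV (\<lambda>k. mball (?f x k) (e x))"
    have "openin ?P (\<Union>x\<in>U. ?B x)"
    proof (intro openin_Union ballI)
      fix S assume "S \<in> ?B ` U"
      then show "openin ?P S" by (auto simp: openin_PiE)
    qed
    moreover have "U = ?f -` (\<Union>x\<in>U. ?B x) \<inter> H"
    proof (intro equalityI subsetI)
      fix x assume x: "x \<in> U"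
      then have "?f x \<in> ?B x" using e(1)[OF x] by (auto simp: ball)
      then show "x \<in> ?f -` (\<Union>x\<in>U. ?B x) \<inter> H" using x R by auto
    next
      fix y assume "y \<in> ?f -` (\<Union>x\<in>U. ?B x) \<inter> H"
      then obtain x where x: "x \<in> U" "?f y \<in> ?B x" "y \<in> H" by auto
      have "v (y $ i $ j - x $ i $ j) < e x" for i j
        using PiE_mem[OF x(2), of "(i, j)"] v_diff_commute[of "y $ i $ j" "x $ i $ j"] by simp
      then show "y \<in> U" using e(2)[OF x(1,3)] by blast
    qed
    ultimately show "openin (rational_points_topology v GG) U" unfolding T by blast
  qed
qed

text \<open>By the ultrametric inequality, multiplication by \<open>A\<close> stretches distances of matrices by no more than the
  largest absolute value of an entry of \<open>A\<close>.\<close>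

lemma v_matrix_mult_bound:
  fixes A :: "'f ^ 'n ^ 'n"
  assumes e: "e > 0"
  shows "\<exists>d>0. \<forall>x y. (\<forall>i j. v (y $ i $ j - x $ i $ j) < d) \<longrightarrow>
    (\<forall>i j. v ((A ** y) $ i $ j - (A ** x) $ i $ j) < e) \<and>
    (\<forall>i j. v ((y ** A) $ i $ j - (x ** A) $ i $ j) < e)"
proof -
  define M where "M = Max (range (\<lambda>(i, j). v (A $ i $ j)))"
  have M: "v (A $ i $ j) \<le> M" for i j
    unfolding M_def by (rule Max_ge) (auto intro!: image_eqI[of _ _ "(i, j)"])
  have M0: "M + 1 > 0" using M[of undefined undefined] v_nonneg[of "A $ undefined $ undefined"] by linarith
  \<comment> \<open>\<open>M\<close> may be zero, hence the summand one\<close>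
  define d where "d = e / (M + 1)"
  have d: "d > 0" using e M0 by (simp add: d_def)
  have bound: "v (A $ i $ j * t) < e" if "v t < d" for i j t
  proof -
    have "v (A $ i $ j * t) \<le> (M + 1) * v t"
      unfolding mult using M[of i j] v_nonneg[of t] by (intro mult_right_mono) auto
    also have "\<dots> < (M + 1) * d" using that M0 by (rule mult_strict_left_mono)
    also have "\<dots> = e" using M0 by (simp add: d_def)
    finally show ?thesis .
  qed
  have "v ((A ** y) $ i $ j - (A ** x) $ i $ j) < e \<and> v ((y ** A) $ i $ j - (x ** A) $ i $ j) < e"
    if xy: "\<forall>i j. v (y $ i $ j - x $ i $ j) < d" for x y :: "'f ^ 'n ^ 'n" and i j
  proof
    have "(A ** y) $ i $ j - (A ** x) $ i $ j = (\<Sum>k\<in>UNIV. A $ i $ k * (y $ k $ j - x $ k $ j))"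
      by (simp add: matrix_matrix_mult_def right_diff_distrib sum_subtractf)
    then show "v ((A ** y) $ i $ j - (A ** x) $ i $ j) < e"
      using v_sum_less[OF finite e, of UNIV "\<lambda>k. A $ i $ k * (y $ k $ j - x $ k $ j)"] bound xy by simp
    have "(y ** A) $ i $ j - (x ** A) $ i $ j = (\<Sum>k\<in>UNIV. A $ k $ j * (y $ i $ k - x $ i $ k))"
      by (simp add: matrix_matrix_mult_def right_diff_distrib sum_subtractf mult.commute)
    then show "v ((y ** A) $ i $ j - (x ** A) $ i $ j) < e"
      using v_sum_less[OF finite e, of UNIV "\<lambda>k. A $ k $ j * (y $ i $ k - x $ i $ k)"] bound xy by simp
  qed
  then show ?thesis using d by (intro exI[of _ d]) auto
qed

lemma translation_group_rational_points:
  fixes GG :: "('f alg_closure ^ 'n ^ 'n) set"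
  assumes GG: "subgroup GG gl_group"
  shows "translation_group (rational_points GG) (rational_points_topology v GG)"
proof -
  let ?G = "rational_points GG" and ?T = "rational_points_topology v GG"
  interpret G: group ?G by (rule group_rational_points[OF GG])
  have m: "A \<otimes>\<^bsub>?G\<^esub> B = A ** B" for A B by (simp add: rational_points_def gl_group_def)
  have "openin ?T (carrier ?G)" unfolding openin_rational_points by (auto intro: exI[of _ 1])
  moreover have "U \<subseteq> carrier ?G" if "openin ?T U" for U
    using that unfolding openin_rational_points by (rule conjunct1)
  ultimately have ts: "topspace ?T = carrier ?G"
    using openin_subset[of ?T "carrier ?G"] by (intro subset_antisym) auto
  have cont: "continuous_map ?T ?T h"
    if h: "\<And>x. x \<in> carrier ?G \<Longrightarrow> h x \<in> carrier ?G"
      and b: "\<And>e. e > 0 \<Longrightarrow> \<exists>d>0. \<forall>x y. (\<forall>i j. v (y $ i $ j - x $ i $ j) < d) \<longrightarrow>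
        (\<forall>i j. v (h y $ i $ j - h x $ i $ j) < e)" for h
    unfolding continuous_map ts
  proof (intro conjI allI impI)
    show "h ` carrier ?G \<subseteq> carrier ?G" using h by auto
    fix U assume U: "openin ?T U"
    show "openin ?T {x \<in> carrier ?G. h x \<in> U}"
      unfolding openin_rational_points
    proof (intro conjI ballI)
      fix x assume x: "x \<in> {x \<in> carrier ?G. h x \<in> U}"
      then obtain e where e: "e > 0"
        "\<And>y. y \<in> carrier ?G \<Longrightarrow> (\<forall>i j. v (y $ i $ j - h x $ i $ j) < e) \<Longrightarrow> y \<in> U"
        using U unfolding openin_rational_points by blast
      obtain d where d: "d > 0" "\<forall>x y. (\<forall>i j. v (y $ i $ j - x $ i $ j) < d) \<longrightarrow>
        (\<forall>i j. v (h y $ i $ j - h x $ i $ j) < e)"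
        using b[OF e(1)] by auto
      show "\<exists>e>0. \<forall>y\<in>carrier ?G. (\<forall>i j. v (y $ i $ j - x $ i $ j) < e) \<longrightarrow> y \<in> {x \<in> carrier ?G. h x \<in> U}"
        using d e(2) h by (intro exI[of _ d]) auto
    qed auto
  qed
  show ?thesis
  proof unfold_locales
    show "topspace ?T = carrier ?G" by (rule ts)
    fix g assume g: "g \<in> carrier ?G"
    have d: "\<exists>d>0. \<forall>x y. (\<forall>i j. v (y $ i $ j - x $ i $ j) < d) \<longrightarrow>
        (\<forall>i j. v ((g ** y) $ i $ j - (g ** x) $ i $ j) < e) \<and>
        (\<forall>i j. v ((y ** g) $ i $ j - (x ** g) $ i $ j) < e)" if e: "e > 0" for e
      using v_matrix_mult_bound[OF e, of g] .
    show "continuous_map ?T ?T (\<lambda>x. g \<otimes>\<^bsub>?G\<^esub> x)"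
    proof (rule cont)
      fix e :: real assume "e > 0"
      from d[OF this] show "\<exists>d>0. \<forall>x y. (\<forall>i j. v (y $ i $ j - x $ i $ j) < d) \<longrightarrow>
        (\<forall>i j. v ((g \<otimes>\<^bsub>?G\<^esub> y) $ i $ j - (g \<otimes>\<^bsub>?G\<^esub> x) $ i $ j) < e)" unfolding m by auto
    qed (use g in auto)
    show "continuous_map ?T ?T (\<lambda>x. x \<otimes>\<^bsub>?G\<^esub> g)"
    proof (rule cont)
      fix e :: real assume "e > 0"
      from d[OF this] show "\<exists>d>0. \<forall>x y. (\<forall>i j. v (y $ i $ j - x $ i $ j) < d) \<longrightarrow>
        (\<forall>i j. v ((y \<otimes>\<^bsub>?G\<^esub> g) $ i $ j - (x \<otimes>\<^bsub>?G\<^esub> g) $ i $ j) < e)" unfolding m by auto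
    qed (use g in auto)
  qed
qed

text \<open>A coset is open, so it contains a cube of some radius \<open>1/(m+1)\<close> around one of its points \<open>x\<close>, and \<open>x\<close> is within that distance
  of a member \<open>d\<close> of a countable dense set of matrices.  The pair of \<open>m\<close> and \<open>d\<close> determines the coset: by the
  ultrametric inequality any two points with these properties lie in the cube around either of them.  The matrices \<open>d\<close> need
  not belong to the group, so a point of the group is chosen for each pair.\<close>

lemma countable_rcosets:
  fixes GG :: "('f alg_closure ^ 'n ^ 'n) set"
  assumes J: "compact_open_subgroup (rational_points GG) (rational_points_topology v GG) J"
  shows "countable (rcosets\<^bsub>rational_points GG\<^esub> J)"
proof -
  let ?G = "rational_points GG" and ?T = "rational_points_topology v GG"
  interpret compact_open_subgroup ?G ?T J by (rule J)
  obtain D where D: "countable D" "\<And>x e. e > 0 \<Longrightarrow> \<exists>d\<in>D. v (x - d) < e"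
    by (rule countable_dense) (rule that)
  define DD :: "('f ^ 'n ^ 'n) set" where
    "DD = (\<lambda>f. \<chi> i j. f (i, j)) ` (Pi\<^sub>E UNIV (\<lambda>_. D))"
  have DD: "countable DD"
    unfolding DD_def using D(1) by (intro countable_image countable_PiE) auto
  have dense: "\<exists>d\<in>DD. \<forall>i j. v (x $ i $ j - d $ i $ j) < e" if e: "e > 0" for x e
  proof -
    have "\<forall>k. \<exists>d. d \<in> D \<and> v (x $ fst k $ snd k - d) < e" using D(2)[OF e] by blast
    from choice[OF this] obtain f where f: "\<forall>k. f k \<in> D \<and> v (x $ fst k $ snd k - f k) < e"
      by (rule exE)
    have "(\<chi> i j. f (i, j)) \<in> DD" using f by (auto simp: DD_def)
    moreover have "v (x $ i $ j - (\<chi> i j. f (i, j)) $ i $ j) < e" for i j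
      using spec[OF f, of "(i, j)"] by simp
    ultimately show ?thesis by blast
  qed
  define r where "r m = inverse (real (Suc m))" for m
  have r: "r m > 0" for m by (simp add: r_def)
  define near where "near m d x \<longleftrightarrow> x \<in> carrier ?G \<and> (\<forall>i j. v (x $ i $ j - d $ i $ j) < r m) \<and>
    (\<forall>y\<in>carrier ?G. (\<forall>i j. v (y $ i $ j - x $ i $ j) < r m) \<longrightarrow> y \<in> J #>\<^bsub>?G\<^esub> x)" for m d x
  have "rcosets\<^bsub>?G\<^esub> J \<subseteq> (\<lambda>(m, d). J #>\<^bsub>?G\<^esub> (SOME x. near m d x)) ` (UNIV \<times> DD)"
  proof
    fix C assume C: "C \<in> rcosets\<^bsub>?G\<^esub> J"
    then obtain x where x: "x \<in> carrier ?G" "C = J #>\<^bsub>?G\<^esub> x" by (auto simp: RCOSETS_def)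
    have "openin ?T C" unfolding x(2) r_coset_image using open_r_trans[OF J_open x(1)] .
    moreover have "x \<in> C" unfolding x(2) using x(1) by (simp add: r_coset_iff)
    ultimately obtain e where e: "e > 0"
      "\<And>y. y \<in> carrier ?G \<Longrightarrow> (\<forall>i j. v (y $ i $ j - x $ i $ j) < e) \<Longrightarrow> y \<in> C"
      unfolding openin_rational_points by blast
    obtain m where m: "r m < e" using reals_Archimedean[OF e(1)] by (auto simp: r_def)
    obtain d where d: "d \<in> DD" "\<And>i j. v (x $ i $ j - d $ i $ j) < r m" using dense[OF r] by blast
    have nx: "near m d x"
      unfolding near_def
    proof (intro conjI ballI impI allI)
      fix y assume "y \<in> carrier ?G" "\<forall>i j. v (y $ i $ j - x $ i $ j) < r m"
      then show "y \<in> J #>\<^bsub>?G\<^esub> x" using e(2)[of y] m x(2) by (meson less_trans)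
    qed (use x d in auto)
    define x' where "x' = (SOME x. near m d x)"
    have nx': "near m d x'" unfolding x'_def by (rule someI[of "near m d", OF nx])
    have x'G: "x' \<in> carrier ?G" and x'd: "\<forall>i j. v (x' $ i $ j - d $ i $ j) < r m"
      and x'C: "\<forall>y\<in>carrier ?G. (\<forall>i j. v (y $ i $ j - x' $ i $ j) < r m) \<longrightarrow> y \<in> J #>\<^bsub>?G\<^esub> x'"
      by (fact conjunct1[OF nx'[unfolded near_def]]
        conjunct1[OF conjunct2[OF nx'[unfolded near_def]]]
        conjunct2[OF conjunct2[OF nx'[unfolded near_def]]])+
    have "v (x $ i $ j - x' $ i $ j) < r m" for i j
    proof (rule v_triangle[OF d(2)])
      show "v (d $ i $ j - x' $ i $ j) < r m"
        using x'd v_diff_commute[of "x' $ i $ j" "d $ i $ j"] by metis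
    qed
    then have xx': "x \<in> J #>\<^bsub>?G\<^esub> x'" using bspec[OF x'C x(1)] by blast
    have "C = J #>\<^bsub>?G\<^esub> x'" using r_coset_eq[OF x'G xx'] x(2) by simp
    then show "C \<in> (\<lambda>(m, d). J #>\<^bsub>?G\<^esub> (SOME x. near m d x)) ` (UNIV \<times> DD)"
      using d(1) unfolding x'_def by (intro image_eqI[of _ _ "(m, d)"]) auto
  qed
  then show ?thesis
    by (rule countable_subset) (intro countable_image countable_SIGMA countableI_type DD)
qed

end

section \<open>Eigenfunctions for a type in a reductive group\<close>

lemma vectorspace_Hom_J:
  assumes lam: "is_rep H (W, \<sigma>)" and V: "is_rep H (V, \<rho>)"
  shows "vectorspace CC (hom_space H (W, \<sigma>) (V, \<rho>))"
proof -
  note W' = is_repD[OF lam] and V' = is_repD[OF V]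
  interpret W: cvs W by (rule cvsI[OF W'(1)])
  interpret V: cvs V by (rule cvsI[OF V'(1)])
  note cl = linear_maps_closed[OF W'(1) V'(1)]
  have inW: "\<alpha> w \<in> carrier V" if "\<alpha> \<in> intertwiners H (W, \<sigma>) (V, \<rho>)" "w \<in> carrier W" for \<alpha> w
    using module_homD(1)[OF intertwinersD(2)[OF that(1)] that(2)] .
  have r: "\<rho> g (x \<oplus>\<^bsub>V\<^esub> y) = \<rho> g x \<oplus>\<^bsub>V\<^esub> \<rho> g y" "\<rho> g (c \<odot>\<^bsub>V\<^esub> x) = c \<odot>\<^bsub>V\<^esub> \<rho> g x" "\<rho> g \<zero>\<^bsub>V\<^esub> = \<zero>\<^bsub>V\<^esub>"
    if "g \<in> carrier H" "x \<in> carrier V" "y \<in> carrier V" for g x y c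
    using module_homD(2,3)[OF V'(2)[OF that(1)]] that
      clinear.zero[OF clinearI[OF V'(1) V'(1) V'(2)[OF that(1)]]] by auto
  show ?thesis
    unfolding hom_space_def fst_conv
  proof (rule vectorspace_pointwise[OF V'(1)])
    show "intertwiners H (W, \<sigma>) (V, \<rho>) \<subseteq> carrier W \<rightarrow>\<^sub>E carrier V"
      by (rule subset_trans[OF _ linear_maps_subset]) (rule subsetI, erule intertwinersD(1))
    show "(\<lambda>x\<in>carrier W. \<zero>\<^bsub>V\<^esub>) \<in> intertwiners H (W, \<sigma>) (V, \<rho>)"
      using cl(1) W'(3) r(3)[OF _ V.zero_closed V.zero_closed] by (intro intertwinersI) auto
    show "(\<lambda>x\<in>carrier W. f x \<oplus>\<^bsub>V\<^esub> g x) \<in> intertwiners H (W, \<sigma>) (V, \<rho>)"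
      if f: "f \<in> intertwiners H (W, \<sigma>) (V, \<rho>)" and g: "g \<in> intertwiners H (W, \<sigma>) (V, \<rho>)" for f g
      using cl(2)[OF intertwinersD(1)[OF f] intertwinersD(1)[OF g]] W'(3) r(1) inW f g
        intertwinersD(3)[OF f] intertwinersD(3)[OF g] by (intro intertwinersI) auto
    show "(\<lambda>x\<in>carrier W. c \<odot>\<^bsub>V\<^esub> f x) \<in> intertwiners H (W, \<sigma>) (V, \<rho>)"
      if f: "f \<in> intertwiners H (W, \<sigma>) (V, \<rho>)" for c f
      using cl(3)[OF intertwinersD(1)[OF f]] W'(3) r(2)[OF _ _ V.zero_closed] inW f
        intertwinersD(3)[OF f] by (intro intertwinersI) auto
  qed
qed

theorem theorem3p11:
  fixes v :: "'f::field \<Rightarrow> real"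
    and GG :: "('f alg_closure ^ 'n ^ 'n) set"
    and G :: "('f ^ 'n ^ 'n) monoid" and T :: "('f ^ 'n ^ 'n) topology"
    and J :: "('f ^ 'n ^ 'n) set"
    and W :: "(complex, 'w) module" and lam :: "'f ^ 'n ^ 'n \<Rightarrow> 'w \<Rightarrow> 'w"
    and V :: "(complex, 'u) module" and \<rho> :: "'f ^ 'n ^ 'n \<Rightarrow> 'u \<Rightarrow> 'u"
    and chi :: "('f ^ 'n ^ 'n \<Rightarrow> ('w \<Rightarrow> complex) \<Rightarrow> 'w \<Rightarrow> complex) \<Rightarrow> complex"
  assumes "nonarch_local_field v"
    and "connected_reductive_group_over GG"
    and "G = rational_points GG" and "T = rational_points_topology v GG"
    and "is_type TYPE('u) G T J (W, lam)"
    and "irreducible_rep G (V, \<rho>)" and "(V, \<rho>) \<in> S_cat G T J (W, lam)"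
    and "vectorspace.fin_dim CC (Hom_J G J (W, lam) (V, \<rho>))"
    and "vectorspace.dim CC (Hom_J G J (W, lam) (V, \<rho>)) = 1"
    and "affords_character G T J (W, lam) (V, \<rho>) chi"
  shows "(vectorspace CC (Hecke_bar_eigen G T J (W, lam) chi) \<and>
          vectorspace.fin_dim CC (Hecke_bar_eigen G T J (W, lam) chi) \<and>
          vectorspace.dim CC (Hecke_bar_eigen G T J (W, lam) chi) \<le> 1) \<and>
         (\<forall>\<Psi>\<in>carrier (Hecke_bar_eigen G T J (W, lam) chi).
            \<forall>w\<in>carrier W. \<forall>w'\<in>carrier (W_dual G T J (W, lam)).
              matrix_coefficient G T (V, \<rho>) (\<lambda>g. \<Psi> (inv\<^bsub>G\<^esub> g) w' w))"
proof -
  interpret nonarch_local_field v by fact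
  have GG: "subgroup GG gl_group"
    using assms(2) by (simp add: connected_reductive_group_over_def algebraic_group_over_def)
  have type: "is_type TYPE('u) G T J (W, lam)" by fact
  have type': "subgroup J G" "compactin T J" "openin T J"
    "smooth_rep (G\<lparr>carrier := J\<rparr>) (subtopology T J) (W, lam)" "irreducible_rep (G\<lparr>carrier := J\<rparr>) (W, lam)"
    using type unfolding is_type_def by simp_all
  have tg: "translation_group G T"
    unfolding assms(3,4) by (rule translation_group_rational_points[OF GG])
  have cos: "compact_open_subgroup G T J"
    by (rule compact_open_subgroup.intro[OF tg compact_open_subgroup_axioms.intro[OF type'(1,3,2)]])
  interpret induction_datum G T J W lam
    by (rule induction_datum.intro[OF cos induction_datum_axioms.intro[OF type'(4,5)]])
  have count: "countable (rcosets\<^bsub>G\<^esub> J)"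
    unfolding assms(3) by (rule countable_rcosets[OF cos[unfolded assms(3,4)]])
  have V: "is_rep G (V, \<rho>)" using irreducible_repD(1)[OF assms(6)] .
  interpret V: cvs V by (rule cvsI[OF is_repD(1)[OF V]])
  have Hom: "Hom_J G J (W, lam) (V, \<rho>) = pointwise_module (carrier W) V (intertwiners GJ (W, lam) (V, \<rho>))"
    by (simp add: Hom_J_def hom_space_def)
  have vHom: "vectorspace CC (Hom_J G J (W, lam) (V, \<rho>))"
    unfolding Hom_J_def by (rule vectorspace_Hom_J[OF lam_rep rep_restrict[OF V]])
  obtain \<alpha> where \<alpha>: "\<alpha> \<in> carrier (Hom_J G J (W, lam) (V, \<rho>))" "\<alpha> \<noteq> \<zero>\<^bsub>Hom_J G J (W, lam) (V, \<rho>)\<^esub>"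
    "\<And>\<beta>. \<beta> \<in> carrier (Hom_J G J (W, lam) (V, \<rho>)) \<Longrightarrow> \<exists>c. \<beta> = c \<odot>\<^bsub>Hom_J G J (W, lam) (V, \<rho>)\<^esub> \<alpha>"
    by (rule dim_1E[OF vHom assms(8,9)]) (rule that)
  have \<alpha>_in: "\<alpha> \<in> intertwiners GJ (W, lam) (V, \<rho>)" using \<alpha>(1) by (simp add: Hom)
  have line: "\<exists>c. \<forall>w\<in>carrier W. \<beta> w = c \<odot>\<^bsub>V\<^esub> \<alpha> w" if b: "\<beta> \<in> intertwiners GJ (W, lam) (V, \<rho>)" for \<beta>
  proof -
    have "\<exists>c. \<beta> = c \<odot>\<^bsub>Hom_J G J (W, lam) (V, \<rho>)\<^esub> \<alpha>" using b by (intro \<alpha>(3)) (simp add: Hom)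
    then show ?thesis by (auto simp: Hom)
  qed
  obtain w0 where w0: "w0 \<in> carrier W" "\<alpha> w0 \<noteq> \<zero>\<^bsub>V\<^esub>"
  proof (rule ccontr)
    assume "\<not> thesis"
    then have "\<forall>w\<in>carrier W. \<alpha> w = \<zero>\<^bsub>V\<^esub>" using that by blast
    then have "\<alpha> = \<zero>\<^bsub>Hom_J G J (W, lam) (V, \<rho>)\<^esub>"
      using intertwinersD(1)[OF \<alpha>_in] by (auto simp: Hom fun_eq_iff linear_maps_def extensional_def)
    then show False using \<alpha>(2) by simp
  qed
  have inj: "inj_on \<alpha> (carrier W)"
    by (rule irreducible_inj[OF lam_irreducible rep_restrict[OF V] \<alpha>_in w0])
  have \<alpha>_nz: "\<alpha> w \<noteq> \<zero>\<^bsub>V\<^esub>" if "w \<in> carrier W" "w \<noteq> \<zero>\<^bsub>W\<^esub>" for w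
    using inj_onD[OF inj, of w "\<zero>\<^bsub>W\<^esub>"] that
      clinear.zero[OF clinearI[OF lamD(1) is_repD(1)[OF V] J_intertwinersD(2)[OF \<alpha>_in]]] by auto
  obtain A where A: "A \<in> intertwiners G (IND, translate) (V, \<rho>)" "frobenius G J (W, lam) A = \<alpha>"
    by (rule frobenius_surj[OF V \<alpha>_in]) (rule that)
  have A_delta: "A (delta w) = \<alpha> w" if "w \<in> carrier W" for w
    using fun_cong[OF A(2), of w] that by (simp add: frobenius_eq)
  have A_hecke: "A (hecke_fun \<phi> w) = chi \<phi> \<odot>\<^bsub>V\<^esub> \<alpha> w" if \<phi>: "\<phi> \<in> HA" and w: "w \<in> carrier W" for \<phi> w
  proof -
    have "Hecke_act G T J (W, lam) (V, \<rho>) \<phi> \<alpha> = chi \<phi> \<odot>\<^bsub>Hom_J G J (W, lam) (V, \<rho>)\<^esub> \<alpha>"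
      using assms(10) \<phi> \<alpha>(1) unfolding affords_character_def by blast
    from fun_cong[OF this, of w] show ?thesis
      unfolding Hecke_act_apply[OF V \<phi> w A] using w by (simp add: Hom)
  qed
  show ?thesis
  proof (intro conjI[OF eigenspace_dim_le_1[OF V \<alpha>_in \<alpha>_nz line]] ballI)
    fix \<Psi> w w'
    assume "\<Psi> \<in> carrier (Hecke_bar_eigen G T J (W, lam) chi)" "w \<in> carrier W" "w' \<in> carrier WD"
    then show "matrix_coefficient G T (V, \<rho>) (\<lambda>g. \<Psi> (inv\<^bsub>G\<^esub> g) w' w)"
      using eigenfunction_matrix_coefficient[OF type assms(6) A(1) \<alpha>_in inj A_delta A_hecke count] by simp
  qed
qed

end
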